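(* Let $N$ be a manifold of dimension $n$ with $n\ge2$. Let $f$ be an immersion of $N$ into an open subset $U$ of $\mathbb{R}^m$. Let $F:U\to\mathbb{R}^{2n-1}$ be a mapping. Then there exists a subset $\Sigma$ of $\mathcal{L}(\mathbb{R}^m,\mathbb{R}^{2n-1})$ with Lebesgue measure zero such that for any $\pi\in\mathcal{L}(\mathbb{R}^m,\mathbb{R}^{2n-1})-\Sigma$, any singular point of the mapping $F_\pi\circ f:N\to\mathbb{R}^{2n-1}$ is a singular point of Whitney umbrella.
   Context: Conventions: $m,n$ are positive integers; all manifolds and mappings are of class $C^\infty$ and all manifolds are without boundary. $\mathcal{L}(\mathbb{R}^m,\mathbb{R}^{\ell})$ is the space of all linear mappings $\mathbb{R}^m\to\mathbb{R}^\ell$, identified with $(\mathbb{R}^m)^\ell$ (via matrices), which gives it Lebesgue measure. For $\pi\in\mathcal{L}(\mathbb{R}^m,\mathbb{R}^\ell)$ and $F:U\to\mathbb{R}^\ell$, $F_\pi=F+\pi|_U:U\to\mathbb{R}^\ell$. A singular point of $g:N\to\mathbb{R}^{2n-1}$ is a point $q$ with $\operatorname{rank}dg_q<n$. For a mapping $g:N\to\mathbb{R}^{2n-1}$ ($n\ge2$), a singular point $q\in N$ is called a singular point of Whitney umbrella if there exist two germs of diffeomorphisms $H:(\mathbb{R}^{2n-1},g(q))\to(\mathbb{R}^{2n-1},0)$ and $h:(N,q)\to(\mathbb{R}^n,0)$ such that $H\circ g\circ h^{-1}(x_1,x_2,\ldots,x_n)=(x_1^2,x_1x_2,\ldots,x_1x_n,x_2,\ldots,x_n)$,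 where $(x_1,\ldots,x_n)$ is a local coordinate around $h(q)=0\in\mathbb{R}^n$. *)

theory Defs
  imports "HOL-Analysis.Analysis"
begin

subsection \<open>Smooth maps on open subsets of Euclidean spaces\<close>

text \<open>
  Both notions below are meant for open \<open>S\<close>: the derivatives are the full ones, taken at the
  points of \<open>S\<close>.
\<close>

fun Ck_on :: "nat \<Rightarrow> ('a::euclidean_space \<Rightarrow> 'b::euclidean_space) \<Rightarrow> 'a set \<Rightarrow> bool" where
  "Ck_on 0 f S \<longleftrightarrow> continuous_on S f"
| "Ck_on (Suc k) f S \<longleftrightarrow>
     (\<forall>x\<in>S. f differentiable (at x)) \<and> (\<forall>v. Ck_on k (\<lambda>x. frechet_derivative f (at x) v) S)"

definition smooth_on :: "'a set \<Rightarrow> ('a::euclidean_space \<Rightarrow> 'b::euclidean_space) \<Rightarrow> bool" where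
  "smooth_on S f \<longleftrightarrow> (\<forall>k. Ck_on k f S)"

definition diffeo_on :: "'a set \<Rightarrow> ('a::euclidean_space \<Rightarrow> 'b::euclidean_space) \<Rightarrow> bool" where
  "diffeo_on S f \<longleftrightarrow> open S \<and> open (f ` S) \<and> inj_on f S \<and>
     smooth_on S f \<and> smooth_on (f ` S) (inv_into S f)"

subsection \<open>Smooth manifolds and maps into Euclidean spaces\<close>

text \<open>
  A chart is a pair \<open>(V, \<phi>)\<close>; only the values of \<open>\<phi>\<close> on \<open>V\<close> are relevant. A manifold is a
  Hausdorff, second countable space \<open>N\<close> together with a (not necessarily maximal) atlas \<open>A\<close>; its
  dimension is \<open>CARD('n)\<close>, and \<open>N\<close> is allowed to be disconnected.
\<close>

type_synonym ('a, 'n) chart = "'a set \<times> ('a \<Rightarrow> real^'n)"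

definition is_chart :: "'a topology \<Rightarrow> ('a, 'n::finite) chart \<Rightarrow> bool" where
  "is_chart N = (\<lambda>(V, \<phi>). openin N V \<and> open (\<phi> ` V) \<and>
     homeomorphic_map (subtopology N V) (top_of_set (\<phi> ` V)) \<phi>)"

definition smooth_transition :: "('a, 'n::finite) chart \<Rightarrow> ('a, 'n) chart \<Rightarrow> bool" where
  "smooth_transition = (\<lambda>(V, \<phi>) (W, \<psi>). smooth_on (\<phi> ` (V \<inter> W)) (\<psi> \<circ> inv_into V \<phi>))"

definition smooth_manifold :: "'a topology \<Rightarrow> ('a, 'n::finite) chart set \<Rightarrow> bool" where
  "smooth_manifold N A \<longleftrightarrow> Hausdorff_space N \<and> second_countable N \<and>
     (\<forall>c\<in>A. is_chart N c) \<and> (\<Union>c\<in>A. fst c) = topspace N \<and>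
     (\<forall>c\<in>A. \<forall>d\<in>A. smooth_transition c d)"

text \<open>The charts of the smooth structure generated by \<open>A\<close>, i.e. the diffeomorphisms from an open
  subset of the manifold onto an open subset of \<open>real^'n\<close>.\<close>

definition compatible_chart ::
  "'a topology \<Rightarrow> ('a, 'n::finite) chart set \<Rightarrow> ('a, 'n) chart \<Rightarrow> bool" where
  "compatible_chart N A c \<longleftrightarrow>
     is_chart N c \<and> (\<forall>d\<in>A. smooth_transition c d \<and> smooth_transition d c)"

definition in_chart :: "('a \<Rightarrow> 'b) \<Rightarrow> ('a, 'n::finite) chart \<Rightarrow> real^'n \<Rightarrow> 'b" where
  "in_chart g = (\<lambda>(V, \<phi>). g \<circ> inv_into V \<phi>)"

definition smooth_map :: "('a, 'n::finite) chart set \<Rightarrow> ('a \<Rightarrow> real^'k::finite) \<Rightarrow> bool" where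
  "smooth_map A g \<longleftrightarrow> (\<forall>c\<in>A. smooth_on (snd c ` fst c) (in_chart g c))"

text \<open>The rank of the differential of \<open>g\<close> at \<open>q\<close>, computed in a chart around \<open>q\<close>. It does not
  depend on the chart of an atlas, so the choices of quantifier over \<open>c\<close> below are immaterial.\<close>

definition rank_at :: "('a, 'n::finite) chart \<Rightarrow> ('a \<Rightarrow> real^'k::finite) \<Rightarrow> 'a \<Rightarrow> nat" where
  "rank_at c g q = rank (jacobian (in_chart g c) (at (snd c q)))"

definition immersion :: "('a, 'n::finite) chart set \<Rightarrow> ('a \<Rightarrow> real^'k::finite) \<Rightarrow> bool" where
  "immersion A g \<longleftrightarrow> smooth_map A g \<and> (\<forall>c\<in>A. \<forall>q\<in>fst c. rank_at c g q = CARD('n))"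

definition singular_point :: "('a, 'n::finite) chart set \<Rightarrow> ('a \<Rightarrow> real^'k::finite) \<Rightarrow> 'a \<Rightarrow> bool"
  where "singular_point A g q \<longleftrightarrow> (\<exists>c\<in>A. q \<in> fst c \<and> rank_at c g q < CARD('n))"

subsection \<open>Whitney umbrellas\<close>

text \<open>
  \<open>coord x k\<close> is the coordinate $x_{k+1}$, with respect to a fixed enumeration of the index type by
  \<open>{..<CARD('n)}\<close>; \<open>to_nat_on UNIV\<close> is the inverse enumeration.
\<close>

definition coord :: "real^'n::finite \<Rightarrow> nat \<Rightarrow> real" where
  "coord x k = x $ from_nat_into UNIV k"

text \<open>
  The map $(x_1^2, x_1 x_2, \ldots, x_1 x_n, x_2, \ldots, x_n)$, for \<open>CARD('p) = 2 * CARD('n) - 1\<close>;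
  the first \<open>CARD('n)\<close> components are $x_1 x_{i+1}$ for \<open>i < CARD('n)\<close>.
\<close>

definition umbrella_normal_form :: "real^'n::finite \<Rightarrow> real^'p::finite" where
  "umbrella_normal_form x = (\<chi> j. let i = to_nat_on UNIV j in
     if i < CARD('n) then coord x 0 * coord x i else coord x (i + 1 - CARD('n)))"

lemma coord_umbrella_normal_form:
  fixes x :: "real^'n::finite"
  defines "w \<equiv> umbrella_normal_form x :: real^'p::finite"
  assumes "CARD('p) = 2 * CARD('n) - 1"
  shows "coord w 0 = (coord x 0)\<^sup>2"
    and "\<lbrakk>1 \<le> i; i < CARD('n)\<rbrakk> \<Longrightarrow> coord w i = coord x 0 * coord x i"
    and "\<lbrakk>1 \<le> i; i < CARD('n)\<rbrakk> \<Longrightarrow> coord w (CARD('n) - 1 + i) = coord x i"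
proof -
  have idx: "to_nat_on (UNIV :: 'p set) (from_nat_into UNIV i) = i" if "i < CARD('p)" for i
    using that to_nat_on_finite[of "UNIV :: 'p set"]
    by (intro to_nat_on_from_nat_into) (auto simp: bij_betw_def)
  have w: "coord w i =
      (if i < CARD('n) then coord x 0 * coord x i else coord x (i + 1 - CARD('n)))"
    if "i < CARD('p)" for i
    using idx[OF that] by (simp add: w_def coord_def umbrella_normal_form_def)
  show "coord w 0 = (coord x 0)\<^sup>2"
    using w[of 0] by (simp add: power2_eq_square)
  show "coord w i = coord x 0 * coord x i" if "1 \<le> i" "i < CARD('n)"
    using that assms(2) by (subst w) auto
  show "coord w (CARD('n) - 1 + i) = coord x i" if "1 \<le> i" "i < CARD('n)"
    using that assms(2) by (subst w) auto
qed

text \<open>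
  The germs of diffeomorphisms are represented by a chart \<open>(V, h)\<close> centred at \<open>q\<close> and a
  diffeomorphism \<open>H\<close> from an open neighbourhood \<open>Y\<close> of \<open>g q\<close> onto an open neighbourhood of \<open>0\<close>.
\<close>

definition whitney_umbrella_point ::
  "'a topology \<Rightarrow> ('a, 'n::finite) chart set \<Rightarrow> ('a \<Rightarrow> real^'p::finite) \<Rightarrow> 'a \<Rightarrow> bool" where
  "whitney_umbrella_point N A g q \<longleftrightarrow> singular_point A g q \<and>
     (\<exists>V h Y H. compatible_chart N A (V, h) \<and> q \<in> V \<and> h q = 0 \<and>
        diffeo_on Y H \<and> g q \<in> Y \<and> H (g q) = (0 :: real^'p) \<and>
        (\<forall>\<^sub>F x in nhds 0. (H \<circ> g \<circ> inv_into V h) x = umbrella_normal_form x))"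

end

theory Submission
  imports Defs
begin

text \<open>
  Let \<open>G\<close> be a map from an \<open>n\<close>-dimensional space to a space of dimension \<open>2n - 1\<close>. At a singular
  point \<open>x\<close> some \<open>v \<noteq> 0\<close> satisfies \<open>DG(x) v = 0\<close>. A point together with a direction has
  \<open>n + (n - 1) = 2n - 1\<close> parameters, as many as there are equations, so one expects that for a generic
  \<open>G\<close> the solutions are nondegenerate: the linearised equation
  \<open>D(DG(\<cdot>) v)(x) \<xi> + DG(x) \<eta> = 0\<close> only has the solutions \<open>\<xi> = 0\<close>, \<open>\<eta> \<in> span {v}\<close>. This condition is
  \<open>whitney_nondegenerate\<close>.

  Linear perturbations suffice to reach the generic case. For \<open>G = \<Phi> + \<pi> \<circ> e\<close> with an immersion \<open>e\<close>
  the equation reads \<open>D\<Phi>(x) v + \<pi> u = 0\<close> with \<open>u = De(x) v \<noteq> 0\<close>. It can be solved for one column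
  of the matrix of \<open>\<pi>\<close>, in terms of \<open>x\<close>, \<open>v\<close> and the other columns. The matrices that admit a
  solution thus are the values of a map between spaces of equal dimension, those with a degenerate
  solution are critical values of it, and Sard's theorem in equal dimensions shows that they form a
  null set (\<open>negligible_degenerate_perturbations\<close>). Since the manifold is second countable, countably
  many charts cover it, and the null sets for these charts add up to a null set.

  It remains to see that a nondegenerate singular point is a Whitney umbrella
  (\<open>umbrella_germ_of_whitney_nondegenerate\<close>). Linear algebra and the inverse function theorem bring
  \<open>G\<close> into the form \<open>(A(t, z), z)\<close> with \<open>n\<close> functions \<open>A\<close>, where \<open>\<partial>/\<partial>t\<close> is the kernel direction, and
  a parametrised Morse lemma turns the first of these functions into \<open>c(z) + t\<^sup>2\<close>. Splitting \<open>A\<close>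
  into its even and its odd part in \<open>t\<close> gives \<open>A(t, z) = a(t\<^sup>2, z) + t b(t\<^sup>2, z)\<close> with smooth \<open>a\<close> and
  \<open>b\<close> (\<open>even_odd_decomposition\<close>). A diffeomorphism of the target subtracts \<open>a\<close> and \<open>c\<close>, and
  nondegeneracy says that the components of \<open>b\<close> other than the first can replace \<open>z\<close> as
  coordinates. The result is \<open>(t\<^sup>2, t b, b)\<close>, the normal form.

  The analytic core is the theorem of Whitney that an even smooth function of \<open>t\<close> is a smooth function
  of \<open>t\<^sup>2\<close> (\<open>even_function_smooth_in_square\<close>). The function of \<open>t\<^sup>2\<close> is needed for negative arguments
  too, since the diffeomorphism of the target is defined on a full neighbourhood. It is obtained there
  by Seeley's extension, a series of reflections.
\<close>

section \<open>Calculus of smooth maps on open sets\<close>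

abbreviation (input) fd :: "('a::euclidean_space \<Rightarrow> 'b::euclidean_space) \<Rightarrow> 'a \<Rightarrow> 'a \<Rightarrow> 'b" where
  "fd f x \<equiv> frechet_derivative f (at x)"

lemma fderiv_eqI: "(f has_derivative f') (at x) \<Longrightarrow> fd f x = f'"
  using frechet_derivative_at by metis

lemma Ck_on_cong:
  assumes "open S" "\<And>x. x \<in> S \<Longrightarrow> f x = g x"
  shows "Ck_on k f S \<longleftrightarrow> Ck_on k g S"
proof -
  have main: "Ck_on k f S \<Longrightarrow> Ck_on k g S" if "\<And>x. x \<in> S \<Longrightarrow> f x = g x" for f g
    using that
  proof (induction k arbitrary: f g)
    case 0
    then show ?case using continuous_on_cong[of S S f g] by auto
  next
    case (Suc k)
    have d: "(g has_derivative fd f x) (at x)" if "x \<in> S" for x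
    proof -
      have "(f has_derivative fd f x) (at x)"
        using Suc.prems(1) that frechet_derivative_works by auto
      then show ?thesis
        using has_derivative_transform_within_open[OF _ \<open>open S\<close> that] Suc.prems(2) by blast
    qed
    have e: "fd g x = fd f x" if "x \<in> S" for x
      using d[OF that] fderiv_eqI by blast
    show ?case
      using d Suc.prems Suc.IH[of "\<lambda>x. fd f x v" "\<lambda>x. fd g x v" for v]
      by (auto simp: e differentiable_def)
  qed
  show ?thesis using main[of f g] main[of g f] assms(2) by auto
qed

text \<open>
  Derivatives given by a formula serve as well as the chosen \<open>frechet_derivative\<close>. Every closure
  property below passes from \<open>k\<close> to \<open>Suc k\<close> in this way.
\<close>

lemma Ck_on_SucI:
  assumes "open S" "\<And>x. x \<in> S \<Longrightarrow> (f has_derivative f' x) (at x)"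
    and "\<And>v. Ck_on k (\<lambda>x. f' x v) S"
  shows "Ck_on (Suc k) f S"
proof -
  have "fd f x = f' x" if "x \<in> S" for x
    using assms(2)[OF that] fderiv_eqI by blast
  then have "Ck_on k (\<lambda>x. fd f x v) S" for v
    using Ck_on_cong[OF assms(1), of "\<lambda>x. fd f x v" "\<lambda>x. f' x v"] assms(3) by auto
  then show ?thesis using assms(2) by (auto simp: differentiable_def)
qed

lemma Ck_on_SucD: "Ck_on (Suc k) f S \<Longrightarrow> Ck_on k f S"
proof (induction k arbitrary: f)
  case 0
  then show ?case
    by (auto intro!: continuous_at_imp_continuous_on differentiable_imp_continuous_within)
next
  case (Suc k)
  then show ?case by (subst Ck_on.simps) (auto simp del: Ck_on.simps simp: Ck_on.simps(2)[of "Suc k"])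
qed

lemma Ck_on_has_derivative:
  "Ck_on (Suc k) f S \<Longrightarrow> x \<in> S \<Longrightarrow> (f has_derivative fd f x) (at x)"
  using frechet_derivative_works by auto

lemma Ck_on_subset: "Ck_on k f S \<Longrightarrow> T \<subseteq> S \<Longrightarrow> Ck_on k f T"
  by (induction k arbitrary: f) (auto intro: continuous_on_subset)

lemma Ck_on_const: "open S \<Longrightarrow> Ck_on k (\<lambda>x. c) S"
  by (induction k arbitrary: c)
    (auto intro!: Ck_on_SucI[where f'="\<lambda>x v. 0"] simp del: Ck_on.simps(2))

lemma Ck_on_bounded_linear:
  assumes "open S" "bounded_linear L" shows "Ck_on k L S"
proof (cases k)
  case 0
  then show ?thesis using assms by (simp add: linear_continuous_on)
next
  case (Suc j)
  show ?thesis unfolding Suc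
    by (rule Ck_on_SucI[where f'="\<lambda>x. L"]) (use assms in \<open>auto intro: bounded_linear_imp_has_derivative Ck_on_const\<close>)
qed

lemma Ck_on_bounded_linear_compose:
  assumes "bounded_linear L" "open S"
  shows "Ck_on k f S \<Longrightarrow> Ck_on k (\<lambda>x. L (f x)) S"
proof (induction k arbitrary: f)
  case 0
  then show ?case using assms
    by (auto intro: bounded_linear.continuous_on)
next
  case (Suc k)
  show ?case
    by (rule Ck_on_SucI[where f'="\<lambda>x v. L (fd f x v)"])
      (use Suc.prems[unfolded Ck_on.simps] in
        \<open>auto intro!: bounded_linear.has_derivative[OF assms(1)] assms Suc.IH Ck_on_has_derivative[OF Suc.prems]\<close>)
qed

lemma Ck_on_add:
  assumes "open S"
  shows "Ck_on k f S \<Longrightarrow> Ck_on k g S \<Longrightarrow> Ck_on k (\<lambda>x. f x + g x) S"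
proof (induction k arbitrary: f g)
  case 0
  then show ?case by (auto intro: continuous_on_add)
next
  case (Suc k)
  show ?case
    by (rule Ck_on_SucI[where f'="\<lambda>x v. fd f x v + fd g x v"])
      (use Suc.prems[unfolded Ck_on.simps] in
        \<open>auto intro!: has_derivative_add assms Suc.IH Ck_on_has_derivative[OF Suc.prems(1)]
          Ck_on_has_derivative[OF Suc.prems(2)]\<close>)
qed

lemma Ck_on_sum:
  assumes "open S" "\<And>i. i \<in> I \<Longrightarrow> Ck_on k (f i) S"
  shows "Ck_on k (\<lambda>x. \<Sum>i\<in>I. f i x) S"
  using assms(2)
proof (induction I rule: infinite_finite_induct)
  case (insert i I)
  then show ?case using Ck_on_add[OF assms(1)] by auto
qed (auto intro: Ck_on_const assms(1))

lemma Ck_on_bilinear: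
  assumes "open S" "bounded_bilinear b"
  shows "Ck_on k f S \<Longrightarrow> Ck_on k g S \<Longrightarrow> Ck_on k (\<lambda>x. b (f x) (g x)) S"
proof (induction k arbitrary: f g)
  case 0
  then show ?case using bounded_bilinear.continuous_on[OF assms(2)] by auto
next
  case (Suc k)
  have fg: "Ck_on k f S" "Ck_on k g S" using Suc.prems Ck_on_SucD by auto
  show ?case
  proof (rule Ck_on_SucI[where f'="\<lambda>x v. b (f x) (fd g x v) + b (fd f x v) (g x)"])
    show "((\<lambda>x. b (f x) (g x)) has_derivative
       (\<lambda>v. b (f x) (fd g x v) + b (fd f x v) (g x))) (at x)"
      if "x \<in> S" for x
      by (rule bounded_bilinear.FDERIV[OF assms(2)]; rule Ck_on_has_derivative) (rule Suc.prems that)+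
    show "Ck_on k (\<lambda>x. b (f x) (fd g x v) + b (fd f x v) (g x)) S" for v
      by (intro Ck_on_add[OF assms(1)] Suc.IH fg) (use Suc.prems in auto)
  qed (rule assms)
qed

lemma linear_eq_Basis_sum:
  fixes L :: "'a::euclidean_space \<Rightarrow> 'b::real_vector"
  assumes "linear L"
  shows "L v = (\<Sum>b\<in>Basis. (v \<bullet> b) *\<^sub>R L b)"
proof -
  have "L v = L (\<Sum>b\<in>Basis. (v \<bullet> b) *\<^sub>R b)" by (simp add: euclidean_representation)
  then show ?thesis by (simp add: linear_sum[OF assms] linear_cmul[OF assms])
qed

text \<open>
  By the chain rule and linearity, a directional derivative of the composite is a sum of products of
  components of \<open>Df(x) v\<close> with the functions \<open>Dg(f x) b\<close>, for basis vectors \<open>b\<close>. The induction hypothesis,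
  for all \<open>g\<close>, applies to the latter.
\<close>

lemma Ck_on_compose:
  fixes g :: "'b::euclidean_space \<Rightarrow> 'c::euclidean_space" and f :: "'a::euclidean_space \<Rightarrow> 'b"
  assumes "open S" "open T" "f ` S \<subseteq> T"
  shows "Ck_on k g T \<Longrightarrow> Ck_on k f S \<Longrightarrow> Ck_on k (\<lambda>x. g (f x)) S"
proof (induction k arbitrary: g)
  case 0
  then show ?case using assms continuous_on_compose2[of T g S f] by auto
next
  case (Suc k)
  have f: "Ck_on k f S" using Suc.prems Ck_on_SucD by auto
  let ?f' = "\<lambda>x. fd f x" and ?g' = "\<lambda>x. fd g x"
  show ?case
  proof (rule Ck_on_SucI[where f'="\<lambda>x v. \<Sum>b\<in>Basis. (?f' x v \<bullet> b) *\<^sub>R ?g' (f x) b"])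
    fix x assume x: "x \<in> S"
    have g: "(g has_derivative ?g' (f x)) (at (f x))"
      using Suc.prems(1) assms x by (intro Ck_on_has_derivative) auto
    have "((\<lambda>x. g (f x)) has_derivative (\<lambda>v. ?g' (f x) (?f' x v))) (at x)"
      using has_derivative_compose[OF Ck_on_has_derivative[OF Suc.prems(2) x], of g "?g' (f x)"] g by simp
    moreover have "(\<lambda>v. ?g' (f x) (?f' x v)) = (\<lambda>v. \<Sum>b\<in>Basis. (?f' x v \<bullet> b) *\<^sub>R ?g' (f x) b)"
      by (intro ext linear_eq_Basis_sum has_derivative_linear[OF g])
    ultimately show "((\<lambda>x. g (f x)) has_derivative (\<lambda>v. \<Sum>b\<in>Basis. (?f' x v \<bullet> b) *\<^sub>R ?g' (f x) b)) (at x)"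
      by simp
  next
    fix v
    show "Ck_on k (\<lambda>x. \<Sum>b\<in>Basis. (?f' x v \<bullet> b) *\<^sub>R ?g' (f x) b) S"
      by (intro Ck_on_sum assms Ck_on_bilinear[OF _ bounded_bilinear_scaleR]
          Ck_on_bounded_linear_compose[OF bounded_linear_inner_left] Suc.IH f) (use Suc.prems in auto)
  qed (rule assms)
qed

named_theorems smooth_intros

lemma smooth_on_cong:
  assumes "open S" "\<And>x. x \<in> S \<Longrightarrow> f x = g x"
  shows "smooth_on S f \<longleftrightarrow> smooth_on S g"
  using Ck_on_cong[OF assms] by (simp add: smooth_on_def)

lemma smooth_on_subset: "smooth_on S f \<Longrightarrow> T \<subseteq> S \<Longrightarrow> smooth_on T f"
  by (auto simp: smooth_on_def intro: Ck_on_subset)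

lemma smooth_on_continuous_on: "smooth_on S f \<Longrightarrow> continuous_on S f"
  unfolding smooth_on_def by (metis Ck_on.simps(1))

lemma smooth_on_has_derivative:
  "smooth_on S f \<Longrightarrow> x \<in> S \<Longrightarrow> (f has_derivative fd f x) (at x)"
  unfolding smooth_on_def using Ck_on_has_derivative by blast

lemma smooth_on_linear_fderiv: "smooth_on S f \<Longrightarrow> x \<in> S \<Longrightarrow> linear (fd f x)"
  using has_derivative_linear smooth_on_has_derivative by blast

lemma smooth_on_fderiv: "smooth_on S f \<Longrightarrow> smooth_on S (\<lambda>x. fd f x v)"
  unfolding smooth_on_def by (metis Ck_on.simps(2))

lemma smooth_on_const [smooth_intros]: "open S \<Longrightarrow> smooth_on S (\<lambda>x. c)"
  by (simp add: smooth_on_def Ck_on_const)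

lemma smooth_on_bounded_linear: "open S \<Longrightarrow> bounded_linear L \<Longrightarrow> smooth_on S L"
  by (simp add: smooth_on_def Ck_on_bounded_linear)

lemma smooth_on_linear:
  fixes L :: "'a::euclidean_space \<Rightarrow> 'b::euclidean_space"
  shows "open S \<Longrightarrow> linear L \<Longrightarrow> smooth_on S L"
  by (simp add: smooth_on_bounded_linear linear_conv_bounded_linear)

lemma smooth_on_ident [smooth_intros]: "open S \<Longrightarrow> smooth_on S (\<lambda>x. x)"
  by (simp add: smooth_on_bounded_linear bounded_linear_ident)

lemma smooth_on_linear_compose:
  fixes L :: "'a::euclidean_space \<Rightarrow> 'b::euclidean_space"
  shows "linear L \<Longrightarrow> open S \<Longrightarrow> smooth_on S f \<Longrightarrow> smooth_on S (\<lambda>x. L (f x))"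
  by (simp add: smooth_on_def linear_conv_bounded_linear Ck_on_bounded_linear_compose)

lemma smooth_on_add [smooth_intros]:
  "open S \<Longrightarrow> smooth_on S f \<Longrightarrow> smooth_on S g \<Longrightarrow> smooth_on S (\<lambda>x. f x + g x)"
  by (simp add: smooth_on_def Ck_on_add)

lemma smooth_on_sum [smooth_intros]:
  "open S \<Longrightarrow> (\<And>i. i \<in> I \<Longrightarrow> smooth_on S (f i)) \<Longrightarrow> smooth_on S (\<lambda>x. \<Sum>i\<in>I. f i x)"
  by (simp add: smooth_on_def Ck_on_sum)

lemma smooth_on_scaleR [smooth_intros]:
  "open S \<Longrightarrow> smooth_on S f \<Longrightarrow> smooth_on S g \<Longrightarrow> smooth_on S (\<lambda>x. f x *\<^sub>R g x)"
  by (simp add: smooth_on_def Ck_on_bilinear[OF _ bounded_bilinear_scaleR])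

lemma smooth_on_mult [smooth_intros]:
  fixes f g :: "'a::euclidean_space \<Rightarrow> real"
  shows "open S \<Longrightarrow> smooth_on S f \<Longrightarrow> smooth_on S g \<Longrightarrow> smooth_on S (\<lambda>x. f x * g x)"
  using smooth_on_scaleR[of S f g] by simp

lemma smooth_on_minus [smooth_intros]: "open S \<Longrightarrow> smooth_on S f \<Longrightarrow> smooth_on S (\<lambda>x. - f x)"
  by (rule smooth_on_linear_compose[where L=uminus]) (auto intro: linearI)

lemma smooth_on_diff [smooth_intros]:
  "open S \<Longrightarrow> smooth_on S f \<Longrightarrow> smooth_on S g \<Longrightarrow> smooth_on S (\<lambda>x. f x - g x)"
  using smooth_on_add[of S f "\<lambda>x. - g x"] smooth_on_minus[of S g] by simp

lemma smooth_on_vec_nth [smooth_intros]: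
  fixes f :: "'a::euclidean_space \<Rightarrow> 'b::euclidean_space^'n::finite"
  shows "open S \<Longrightarrow> smooth_on S f \<Longrightarrow> smooth_on S (\<lambda>x. f x $ i)"
  by (rule smooth_on_linear_compose) (auto intro: linearI)

lemma smooth_on_fst [smooth_intros]: "open S \<Longrightarrow> smooth_on S f \<Longrightarrow> smooth_on S (\<lambda>x. fst (f x))"
  by (rule smooth_on_linear_compose) (auto intro: linearI)

lemma smooth_on_snd [smooth_intros]: "open S \<Longrightarrow> smooth_on S f \<Longrightarrow> smooth_on S (\<lambda>x. snd (f x))"
  by (rule smooth_on_linear_compose) (auto intro: linearI)

lemma smooth_on_Pair [smooth_intros]:
  assumes "open S" "smooth_on S f" "smooth_on S g"
  shows "smooth_on S (\<lambda>x. (f x, g x))"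
proof -
  have "smooth_on S (\<lambda>x. (f x, 0) + (0, g x))"
    by (intro smooth_on_add assms smooth_on_linear_compose[OF _ _ assms(2), of "\<lambda>u. (u, 0)"]
        smooth_on_linear_compose[OF _ _ assms(3), of "\<lambda>u. (0, u)"]) (auto intro: linearI)
  then show ?thesis by simp
qed

lemma smooth_on_prod [smooth_intros]:
  fixes f :: "'i \<Rightarrow> 'a::euclidean_space \<Rightarrow> real"
  assumes "open S" "\<And>i. i \<in> I \<Longrightarrow> smooth_on S (f i)"
  shows "smooth_on S (\<lambda>x. \<Prod>i\<in>I. f i x)"
  using assms(2)
proof (induction I rule: infinite_finite_induct)
  case (insert i I)
  then show ?case using smooth_on_mult[OF assms(1)] by auto
qed (auto intro: smooth_on_const assms(1))

lemma smooth_on_power [smooth_intros]: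
  fixes f :: "'a::euclidean_space \<Rightarrow> real"
  shows "open S \<Longrightarrow> smooth_on S f \<Longrightarrow> smooth_on S (\<lambda>x. f x ^ n)"
  by (induction n) (simp_all add: smooth_on_const smooth_on_mult)

lemma Ck_on_vec_lambda:
  fixes f :: "'n::finite \<Rightarrow> 'a::euclidean_space \<Rightarrow> real"
  assumes "open S" "\<And>i. Ck_on k (f i) S"
  shows "Ck_on k (\<lambda>x. \<chi> i. f i x) S"
proof -
  have "Ck_on k (\<lambda>x. \<Sum>i\<in>UNIV. f i x *\<^sub>R axis i (1::real)) S"
    by (intro Ck_on_sum Ck_on_bilinear[OF _ bounded_bilinear_scaleR] Ck_on_const assms)
  moreover have "(\<lambda>x. \<Sum>i\<in>UNIV. f i x *\<^sub>R axis i (1::real)) = (\<lambda>x. \<chi> i. f i x)"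
    by (auto simp: vec_eq_iff axis_def if_distrib[of "(*) _"] cong: if_cong)
  ultimately show ?thesis by simp
qed

lemma smooth_on_vec_lambda [smooth_intros]:
  fixes f :: "'n::finite \<Rightarrow> 'a::euclidean_space \<Rightarrow> real"
  assumes "open S" "\<And>i. smooth_on S (f i)"
  shows "smooth_on S (\<lambda>x. \<chi> i. f i x)"
  using assms by (auto simp: smooth_on_def intro!: Ck_on_vec_lambda)

lemma smooth_on_compose:
  assumes "smooth_on T g" "smooth_on S f" "open S" "open T" "f ` S \<subseteq> T"
  shows "smooth_on S (\<lambda>x. g (f x))"
  using assms(1,2) Ck_on_compose[OF assms(3-5)] unfolding smooth_on_def by blast

lemma Ck_on_Suc_real:
  fixes f :: "real \<Rightarrow> real"
  assumes "open S" "\<And>x. x \<in> S \<Longrightarrow> (f has_real_derivative f' x) (at x)" "Ck_on k f' S"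
  shows "Ck_on (Suc k) f S"
proof (rule Ck_on_SucI[where f'="\<lambda>x v. f' x * v"])
  show "Ck_on k (\<lambda>x. f' x * v) S" for v
    by (rule Ck_on_bounded_linear_compose[OF bounded_linear_mult_left assms(1,3)])
qed (use assms in \<open>auto simp: has_field_derivative_def\<close>)

lemma smooth_on_real_inverse: "smooth_on (-{0::real}) inverse"
proof -
  have "Ck_on k inverse (-{0::real})" for k
  proof (induction k)
    case 0
    show ?case by (auto intro!: continuous_intros)
  next
    case (Suc k)
    show ?case
    proof (rule Ck_on_Suc_real[where f'="\<lambda>x. - (inverse x * inverse x)"])
      show "Ck_on k (\<lambda>x::real. - (inverse x * inverse x)) (-{0})"
        by (intro Ck_on_bounded_linear_compose[OF bounded_linear_minus[OF bounded_linear_ident]]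
            Ck_on_bilinear[OF _ bounded_bilinear_mult] Suc) auto
    qed (auto intro!: derivative_eq_intros)
  qed
  then show ?thesis by (simp add: smooth_on_def)
qed

lemma smooth_on_inverse [smooth_intros]:
  fixes f :: "'a::euclidean_space \<Rightarrow> real"
  assumes "open S" "smooth_on S f" "\<And>x. x \<in> S \<Longrightarrow> f x \<noteq> 0"
  shows "smooth_on S (\<lambda>x. inverse (f x))"
  by (rule smooth_on_compose[OF smooth_on_real_inverse]) (use assms in auto)

lemma smooth_on_divide [smooth_intros]:
  fixes f g :: "'a::euclidean_space \<Rightarrow> real"
  assumes "open S" "smooth_on S f" "smooth_on S g" "\<And>x. x \<in> S \<Longrightarrow> g x \<noteq> 0"
  shows "smooth_on S (\<lambda>x. f x / g x)"
  using smooth_on_mult[OF assms(1,2) smooth_on_inverse[OF assms(1,3,4)]] by (simp add: divide_inverse)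

lemma smooth_on_real_sqrt: "smooth_on {0<..} sqrt"
proof -
  have "Ck_on k sqrt {0<..}" for k
  proof (induction k)
    case 0
    show ?case by (auto intro!: continuous_intros)
  next
    case (Suc k)
    show ?case
    proof (rule Ck_on_Suc_real[where f'="\<lambda>x. inverse (sqrt x) * (1/2)"])
      have "Ck_on k (\<lambda>x. inverse (sqrt x)) {0<..}"
        by (rule Ck_on_compose[OF _ _ _ _ Suc, where T="-{0}"])
          (use smooth_on_real_inverse in \<open>auto simp: smooth_on_def\<close>)
      then show "Ck_on k (\<lambda>x. inverse (sqrt x) * (1/2)) {0<..}"
        by (intro Ck_on_bounded_linear_compose[OF bounded_linear_mult_left]) auto
    qed (auto intro!: derivative_eq_intros)
  qed
  then show ?thesis by (simp add: smooth_on_def)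
qed

section \<open>Inverse functions, parameter integrals and Hadamard quotients\<close>

lemma smooth_on_det:
  fixes a :: "'n::finite \<Rightarrow> 'n \<Rightarrow> 'a::euclidean_space \<Rightarrow> real"
  assumes "open S" "\<And>i j. smooth_on S (a i j)"
  shows "smooth_on S (\<lambda>x. det (\<chi> i j. a i j x))"
  unfolding det_def by (simp, intro smooth_intros assms)

text \<open>
  Smoothness of the inverse \<open>g\<close> is a bootstrap. By Cramer's rule the solution of \<open>Df(x) w = v\<close>
  depends smoothly on \<open>x\<close>. The derivative of \<open>g\<close> in direction \<open>v\<close> is this solution composed with \<open>g\<close>, so
  it is as often differentiable as \<open>g\<close> is, and \<open>g\<close> gains one derivative.
\<close>

lemma smooth_inverse_function:
  fixes f :: "real^'n::finite \<Rightarrow> real^'n"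
  assumes sm: "smooth_on S f" and S: "open S" "x0 \<in> S" and inj: "inj (fd f x0)"
  obtains U where "open U" "x0 \<in> U" "U \<subseteq> S" "diffeo_on U f"
proof -
  let ?D = "\<lambda>x. fd f x"
  define f' where "f' x = Blinfun (?D x)" for x
  have lin: "linear (?D x)" if "x \<in> S" for x
    using smooth_on_linear_fderiv[OF sm that] .
  have f': "blinfun_apply (f' x) = ?D x" if "x \<in> S" for x
    unfolding f'_def using lin[OF that] by (simp add: bounded_linear_Blinfun_apply linear_conv_bounded_linear)
  have cont: "continuous_on S f'"
  proof (rule continuous_on_blinfun_componentwise)
    fix i :: "real^'n"
    have "continuous_on S (\<lambda>x. ?D x i)"
      using smooth_on_continuous_on[OF smooth_on_fderiv[OF sm]] .
    then show "continuous_on S (\<lambda>x. blinfun_apply (f' x) i)"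
      by (rule continuous_on_eq) (simp add: f')
  qed
  obtain L where L: "linear L" "\<And>x. L (?D x0 x) = x"
    using linear_injective_isomorphism[OF lin[OF S(2)] inj] by blast
  have inv: "Blinfun L o\<^sub>L f' x0 = id_blinfun"
    using L f'[OF S(2)]
    by (intro blinfun_eqI) (simp add: bounded_linear_Blinfun_apply linear_conv_bounded_linear)
  obtain U V g g' where U: "open U" "U \<subseteq> S" "x0 \<in> U" and V: "open V" "f x0 \<in> V"
    and hom: "homeomorphism U V f g"
    and g: "\<And>y. y \<in> V \<Longrightarrow> (g has_derivative (g' y)) (at y)"
    and g': "\<And>y. y \<in> V \<Longrightarrow> g' y = inv (blinfun_apply (f' (g y)))"
    and bij: "\<And>y. y \<in> V \<Longrightarrow> bij (blinfun_apply (f' (g y)))"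
    using inverse_function_theorem[OF S(1) _ cont S(2) inv] smooth_on_has_derivative[OF sm] f' by (metis (no_types, lifting))
  have gU: "g y \<in> U" if "y \<in> V" for y using hom that by (auto simp: homeomorphism_def)
  have fV: "f x \<in> V" "g (f x) = x" if "x \<in> U" for x using hom that by (auto simp: homeomorphism_def)
  let ?A = "\<lambda>x. matrix (?D x) :: real^'n^'n"
  have detA: "det (?A x) \<noteq> 0" if "x \<in> U" for x
  proof -
    have "bij (?D x)" using bij[OF fV(1)[OF that]] fV(2)[OF that] f' U(2) that by auto
    then show ?thesis using lin U(2) that det_nz_iff_inj[of "?D x"] by (auto dest: bij_is_inj)
  qed
  let ?W = "\<lambda>v x. \<chi> k. det (\<chi> i j. if j = k then v $ i else ?A x $ i $ j) / det (?A x)"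
  have entry: "smooth_on S (\<lambda>x. ?A x $ i $ j)" for i j
    unfolding matrix_def using smooth_on_vec_nth[OF S(1) smooth_on_fderiv[OF sm]] by simp
  have detsm: "smooth_on S (\<lambda>x. det (?A x))"
    using smooth_on_det[OF S(1), of "\<lambda>i j x. ?A x $ i $ j"] entry by simp
  have W: "smooth_on U (?W v)" for v
  proof (intro smooth_on_vec_lambda smooth_on_divide U)
    show "smooth_on U (\<lambda>x. det (\<chi> i j. if j = k then v $ i else ?A x $ i $ j))" for k
    proof (rule smooth_on_det[OF U(1)])
      show "smooth_on U (\<lambda>x. if j = k then v $ i else ?A x $ i $ j)" for i j
        using smooth_on_subset[OF entry U(2)] by (cases "j = k") (auto intro: smooth_on_const U)
    qed
    show "smooth_on U (\<lambda>x. det (?A x))" using smooth_on_subset[OF detsm U(2)] .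
  qed (rule detA)
  have g'W: "g' y v = ?W v (g y)" if "y \<in> V" for y v
  proof -
    have x: "g y \<in> U" "g y \<in> S" using gU[OF that] U(2) by auto
    have "?D (g y) (g' y v) = v"
      using g'[OF that] bij[OF that] f'[OF x(2)] by (simp add: bij_is_surj surj_f_inv_f)
    then have "?A (g y) *v g' y v = v" using lin[OF x(2)] by simp
    then show ?thesis using cramer[OF detA[OF x(1)]] by blast
  qed
  have Ck: "Ck_on k g V" for k
  proof (induction k)
    case 0
    show ?case using g by (auto intro!: continuous_at_imp_continuous_on has_derivative_continuous)
  next
    case (Suc k)
    show ?case
    proof (rule Ck_on_SucI[OF V(1) g])
      fix v
      have "Ck_on k (\<lambda>y. ?W v (g y)) V"
        by (rule Ck_on_compose[OF V(1) U(1) _ _ Suc]) (use gU W in \<open>auto simp: smooth_on_def\<close>)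
      then show "Ck_on k (\<lambda>y. g' y v) V"
        by (subst Ck_on_cong[OF V(1), of _ "\<lambda>y. ?W v (g y)"]) (use g'W in auto)
    qed
  qed
  have fU: "f ` U = V" using hom by (auto simp: homeomorphism_def)
  have injU: "inj_on f U" using fV(2) by (metis inj_onI)
  have "smooth_on V (inv_into U f)"
  proof (subst smooth_on_cong[OF V(1)])
    show "inv_into U f y = g y" if "y \<in> V" for y
      using that hom injU by (metis fU gU inv_into_f_f f_inv_into_f fV(2) inv_into_into)
    show "smooth_on V g" using Ck by (simp add: smooth_on_def)
  qed
  then have "diffeo_on U f"
    unfolding diffeo_on_def using U V fU injU smooth_on_subset[OF sm U(2)] by auto
  then show thesis using that U by blast
qed

text \<open>
  Differentiation under the integral sign produces an integral of the same kind, with a directional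
  derivative of \<open>g\<close> in place of \<open>g\<close>.
\<close>

lemma Ck_on_integral:
  fixes g :: "real \<times> 'a::euclidean_space \<Rightarrow> 'b::euclidean_space"
  assumes "smooth_on T g" "open T" "open S" "{0..1} \<times> S \<subseteq> T"
  shows "Ck_on k (\<lambda>x. integral {0..1} (\<lambda>\<theta>. g (\<theta>, x))) S"
  using assms(1)
proof (induction k arbitrary: g)
  case 0
  have "continuous_on (S \<times> cbox 0 1) (\<lambda>(x, t). g (t, x))"
    unfolding split_def
    by (rule continuous_on_compose2[OF smooth_on_continuous_on[OF 0]])
      (use assms(4) in \<open>auto intro!: continuous_intros\<close>)
  then have "continuous_on S (\<lambda>x. integral (cbox 0 1) (\<lambda>\<theta>. g (\<theta>, x)))"
    by (rule integral_continuous_on_param)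
  then show ?case by simp
next
  case (Suc k)
  let ?D = "\<lambda>t x v. fd g (t, x) (0, v)"
  define f' where "f' x t = Blinfun (?D t x)" for x t
  have d: "((\<lambda>x. g (t, x)) has_derivative ?D t x) (at x)" if "x \<in> S" "t \<in> {0..1}" for x t
  proof -
    have "(g has_derivative fd g (t, x)) (at (t, x))"
      using assms(4) that by (intro smooth_on_has_derivative[OF Suc.prems]) auto
    moreover have "((\<lambda>x. (t, x)) has_derivative (\<lambda>v. (0, v))) (at x)"
      by (auto intro!: derivative_eq_intros)
    ultimately show ?thesis
      using has_derivative_compose[where f="\<lambda>x. (t, x)" and g=g] by blast
  qed
  have f': "blinfun_apply (f' x t) = ?D t x" if "x \<in> S" "t \<in> {0..1}" for x t
    unfolding f'_def using has_derivative_bounded_linear[OF d[OF that]]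
    by (rule bounded_linear_Blinfun_apply)
  have Dsm: "smooth_on T (\<lambda>y. fd g y (0, v))" for v
    using smooth_on_fderiv[OF Suc.prems] .
  have cont: "continuous_on (S \<times> cbox 0 1) (\<lambda>(x, t). f' x t)"
  proof (rule continuous_on_blinfun_componentwise)
    fix i :: 'a
    have "continuous_on (S \<times> cbox 0 1) (\<lambda>p. ?D (snd p) (fst p) i)"
      by (rule continuous_on_compose2[OF smooth_on_continuous_on[OF Dsm], of _ "\<lambda>p. (snd p, fst p)"])
        (use assms(4) in \<open>auto intro!: continuous_intros\<close>)
    then show "continuous_on (S \<times> cbox 0 1) (\<lambda>p. blinfun_apply (case p of (x, t) \<Rightarrow> f' x t) i)"
      by (rule continuous_on_eq) (auto simp: f')
  qed
  have int: "(\<lambda>t. g (t, x)) integrable_on cbox 0 1" if "x \<in> S" for x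
    by (intro integrable_continuous continuous_on_compose2[OF smooth_on_continuous_on[OF Suc.prems]])
      (use assms(4) that in \<open>auto intro!: continuous_intros\<close>)
  have intf': "f' x integrable_on cbox 0 1" if "x \<in> S" for x
  proof -
    have "continuous_on (cbox 0 1) (\<lambda>t. case (x, t) of (x, t) \<Rightarrow> f' x t)"
      by (rule continuous_on_compose2[OF cont]) (use that in \<open>auto intro!: continuous_intros\<close>)
    then show ?thesis by (intro integrable_continuous) simp
  qed
  have der: "((\<lambda>x. integral (cbox 0 1) (\<lambda>t. g (t, x))) has_derivative
      blinfun_apply (integral (cbox 0 1) (f' x))) (at x)" if x: "x \<in> S" for x
  proof -
    obtain e where e: "e > 0" "ball x e \<subseteq> S" by (rule openE[OF assms(3) x])
    define F where "F x t = g (t, x)" for x t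
    have 1: "(F y has_integral integral (cbox 0 1) (F y)) (cbox 0 1)" if "y \<in> ball x e" for y
      using int[of y] e that unfolding F_def by (auto intro!: integrable_integral)
    have 2: "((\<lambda>x. F x t) has_derivative blinfun_apply (f' y t)) (at y within ball x e)"
      if "y \<in> ball x e" "t \<in> cbox 0 1" for y t
      using has_derivative_at_withinI[OF d[of y t]] f'[of y t] that e unfolding F_def by auto
    have 3: "continuous_on (ball x e \<times> cbox 0 1) (\<lambda>(x, t). f' x t)"
      by (rule continuous_on_subset[OF cont]) (use e in auto)
    have "((\<lambda>x. integral (cbox 0 1) (F x)) has_derivative
      blinfun_apply (integral (cbox 0 1) (f' x))) (at x within ball x e)"
      by (rule leibniz_rule[OF 2 _ 3]) (use e 1 in \<open>auto simp: integrable_on_def\<close>)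
    then have "((\<lambda>x. integral (cbox 0 1) (F x)) has_derivative
      blinfun_apply (integral (cbox 0 1) (f' x))) (at x)"
      using e at_within_open[of x "ball x e"] by simp
    then show ?thesis unfolding F_def .
  qed
  have "Ck_on (Suc k) (\<lambda>x. integral (cbox 0 1) (\<lambda>t. g (t, x))) S"
  proof (rule Ck_on_SucI[OF assms(3) der])
    fix v
    have "Ck_on k (\<lambda>x. integral {0..1} (\<lambda>t. ?D t x v)) S"
      using Suc.IH[OF Dsm[of v]] by simp
    moreover have "blinfun_apply (integral (cbox 0 1) (f' x)) v = integral {0..1} (\<lambda>t. ?D t x v)"
      if "x \<in> S" for x
    proof -
      have "integral (cbox 0 1) (\<lambda>t. blinfun_apply (f' x t) v) = integral (cbox 0 1) (\<lambda>t. ?D t x v)"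
        by (rule integral_cong) (simp add: f'[OF that])
      then show ?thesis using blinfun_apply_integral[OF intf'[OF that], of v] by simp
    qed
    ultimately show "Ck_on k (\<lambda>x. blinfun_apply (integral (cbox 0 1) (f' x)) v) S"
      by (subst Ck_on_cong[OF assms(3), of _ "\<lambda>x. integral {0..1} (\<lambda>t. ?D t x v)"]) auto
  qed
  then show ?case by simp
qed

text \<open>
  The quotient is the mean value of the derivative in the first variable over the segment from \<open>0\<close> to
  \<open>t\<close>; unlike \<open>f (t, z) / t\<close>, this expression is visibly smooth at \<open>t = 0\<close>.
\<close>

lemma smooth_Hadamard_quotient:
  fixes f :: "real \<times> 'a::euclidean_space \<Rightarrow> 'b::euclidean_space"
  assumes sm: "smooth_on ({-\<epsilon><..<\<epsilon>} \<times> B) f" and B: "open B" and zero: "\<And>z. z \<in> B \<Longrightarrow> f (0, z) = 0"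
  obtains q where "smooth_on ({-\<epsilon><..<\<epsilon>} \<times> B) q"
    "\<And>t z. \<bar>t\<bar> < \<epsilon> \<Longrightarrow> z \<in> B \<Longrightarrow> f (t, z) = t *\<^sub>R q (t, z)"
proof
  let ?T = "{-\<epsilon><..<\<epsilon>} \<times> B"
  let ?d = "\<lambda>y. fd f y (1, 0)"
  define g where "g p = ?d (fst p * fst (snd p), snd (snd p))" for p
  have T: "open ?T" using B by (intro open_Times) auto
  define R where "R = (\<lambda>p::real \<times> real \<times> 'a. (fst p * fst (snd p), snd (snd p))) -` ?T"
  have R: "open R" unfolding R_def by (intro open_vimage T continuous_intros)
  have gsm: "smooth_on R g"
    unfolding g_def
    by (rule smooth_on_compose[OF smooth_on_fderiv[OF sm] _ R T])
      (auto intro!: smooth_intros R, auto simp: R_def)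
  have *: "{0..1} \<times> ?T \<subseteq> R"
  proof (clarsimp simp: R_def)
    fix \<theta> t :: real assume "0 \<le> \<theta>" "\<theta> \<le> 1" "- \<epsilon> < t" "t < \<epsilon>"
    then have "\<bar>\<theta> * t\<bar> \<le> \<bar>t\<bar>" "\<bar>t\<bar> < \<epsilon>" by (auto simp: abs_mult mult_left_le_one_le)
    then show "- \<epsilon> < \<theta> * t \<and> \<theta> * t < \<epsilon>" by linarith
  qed
  define q where "q p = integral {0..1} (\<lambda>\<theta>. g (\<theta>, p))" for p
  show "smooth_on ?T q"
    unfolding smooth_on_def q_def using Ck_on_integral[OF gsm R T *] by blast
  show "f (t, z) = t *\<^sub>R q (t, z)" if t: "\<bar>t\<bar> < \<epsilon>" and z: "z \<in> B" for t z
  proof -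
    have mem: "(\<theta> * t, z) \<in> ?T" if "\<theta> \<in> {0..1}" for \<theta>
    proof -
      have "(\<theta>, t, z) \<in> R" by (rule subsetD[OF *]) (use that t z in auto)
      then show ?thesis by (simp add: R_def)
    qed
    have der: "((\<lambda>\<theta>. f (\<theta> * t, z)) has_vector_derivative t *\<^sub>R g (\<theta>, (t, z))) (at \<theta>)"
      if "\<theta> \<in> {0..1}" for \<theta>
    proof -
      note D = smooth_on_has_derivative[OF sm mem[OF that]]
      have "((\<lambda>\<theta>. f (\<theta> * t, z)) has_derivative
          (\<lambda>h. fd f (\<theta> * t, z) (h * t, 0))) (at \<theta>)"
        by (rule has_derivative_compose[where f="\<lambda>\<theta>. (\<theta> * t, z)" and g=f, OF _ D])
          (auto intro!: derivative_eq_intros)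
      moreover have "fd f (\<theta> * t, z) (h * t, 0) = h *\<^sub>R t *\<^sub>R g (\<theta>, (t, z))" for h
        using linear_cmul[OF has_derivative_linear[OF D], of "h * t" "(1, 0)"] by (simp add: g_def)
      ultimately show ?thesis by (simp add: has_vector_derivative_def)
    qed
    have "((\<lambda>\<theta>. t *\<^sub>R g (\<theta>, (t, z))) has_integral f (1 * t, z) - f (0 * t, z)) {0..1}"
      by (rule fundamental_theorem_of_calculus, simp, rule has_vector_derivative_at_within, rule der)
    then have "integral {0..1} (\<lambda>\<theta>. t *\<^sub>R g (\<theta>, (t, z))) = f (t, z)"
      using zero z by (simp add: integral_unique del: integral_cmul)
    then show ?thesis by (simp add: q_def)
  qed
qed

section \<open>Seeley extension and even functions\<close>

text \<open>
  With these coefficients, \<open>\<Sum>k. c k * \<phi> (-(4^k) * s)\<close> has the same derivatives at \<open>s = 0\<close> as \<open>\<phi>\<close>.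
  For \<open>q = 1/4\<close> the numbers \<open>d k\<close> of the proof are the coefficients in Euler's expansion of the infinite
  product of the factors \<open>1 - q^i * z\<close> over \<open>i \<ge> 0\<close>. This product vanishes at \<open>z = 4^j\<close>, which says that all
  moments \<open>\<Sum>k. d k * (4^k)^j\<close> are zero. The sequence \<open>s k = d k / (1 + 4^k)\<close> then has moments such that
  any two consecutive ones cancel, so they alternate in sign, as required after normalisation.
\<close>

lemma seeley_coefficients:
  obtains c :: "nat \<Rightarrow> real" where
    "\<And>j. summable (\<lambda>k. \<bar>c k * (-(4^k))^j\<bar>)" "\<And>j. (\<Sum>k. c k * (-(4^k))^j) = 1"
proof -
  define r where "r k = - ((1/4::real)^k) / (1 - (1/4)^Suc k)" for k
  define d where "d k = (\<Prod>i<k. r i)" for k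
  have d0: "d 0 = 1" and dSuc: "d (Suc k) = d k * r k" for k by (auto simp: d_def)
  have q: "(1/4::real)^Suc k \<le> 1/4" for k by (simp add: power_le_one)
  have r: "\<bar>r k\<bar> \<le> 4/3 * (1/4)^k" for k
  proof -
    have "\<bar>r k\<bar> = (1/4)^k / (1 - (1/4)^Suc k)" unfolding r_def using q[of k] by simp
    also have "\<dots> \<le> (1/4)^k / (3/4)" using q[of k] by (intro divide_left_mono) auto
    finally show ?thesis by simp
  qed
  \<comment> \<open>the functional equation of the infinite product, read off on its coefficients\<close>
  have rec: "d (Suc k) * (1 - (1/4)^Suc k) = - ((1/4)^k * d k)" for k
  proof -
    have "1 - (1/4)^Suc k \<noteq> (0::real)" using q[of k] by linarith
    then show ?thesis unfolding dSuc r_def by (simp del: power_Suc add: mult.commute)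
  qed
  have summ: "summable (\<lambda>k. \<bar>d k\<bar> * (4^k)^j)" for j
  proof -
    obtain N where N: "4/3 * 4^j * (1/4::real)^N < 1/2"
    proof -
      have "(\<lambda>n. 4/3 * 4^j * (1/4::real)^n) \<longlonglongrightarrow> 4/3 * 4^j * 0"
        by (intro tendsto_mult tendsto_const LIMSEQ_power_zero) auto
      then have "\<forall>\<^sub>F n in sequentially. 4/3 * 4^j * (1/4::real)^n < 1/2"
        by (rule order_tendstoD(2)) simp
      then show thesis using that by (auto simp: eventually_sequentially)
    qed
    show ?thesis
    proof (rule summable_ratio_test[where c="1/2" and N=N])
      fix n assume n: "n \<ge> N"
      have "norm (\<bar>d (Suc n)\<bar> * (4 ^ Suc n) ^ j) = (\<bar>r n\<bar> * 4^j) * norm (\<bar>d n\<bar> * (4 ^ n) ^ j)"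
        by (simp add: dSuc abs_mult power_mult_distrib)
      also have "\<dots> \<le> (4/3 * (1/4)^n * 4^j) * norm (\<bar>d n\<bar> * (4 ^ n) ^ j)"
        by (intro mult_right_mono r) auto
      also have "\<dots> \<le> 1/2 * norm (\<bar>d n\<bar> * (4 ^ n) ^ j)"
      proof (rule mult_right_mono)
        have "(1/4::real)^n \<le> (1/4)^N" using n by (intro power_decreasing) auto
        then have "4/3 * 4^j * (1/4::real)^n \<le> 4/3 * 4^j * (1/4)^N" by (intro mult_left_mono) auto
        then have "4/3 * 4^j * (1/4::real)^n \<le> 1/2" using N by linarith
        then show "4/3 * (1/4)^n * 4^j \<le> (1/2::real)" by (simp only: mult_ac)
      qed auto
      finally show "norm (\<bar>d (Suc n)\<bar> * (4 ^ Suc n) ^ j) \<le> 1/2 * norm (\<bar>d n\<bar> * (4 ^ n) ^ j)" .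
    qed auto
  qed
  have summ': "summable (\<lambda>k. d k * (4^k)^j)" for j
    by (rule summable_rabs_cancel) (use summ[of j] in \<open>simp add: abs_mult\<close>)
  have summm: "summable (\<lambda>k. d k * (1/4)^k)"
  proof (rule summable_comparison_test')
    show "summable (\<lambda>k. \<bar>d k\<bar> * (4^k)^0)" by (rule summ)
    show "norm (d n * (1/4)^n) \<le> \<bar>d n\<bar> * (4^n)^0" for n
      by (simp add: abs_mult mult_left_le power_le_one)
  qed
  have D0: "(\<Sum>k. d k * (4^k)^j) = 0" for j
  proof (induction j)
    case 0
    have "(\<Sum>k. d k * (1 - (1/4)^k)) = (\<Sum>k. d (Suc k) * (1 - (1/4)^Suc k))"
      using suminf_split_head[of "\<lambda>k. d k * (1 - (1/4)^k)"] summable_diff[OF summ'[of 0] summm]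
      by (simp add: algebra_simps)
    also have "\<dots> = - (\<Sum>k. d k * (1/4)^k)"
      unfolding rec by (subst suminf_minus[symmetric, OF summm]) (simp add: mult_ac)
    finally have "(\<Sum>k. d k * (1 - (1/4)^k)) = - (\<Sum>k. d k * (1/4)^k)" .
    moreover have "(\<Sum>k. d k * (1 - (1/4)^k)) = (\<Sum>k. d k) - (\<Sum>k. d k * (1/4)^k)"
      using suminf_diff[OF summ'[of 0] summm] by (simp add: algebra_simps)
    ultimately show ?case by simp
  next
    case (Suc j)
    have e: "d k * (1 - (1/4)^k) * (4^k)^Suc j = d k * (4^k)^Suc j - d k * (4^k)^j" for k
      by (simp add: field_simps power_divide)
    have "(\<Sum>k. d k * (1 - (1/4)^k) * (4^k)^Suc j) = (\<Sum>k. d (Suc k) * (1 - (1/4)^Suc k) * (4^Suc k)^Suc j)"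
      using suminf_split_head[of "\<lambda>k. d k * (1 - (1/4)^k) * (4^k)^Suc j"]
        summable_diff[OF summ'[of "Suc j"] summ'[of j]] unfolding e by simp
    also have "\<dots> = (\<Sum>k. - (4^Suc j) * (d k * (4^k)^j))"
      unfolding rec by (intro suminf_cong) (simp add: field_simps power_divide power_mult_distrib)
    also have "\<dots> = - (4^Suc j) * (\<Sum>k. d k * (4^k)^j)"
      by (rule suminf_mult[OF summ'])
    finally have "(\<Sum>k. d k * (4^k)^Suc j) - (\<Sum>k. d k * (4^k)^j) = 0"
      using suminf_diff[OF summ'[of "Suc j"] summ'[of j]] unfolding e using Suc by simp
    then show ?case using Suc by simp
  qed
  define s where "s k = d k / (1 + 4^k)" for k
  have sle: "\<bar>s k\<bar> \<le> \<bar>d k\<bar>" for k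
    unfolding s_def abs_divide by (simp add: divide_le_eq mult_left_le)
      (smt (verit) mult_le_cancel_left1 zero_less_power abs_ge_zero)
  have ssum: "summable (\<lambda>k. \<bar>s k\<bar> * (4^k)^j)" for j
    by (rule summable_comparison_test'[OF summ[of j]]) (simp add: abs_mult mult_right_mono sle)
  have ssum': "summable (\<lambda>k. s k * (4^k)^j)" for j
    by (rule summable_rabs_cancel) (use ssum[of j] in \<open>simp add: abs_mult\<close>)
  define C where "C = (\<Sum>k. s k)"
  \<comment> \<open>\<open>s k + s k * 4^k = d k\<close>, so consecutive moments add up to a moment of \<open>d\<close>, which is zero\<close>
  have srec: "(\<Sum>k. s k * (4^k)^Suc j) = - (\<Sum>k. s k * (4^k)^j)" for j
  proof -
    have "s k * (4^k)^j + s k * (4^k)^Suc j = d k * (4^k)^j" for k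
    proof -
      have "(1 + 4^k :: real) \<noteq> 0" by (smt (verit) zero_less_power)
      then have "s k * (1 + 4^k) = d k" by (simp add: s_def)
      moreover have "s k * (4^k)^j + s k * (4^k)^Suc j = (s k * (1 + 4^k)) * (4^k)^j"
        by (simp add: algebra_simps)
      ultimately show ?thesis by simp
    qed
    then show ?thesis
      using suminf_add[OF ssum'[of j] ssum'[of "Suc j"]] D0[of j] by simp
  qed
  have S: "(\<Sum>k. s k * (4^k)^j) = C * (-1)^j" for j
    by (induction j) (use srec in \<open>auto simp: C_def simp del: power_Suc simp add: power_Suc[of "-1"]\<close>)
  \<comment> \<open>the term \<open>s 0 = 1/2\<close> outweighs the remaining ones, which sum to at most \<open>2/5\<close>\<close>
  have "C > 0"
  proof -
    have b: "\<bar>s (Suc k)\<bar> \<le> 4/15 * (1/3)^k" for k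
    proof (induction k)
      case 0
      show ?case by (simp add: s_def d_def r_def)
    next
      case (Suc k)
      have "\<bar>d (Suc (Suc k))\<bar> \<le> \<bar>d (Suc k)\<bar> * (4/3 * (1/4)^Suc k)"
        unfolding dSuc[of "Suc k"] abs_mult by (intro mult_left_mono r) auto
      also have "\<dots> \<le> \<bar>d (Suc k)\<bar> * (1/3)" using q[of k] by (intro mult_left_mono) auto
      finally have le: "\<bar>d (Suc (Suc k))\<bar> \<le> \<bar>d (Suc k)\<bar> * (1/3)" .
      have "\<bar>d (Suc (Suc k))\<bar> / (1 + 4^Suc (Suc k)) \<le> \<bar>d (Suc k)\<bar> * (1/3) / (1 + 4^Suc k)"
      proof (rule frac_le[OF _ le])
        show "(0::real) < 1 + 4^Suc k" by (simp add: add_pos_pos)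
      qed auto
      then have "\<bar>s (Suc (Suc k))\<bar> \<le> 1/3 * \<bar>s (Suc k)\<bar>" by (simp add: s_def abs_divide)
      then show ?case using Suc by simp
    qed
    have s1: "summable s" using ssum'[of 0] by simp
    have "\<bar>\<Sum>k. s (Suc k)\<bar> \<le> (\<Sum>k. 4/15 * (1/3::real)^k)"
      using norm_suminf_le[of "\<lambda>k. s (Suc k)" "\<lambda>k. 4/15 * (1/3::real)^k"] b
      by (auto intro!: summable_mult summable_geometric)
    also have "\<dots> = 4/15 * (\<Sum>k. (1/3::real)^k)"
      by (intro suminf_mult summable_geometric) auto
    also have "\<dots> = 2/5" by (subst suminf_geometric) auto
    finally have "\<bar>\<Sum>k. s (Suc k)\<bar> \<le> 2/5" .
    moreover have "(\<Sum>k. s (Suc k)) = C - s 0" unfolding C_def using suminf_split_head[OF s1] .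
    ultimately have "\<bar>C - 1/2\<bar> \<le> 2/5" by (simp add: s_def d0)
    then show ?thesis by linarith
  qed
  show thesis
  proof
    fix j
    have e: "s k / C * (-(4^k))^j = (-1)^j / C * (s k * (4^k)^j)" for k
      by (simp add: power_minus[of "4^k"])
    show "summable (\<lambda>k. \<bar>s k / C * (-(4^k))^j\<bar>)"
      unfolding e abs_mult using summable_mult[OF ssum[of j], of "\<bar>(-1)^j / C\<bar>"] by simp
    show "(\<Sum>k. s k / C * (-(4^k))^j) = 1"
      unfolding e using suminf_mult[OF ssum'[of j], of "(-1)^j / C"] S[of j] \<open>C > 0\<close>
      by (simp flip: power_mult_distrib)
  qed
qed


text \<open>
  Measures how far two linear maps on \<open>real \<times> 'a\<close> are apart, given the distances of their values on
  the basis vectors.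
\<close>

lemma norm_split_combination_le:
  fixes h :: "real \<times> 'a::euclidean_space" and P :: "'b::real_normed_vector"
  assumes P: "norm P \<le> e" and Q: "\<And>b. b \<in> Basis \<Longrightarrow> norm (Q b) \<le> e"
  shows "norm (fst h *\<^sub>R P + (\<Sum>b\<in>Basis. (snd h \<bullet> b) *\<^sub>R Q b)) \<le> e * (1 + real DIM('a)) * norm h"
proof -
  have fs: "\<bar>fst h\<bar> \<le> norm h" "norm (snd h) \<le> norm h"
    using norm_fst_le[of "fst h" "snd h"] norm_snd_le[of "snd h" "fst h"] by simp_all
  have "norm (fst h *\<^sub>R P + (\<Sum>b\<in>Basis. (snd h \<bullet> b) *\<^sub>R Q b)) \<le>
      norm (fst h *\<^sub>R P) + (\<Sum>b\<in>Basis. norm ((snd h \<bullet> b) *\<^sub>R Q b))"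
    by (intro order_trans[OF norm_triangle_ineq] add_left_mono norm_sum)
  also have "\<dots> \<le> norm h * e + (\<Sum>b\<in>(Basis::'a set). norm h * e)"
  proof (intro add_mono sum_mono)
    show "norm (fst h *\<^sub>R P) \<le> norm h * e" unfolding norm_scaleR using P fs by (intro mult_mono) auto
    show "norm ((snd h \<bullet> b) *\<^sub>R Q b) \<le> norm h * e" if b: "b \<in> Basis" for b
      unfolding norm_scaleR using Q[OF b] order_trans[OF Basis_le_norm[OF b] fs(2)] by (intro mult_mono) auto
  qed
  also have "\<dots> = e * (1 + real DIM('a)) * norm h" by (simp add: algebra_simps)
  finally show ?thesis .
qed

lemma scaleR_uminus_cancel:
  fixes a b :: "'b::real_vector"
  shows "(-t) *\<^sub>R a = - (t *\<^sub>R b) \<Longrightarrow> t \<noteq> 0 \<Longrightarrow> a = b"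
  unfolding scaleR_minus_left neg_equal_iff_equal by (rule scaleR_left_imp_eq)

text \<open>
  The segment from a point \<open>p\<close> of the hyperplane to a point \<open>q\<close> off it meets the hyperplane only in \<open>p\<close>,
  so the mean value theorem applies along it. The resulting estimate extends by continuity to \<open>q\<close> in the
  hyperplane.
\<close>

lemma has_derivative_across_hyperplane:
  fixes f :: "real \<times> 'a::euclidean_space \<Rightarrow> 'b::euclidean_space"
  assumes W: "open W" and f: "continuous_on W f" and \<alpha>: "continuous_on W \<alpha>"
    and \<beta>: "\<And>b. b \<in> Basis \<Longrightarrow> continuous_on W (\<beta> b)"
    and der: "\<And>p. p \<in> W \<Longrightarrow> fst p \<noteq> 0 \<Longrightarrow>
      (f has_derivative (\<lambda>h. fst h *\<^sub>R \<alpha> p + (\<Sum>b\<in>Basis. (snd h \<bullet> b) *\<^sub>R \<beta> b p))) (at p)"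
    and p: "p \<in> W"
  shows "(f has_derivative (\<lambda>h. fst h *\<^sub>R \<alpha> p + (\<Sum>b\<in>Basis. (snd h \<bullet> b) *\<^sub>R \<beta> b p))) (at p)"
proof (cases "fst p = 0")
  case False
  then show ?thesis using der p by blast
next
  case p0: True
  define A where "A p h = fst h *\<^sub>R \<alpha> p + (\<Sum>b\<in>Basis. (snd h \<bullet> b) *\<^sub>R \<beta> b p)" for p h
  have bl: "bounded_linear (A p)"
    unfolding A_def by (intro bounded_linear_intros)
  let ?n = "1 + real DIM('a)"
  have "\<exists>d>0. \<forall>q. norm (q - p) < d \<longrightarrow> norm (f q - f p - A p (q - p)) \<le> e * norm (q - p)"
    if "e > 0" for e
  proof -
    define e1 where "e1 = e / ?n"
    have e1: "e1 > 0" using that by (simp add: e1_def)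
    have "\<forall>\<^sub>F q in at p. q \<in> W \<and> dist (\<alpha> q) (\<alpha> p) < e1 \<and> (\<forall>b\<in>Basis. dist (\<beta> b q) (\<beta> b p) < e1)"
    proof (intro eventually_conj eventually_ball_finite ballI)
      show "\<forall>\<^sub>F q in at p. q \<in> W" using W p eventually_at_topological by blast
      show "\<forall>\<^sub>F q in at p. dist (\<alpha> q) (\<alpha> p) < e1"
        by (rule tendstoD[OF _ e1]) (use \<alpha> W p in \<open>simp add: continuous_on_eq_continuous_at isCont_def\<close>)
      show "\<forall>\<^sub>F q in at p. dist (\<beta> b q) (\<beta> b p) < e1" if "b \<in> Basis" for b
        by (rule tendstoD[OF _ e1]) (use \<beta>[OF that] W p in \<open>simp add: continuous_on_eq_continuous_at isCont_def\<close>)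
    qed auto
    then obtain d where d: "d > 0" and close:
      "\<And>q. q \<noteq> p \<Longrightarrow> dist q p < d \<Longrightarrow> q \<in> W \<and> dist (\<alpha> q) (\<alpha> p) < e1 \<and> (\<forall>b\<in>Basis. dist (\<beta> b q) (\<beta> b p) < e1)"
      unfolding eventually_at by auto
    have ball: "ball p d \<subseteq> W" using close p by (auto simp: dist_commute) (metis prod.collapse)
    have Adiff: "norm (A q h - A p h) \<le> e * norm h" if "q \<in> ball p d" for q h
    proof (cases "q = p")
      case False
      have "A q h - A p h = fst h *\<^sub>R (\<alpha> q - \<alpha> p) + (\<Sum>b\<in>Basis. (snd h \<bullet> b) *\<^sub>R (\<beta> b q - \<beta> b p))"
        by (simp add: A_def algebra_simps sum_subtractf)
      also have "norm \<dots> \<le> e1 * ?n * norm h"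
        using close[OF False] that
        by (intro norm_split_combination_le) (auto simp: dist_norm norm_minus_commute less_imp_le)
      also have "\<dots> = e * norm h" by (simp add: e1_def)
      finally show ?thesis .
    qed (use \<open>e > 0\<close> in simp)
    have main: "norm (f q - f p - A p (q - p)) \<le> e * norm (q - p)" if q: "q \<in> ball p d" and q0: "fst q \<noteq> 0" for q
    proof -
      define c where "c \<theta> = p + \<theta> *\<^sub>R (q - p)" for \<theta> :: real
      have cball: "c \<theta> \<in> ball p d" if "\<theta> \<in> {0..1}" for \<theta>
      proof -
        have "dist p (c \<theta>) = \<bar>\<theta>\<bar> * norm (q - p)" by (simp add: c_def dist_norm)
        also have "\<dots> \<le> 1 * norm (q - p)" using that by (intro mult_right_mono) auto
        finally show ?thesis using q by (simp add: dist_norm norm_minus_commute)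
      qed
      define G where "G \<theta> = f (c \<theta>) - \<theta> *\<^sub>R A p (q - p)" for \<theta>
      have "\<exists>\<theta>\<in>{0<..<1}. norm (G 1 - G 0) \<le> norm ((1 - 0) *\<^sub>R (A (c \<theta>) (q - p) - A p (q - p)))"
      proof (rule mvt_general[where f'="\<lambda>\<theta> h. h *\<^sub>R (A (c \<theta>) (q - p) - A p (q - p))"])
        show "continuous_on {0..1} G" unfolding G_def
        proof (intro continuous_intros continuous_on_compose2[OF f])
          show "continuous_on {0..1} c" unfolding c_def by (intro continuous_intros)
        qed (use cball ball in auto)
        fix \<theta> :: real assume \<theta>: "0 < \<theta>" "\<theta> < 1"
        have c: "(c has_derivative (\<lambda>h. h *\<^sub>R (q - p))) (at \<theta>)"
          unfolding c_def by (auto intro!: derivative_eq_intros)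
        have "fst (c \<theta>) \<noteq> 0" using \<theta> p0 q0 by (simp add: c_def)
        then have D: "(f has_derivative A (c \<theta>)) (at (c \<theta>))"
          unfolding A_def using \<theta> cball[of \<theta>] ball by (intro der) auto
        have "bounded_linear (A (c \<theta>))" unfolding A_def by (intro bounded_linear_intros)
        then have lin: "A (c \<theta>) (h *\<^sub>R (q - p)) = h *\<^sub>R A (c \<theta>) (q - p)" for h
          by (simp add: bounded_linear.linear linear_cmul)
        have "((\<lambda>\<theta>. f (c \<theta>)) has_derivative (\<lambda>h. A (c \<theta>) (h *\<^sub>R (q - p)))) (at \<theta>)"
          using has_derivative_compose[where f=c and g=f] c D by blast
        then show "(G has_derivative (\<lambda>h. h *\<^sub>R (A (c \<theta>) (q - p) - A p (q - p)))) (at \<theta>)"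
          unfolding G_def lin
          by (auto intro!: derivative_eq_intros simp: algebra_simps)
      qed auto
      then obtain \<theta> where \<theta>: "\<theta> \<in> {0<..<1}" "norm (G 1 - G 0) \<le> norm (A (c \<theta>) (q - p) - A p (q - p))" by auto
      note \<theta>(2)
      also have "norm (A (c \<theta>) (q - p) - A p (q - p)) \<le> e * norm (q - p)"
        using Adiff[OF cball] \<theta>(1) by auto
      finally show ?thesis by (simp add: G_def c_def algebra_simps)
    qed
    have "norm (f q - f p - A p (q - p)) \<le> e * norm (q - p)" if q: "norm (q - p) < d" for q
    proof (cases "fst q = 0")
      case False
      have "q \<in> ball p d" using q by (simp add: dist_norm norm_minus_commute)
      then show ?thesis using main False by blast
    next
      case True
      define Q where "Q n = q + (inverse (real (Suc n)), 0)" for n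
      have Q: "Q \<longlonglongrightarrow> q"
        unfolding Q_def using tendsto_add[OF tendsto_const[of q] tendsto_Pair[OF LIMSEQ_inverse_real_of_nat tendsto_const[of 0]]]
        by (simp add: zero_prod_def[symmetric])
      have qb: "q \<in> ball p d" using q by (simp add: dist_norm norm_minus_commute)
      have ev: "\<forall>\<^sub>F n in sequentially. Q n \<in> ball p d"
        using topological_tendstoD[OF Q open_ball qb] .
      have fQ: "(\<lambda>n. f (Q n)) \<longlonglongrightarrow> f q"
        by (rule continuous_on_tendsto_compose[OF f Q _ eventually_mono[OF ev]]) (use qb ball in auto)
      have AQ: "(\<lambda>n. A p (Q n - p)) \<longlonglongrightarrow> A p (q - p)"
        by (intro bounded_linear.tendsto[OF bl] tendsto_diff Q tendsto_const)
      show ?thesis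
      proof (rule tendsto_le)
        show "(\<lambda>n. e * norm (Q n - p)) \<longlonglongrightarrow> e * norm (q - p)" by (intro tendsto_intros Q)
        show "(\<lambda>n. norm (f (Q n) - f p - A p (Q n - p))) \<longlonglongrightarrow> norm (f q - f p - A p (q - p))"
          by (intro tendsto_intros fQ AQ)
        show "\<forall>\<^sub>F n in sequentially. norm (f (Q n) - f p - A p (Q n - p)) \<le> e * norm (Q n - p)"
          using ev by eventually_elim (rule main, auto simp: Q_def True)
      qed simp
    qed
    then show ?thesis using d by blast
  qed
  then have "(f has_derivative A p) (at p)" unfolding has_derivative_at_alt using bl by blast
  then show ?thesis unfolding A_def .
qed


text \<open>
  Seeley's extension of a function on the half space \<open>{0..} \<times> UNIV\<close> by a series of reflections. The
  factor \<open>(-(4^k))^j\<close> is the one that \<open>j\<close> derivatives in the first variable produce: such a derivative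
  turns the extension with index \<open>j\<close> of \<open>\<phi>\<close> into the extension with index \<open>Suc j\<close> of its derivative.
\<close>

definition half_ext :: "(nat \<Rightarrow> real) \<Rightarrow> nat \<Rightarrow> (real \<times> 'a \<Rightarrow> 'b) \<Rightarrow> real \<times> 'a::euclidean_space \<Rightarrow> 'b::euclidean_space" where
  "half_ext c j \<phi> p = (if fst p \<ge> 0 then \<phi> p
     else (\<Sum>k. (c k * (-(4^k))^j) *\<^sub>R \<phi> (-(4^k) * fst p, snd p)))"

text \<open>
  The series represents the extension on the closed half space \<open>{..0} \<times> B\<close>: for first coordinate \<open>0\<close> all
  reflections coincide, and the weights add up to \<open>1\<close>.
\<close>

lemma half_ext_uniform_limit:
  fixes \<phi> :: "real \<times> 'a::euclidean_space \<Rightarrow> 'b::euclidean_space"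
  assumes c: "summable (\<lambda>k. \<bar>c k * (-(4^k))^j\<bar>)" "(\<Sum>k. c k * (-(4^k))^j) = 1"
    and M: "\<And>p. p \<in> {0..} \<times> B \<Longrightarrow> norm (\<phi> p) \<le> M"
  shows "uniform_limit ({..0} \<times> B)
    (\<lambda>n p. \<Sum>k<n. (c k * (-(4^k))^j) *\<^sub>R \<phi> (-(4^k) * fst p, snd p)) (half_ext c j \<phi>) sequentially"
proof -
  let ?f = "\<lambda>k p. (c k * (-(4^k))^j) *\<^sub>R \<phi> (-(4^k) * fst p, snd p)"
  have "uniform_limit ({..0} \<times> B) (\<lambda>n p. \<Sum>k<n. ?f k p) (\<lambda>p. \<Sum>k. ?f k p) sequentially"
  proof (rule Weierstrass_m_test)
    show "norm (?f n p) \<le> \<bar>c n * (-(4^n))^j\<bar> * M" if "p \<in> {..0} \<times> B" for n p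
    proof -
      have "0 \<le> -(4^n) * fst p" using that by (auto simp: mult_nonneg_nonpos)
      then have "norm (\<phi> (-(4^n) * fst p, snd p)) \<le> M" using that by (intro M) auto
      then show ?thesis unfolding norm_scaleR by (intro mult_left_mono) auto
    qed
    show "summable (\<lambda>n. \<bar>c n * (-(4^n))^j\<bar> * M)" by (rule summable_mult2[OF c(1)])
  qed
  moreover have "(\<Sum>k. ?f k p) = half_ext c j \<phi> p" if "p \<in> {..0} \<times> B" for p
  proof (cases "fst p = 0")
    case True
    have "(\<Sum>k. ?f k p) = (\<Sum>k. (c k * (-(4^k))^j) *\<^sub>R \<phi> p)"
      using True by (intro suminf_cong) (metis mult_zero_right prod.collapse)
    also have "\<dots> = (\<Sum>k. c k * (-(4^k))^j) *\<^sub>R \<phi> p"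
      by (rule suminf_scaleR_left[symmetric]) (rule summable_rabs_cancel[OF c(1)])
    finally show ?thesis using True c(2) by (simp add: half_ext_def)
  next
    case False
    then show ?thesis using that by (auto simp: half_ext_def)
  qed
  ultimately show ?thesis by (subst uniform_limit_cong'[of _ _ "\<lambda>n p. \<Sum>k<n. ?f k p"]) auto
qed

lemma continuous_on_half_ext:
  fixes \<phi> :: "real \<times> 'a::euclidean_space \<Rightarrow> 'b::euclidean_space"
  assumes c: "summable (\<lambda>k. \<bar>c k * (-(4^k))^j\<bar>)" "(\<Sum>k. c k * (-(4^k))^j) = 1"
    and M: "\<And>p. p \<in> {0..} \<times> B \<Longrightarrow> norm (\<phi> p) \<le> M"
    and cont: "continuous_on ({0..} \<times> B) \<phi>"
  shows "continuous_on (UNIV \<times> B) (half_ext c j \<phi>)"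
proof -
  have 1: "continuous_on ({0..} \<times> B) (half_ext c j \<phi>)"
    by (rule continuous_on_eq[OF cont]) (auto simp: half_ext_def)
  have 2: "continuous_on ({..0} \<times> B) (half_ext c j \<phi>)"
  proof (rule uniform_limit_theorem[OF _ half_ext_uniform_limit[OF c M]])
    show "\<forall>\<^sub>F n in sequentially. continuous_on ({..0} \<times> B)
        (\<lambda>p. \<Sum>k<n. (c k * (- (4 ^ k)) ^ j) *\<^sub>R \<phi> (- (4 ^ k) * fst p, snd p))"
      by (intro always_eventually allI continuous_intros continuous_on_compose2[OF cont])
        (auto simp: mult_nonneg_nonpos)
  qed auto
  have eq: "UNIV \<times> B = {0..} \<times> B \<union> {..0::real} \<times> B" by (auto; linarith)
  show ?thesis unfolding eq
  proof (rule continuous_on_Un_local[OF _ _ 1 2])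
    have "closedin (top_of_set (UNIV \<times> B)) ((UNIV \<times> B) \<inter> fst -` {0::real..})"
      by (intro closedin_closed_Int closed_vimage_fst closed_atLeast)
    moreover have "(UNIV \<times> B) \<inter> fst -` {0::real..} = {0..} \<times> B" by auto
    ultimately show "closedin (top_of_set ({0::real..} \<times> B \<union> {..0} \<times> B)) ({0..} \<times> B)"
      unfolding eq[symmetric] by simp
    have "closedin (top_of_set (UNIV \<times> B)) ((UNIV \<times> B) \<inter> fst -` {..0::real})"
      by (intro closedin_closed_Int closed_vimage_fst closed_atMost)
    moreover have "(UNIV \<times> B) \<inter> fst -` {..0::real} = {..0} \<times> B" by auto
    ultimately show "closedin (top_of_set ({0::real..} \<times> B \<union> {..0} \<times> B)) ({..0} \<times> B)"
      unfolding eq[symmetric] by simp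
  qed
qed

text \<open>
  The differentiated series converges uniformly because the factor \<open>4^k\<close> from the chain rule only
  raises the index \<open>j\<close> of the absolutely summable weights.
\<close>

lemma half_ext_has_derivative_neg:
  fixes \<phi> \<psi> :: "real \<times> 'a::euclidean_space \<Rightarrow> 'b::euclidean_space"
  assumes c: "\<And>j. summable (\<lambda>k. \<bar>c k * (-(4^k))^j\<bar>)" "\<And>j. (\<Sum>k. c k * (-(4^k))^j) = 1"
    and B: "open B" and p: "fst p < 0" "snd p \<in> B"
    and M\<phi>: "\<And>p. p \<in> {0..} \<times> B \<Longrightarrow> norm (\<phi> p) \<le> M\<phi>"
    and M\<psi>: "\<And>p. p \<in> {0..} \<times> B \<Longrightarrow> norm (\<psi> p) \<le> M\<psi>"
    and M\<kappa>: "\<And>b p. b \<in> Basis \<Longrightarrow> p \<in> {0..} \<times> B \<Longrightarrow> norm (\<kappa> b p) \<le> M\<kappa> b"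
    and der: "\<And>p. fst p > 0 \<Longrightarrow> snd p \<in> B \<Longrightarrow>
      (\<phi> has_derivative (\<lambda>h. fst h *\<^sub>R \<psi> p + (\<Sum>b\<in>Basis. (snd h \<bullet> b) *\<^sub>R \<kappa> b p))) (at p)"
  shows "(half_ext c j \<phi> has_derivative
    (\<lambda>h. fst h *\<^sub>R half_ext c (Suc j) \<psi> p + (\<Sum>b\<in>Basis. (snd h \<bullet> b) *\<^sub>R half_ext c j (\<kappa> b) p))) (at p)"
proof -
  obtain r where r: "r > 0" "ball (snd p) r \<subseteq> B" using openE[OF B p(2)] by metis
  define S where "S = {..<0::real} \<times> ball (snd p) r"
  have S: "convex S" "open S" "p \<in> S" "S \<subseteq> {..0} \<times> B"
    using r p unfolding S_def by (auto intro: convex_Times open_Times simp: mem_Times_iff)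
  define w where "w i k = c k * (-(4^k))^i" for i k
  define m where "m k p = (-(4^k) * fst p, snd p)" for k :: nat and p :: "real \<times> 'a"
  define f where "f k p = w j k *\<^sub>R \<phi> (m k p)" for k p
  define f' where "f' k p h = fst h *\<^sub>R (w (Suc j) k *\<^sub>R \<psi> (m k p)) +
    (\<Sum>b\<in>Basis. (snd h \<bullet> b) *\<^sub>R (w j k *\<^sub>R \<kappa> b (m k p)))" for k p h
  define g' where "g' p h = fst h *\<^sub>R half_ext c (Suc j) \<psi> p +
    (\<Sum>b\<in>Basis. (snd h \<bullet> b) *\<^sub>R half_ext c j (\<kappa> b) p)" for p h
  have fder: "(f k has_derivative f' k q) (at q within S)" if "q \<in> S" for k q
  proof -
    have q: "fst (m k q) > 0" "snd (m k q) \<in> B"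
      using that S(4) by (auto simp: S_def m_def mult_pos_neg)
    have mk: "(m k has_derivative (\<lambda>h. (-(4^k) * fst h, snd h))) (at q)"
      unfolding m_def by (auto intro!: derivative_eq_intros)
    have "((\<lambda>q. \<phi> (m k q)) has_derivative (\<lambda>h. (-(4^k) * fst h) *\<^sub>R \<psi> (m k q) +
        (\<Sum>b\<in>Basis. (snd h \<bullet> b) *\<^sub>R \<kappa> b (m k q)))) (at q)"
      using has_derivative_compose[where f="m k" and g=\<phi>, OF mk der[OF q]]
      unfolding fst_conv snd_conv .
    then have "(f k has_derivative (\<lambda>h. w j k *\<^sub>R ((-(4^k) * fst h) *\<^sub>R \<psi> (m k q) +
        (\<Sum>b\<in>Basis. (snd h \<bullet> b) *\<^sub>R \<kappa> b (m k q))))) (at q)"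
      unfolding f_def by (rule has_derivative_scaleR_right)
    moreover have "(\<lambda>h. w j k *\<^sub>R ((-(4^k) * fst h) *\<^sub>R \<psi> (m k q) +
        (\<Sum>b\<in>Basis. (snd h \<bullet> b) *\<^sub>R \<kappa> b (m k q)))) = f' k q"
      by (auto simp: f'_def w_def fun_eq_iff scaleR_right_diff_distrib scaleR_sum_right mult_ac)
    ultimately show ?thesis by (simp add: has_derivative_at_withinI)
  qed
  have unif: "\<forall>\<^sub>F n in sequentially. \<forall>q\<in>S. \<forall>h. norm ((\<Sum>k<n. f' k q h) - g' q h) \<le> e * norm h"
    if "e > 0" for e
  proof -
    let ?n = "1 + real DIM('a)"
    define e1 where "e1 = e / ?n"
    have e1: "e1 > 0" using that by (simp add: e1_def)
    have "\<forall>\<^sub>F n in sequentially. \<forall>q\<in>{..0}\<times>B. dist (\<Sum>k<n. w (Suc j) k *\<^sub>R \<psi> (m k q)) (half_ext c (Suc j) \<psi> q) < e1"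
      unfolding w_def m_def by (rule uniform_limitD[OF half_ext_uniform_limit[OF c M\<psi>] e1])
    moreover have "\<forall>\<^sub>F n in sequentially. \<forall>b\<in>Basis. \<forall>q\<in>{..0}\<times>B. dist (\<Sum>k<n. w j k *\<^sub>R \<kappa> b (m k q)) (half_ext c j (\<kappa> b) q) < e1"
      unfolding w_def m_def
    proof (rule eventually_ball_finite[OF finite_Basis], rule ballI)
      fix b :: 'a assume b: "b \<in> Basis"
      show "\<forall>\<^sub>F n in sequentially. \<forall>q\<in>{..0}\<times>B.
          dist (\<Sum>k<n. (c k * (-(4^k))^j) *\<^sub>R \<kappa> b (-(4^k) * fst q, snd q)) (half_ext c j (\<kappa> b) q) < e1"
        by (rule uniform_limitD[OF half_ext_uniform_limit[OF c M\<kappa>[OF b]] e1])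
    qed
    ultimately show ?thesis
    proof eventually_elim
      case (elim n)
      show ?case
      proof (intro ballI allI)
        fix q and h :: "real \<times> 'a" assume q: "q \<in> S"
        let ?P = "(\<Sum>k<n. w (Suc j) k *\<^sub>R \<psi> (m k q)) - half_ext c (Suc j) \<psi> q"
        let ?Q = "\<lambda>b. (\<Sum>k<n. w j k *\<^sub>R \<kappa> b (m k q)) - half_ext c j (\<kappa> b) q"
        have "(\<Sum>k<n. f' k q h) = fst h *\<^sub>R (\<Sum>k<n. w (Suc j) k *\<^sub>R \<psi> (m k q)) +
            (\<Sum>b\<in>Basis. (snd h \<bullet> b) *\<^sub>R (\<Sum>k<n. w j k *\<^sub>R \<kappa> b (m k q)))"
          unfolding f'_def sum.distrib scaleR_sum_right by (subst sum.swap[of _ Basis]) simp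
        then have "(\<Sum>k<n. f' k q h) - g' q h = fst h *\<^sub>R ?P + (\<Sum>b\<in>Basis. (snd h \<bullet> b) *\<^sub>R ?Q b)"
          by (simp add: g'_def algebra_simps sum_subtractf)
        also have "norm \<dots> \<le> e1 * ?n * norm h"
          using elim q S(4) by (intro norm_split_combination_le) (auto simp: dist_norm less_imp_le)
        also have "\<dots> = e * norm h" by (simp add: e1_def)
        finally show "norm ((\<Sum>k<n. f' k q h) - g' q h) \<le> e * norm h" .
      qed
    qed
  qed
  have fsums: "(\<lambda>k. f k q) sums half_ext c j \<phi> q" if "q \<in> S" for q
    using tendsto_uniform_limitI[OF half_ext_uniform_limit[where j=j and \<phi>=\<phi> and B=B, OF c M\<phi>], where x=q] that S(4)
    by (auto simp: sums_def f_def w_def m_def)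
  obtain g where g: "\<forall>q\<in>S. (\<lambda>n. f n q) sums g q \<and> (g has_derivative g' q) (at q within S)"
    using has_derivative_series[OF S(1) fder _ S(3) fsums[OF S(3)], of g'] unif by (auto simp: eventually_sequentially)
  then have "(g has_derivative g' p) (at p)" using S at_within_open by metis
  moreover have "g q = half_ext c j \<phi> q" if "q \<in> S" for q
    using g fsums that sums_unique2 by blast
  ultimately have "(half_ext c j \<phi> has_derivative g' p) (at p)"
    using has_derivative_transform_within_open S(2,3) by blast
  then show ?thesis unfolding g'_def .
qed

text \<open>
  The set \<open>\<Phi>\<close> stands for a function on the half space together with all of its derivatives; it replaces the
  notion of a smooth function up to the boundary. The directional derivatives of an extension are
  combinations of extensions of members of \<open>\<Phi>\<close>, so continuity of all these extensions gives smoothness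
  by induction.
\<close>

theorem seeley_extension:
  fixes \<Phi> :: "(real \<times> 'a::euclidean_space \<Rightarrow> 'b::euclidean_space) set"
  assumes c: "\<And>j. summable (\<lambda>k. \<bar>c k * (-(4^k))^j\<bar>)" "\<And>j. (\<Sum>k. c k * (-(4^k))^j) = 1"
    and B: "open B"
    and cont: "\<And>\<phi>. \<phi> \<in> \<Phi> \<Longrightarrow> continuous_on ({0..} \<times> B) \<phi>"
    and bdd: "\<And>\<phi>. \<phi> \<in> \<Phi> \<Longrightarrow> \<exists>M. \<forall>p\<in>{0..} \<times> B. norm (\<phi> p) \<le> M"
    and der: "\<And>\<phi>. \<phi> \<in> \<Phi> \<Longrightarrow> \<exists>\<psi> \<kappa>. \<psi> \<in> \<Phi> \<and> (\<forall>b\<in>Basis. \<kappa> b \<in> \<Phi>) \<and>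
      (\<forall>p. fst p > 0 \<longrightarrow> snd p \<in> B \<longrightarrow>
        (\<phi> has_derivative (\<lambda>h. fst h *\<^sub>R \<psi> p + (\<Sum>b\<in>Basis. (snd h \<bullet> b) *\<^sub>R \<kappa> b p))) (at p))"
    and \<phi>: "\<phi> \<in> \<Phi>"
  shows "smooth_on (UNIV \<times> B) (half_ext c j \<phi>)"
proof -
  have W: "open (UNIV \<times> B :: (real \<times> 'a) set)" using B by (simp add: open_Times)
  have C: "continuous_on (UNIV \<times> B) (half_ext c j \<phi>)" if "\<phi> \<in> \<Phi>" for \<phi> j
    using bdd[OF that] continuous_on_half_ext[OF c _ cont[OF that]] by blast
  have "Ck_on k (half_ext c j \<phi>) (UNIV \<times> B)" if "\<phi> \<in> \<Phi>" for k
    using that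
  proof (induction k arbitrary: j \<phi>)
    case 0
    then show ?case using C by simp
  next
    case (Suc k)
    from der[OF Suc.prems] obtain \<psi> \<kappa> where *: "\<psi> \<in> \<Phi> \<and> (\<forall>b\<in>Basis. \<kappa> b \<in> \<Phi>) \<and>
      (\<forall>p. fst p > 0 \<longrightarrow> snd p \<in> B \<longrightarrow>
        (\<phi> has_derivative (\<lambda>h. fst h *\<^sub>R \<psi> p + (\<Sum>b\<in>Basis. (snd h \<bullet> b) *\<^sub>R \<kappa> b p))) (at p))"
      by (elim exE) (rule that)
    have \<psi>: "\<psi> \<in> \<Phi>" using * by (rule conjunct1)
    have \<kappa>: "\<kappa> b \<in> \<Phi>" if "b \<in> Basis" for b
      using *[THEN conjunct2, THEN conjunct1] that by (rule bspec)
    have d: "(\<phi> has_derivative (\<lambda>h. fst h *\<^sub>R \<psi> p + (\<Sum>b\<in>Basis. (snd h \<bullet> b) *\<^sub>R \<kappa> b p))) (at p)"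
      if "fst p > 0" "snd p \<in> B" for p
      using *[THEN conjunct2, THEN conjunct2, rule_format, OF that] .
    obtain M\<phi> where M\<phi>: "\<And>p. p \<in> {0..} \<times> B \<Longrightarrow> norm (\<phi> p) \<le> M\<phi>" using bdd[OF Suc.prems] by metis
    obtain M\<psi> where M\<psi>: "\<And>p. p \<in> {0..} \<times> B \<Longrightarrow> norm (\<psi> p) \<le> M\<psi>" using bdd[OF \<psi>] by metis
    have "\<forall>b\<in>Basis. \<exists>M. \<forall>p\<in>{0..} \<times> B. norm (\<kappa> b p) \<le> M" using bdd \<kappa> by blast
    then obtain M\<kappa> where M\<kappa>: "\<And>b p. b \<in> Basis \<Longrightarrow> p \<in> {0..} \<times> B \<Longrightarrow> norm (\<kappa> b p) \<le> M\<kappa> b"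
      by metis
    define f' where "f' p h = fst h *\<^sub>R half_ext c (Suc j) \<psi> p +
      (\<Sum>b\<in>Basis. (snd h \<bullet> b) *\<^sub>R half_ext c j (\<kappa> b) p)" for p h
    show ?case
    proof (rule Ck_on_SucI[OF W])
      fix p :: "real \<times> 'a" assume p: "p \<in> UNIV \<times> B"
      show "(half_ext c j \<phi> has_derivative f' p) (at p)"
        unfolding f'_def
      proof (rule has_derivative_across_hyperplane[OF W C[OF Suc.prems] C[OF \<psi>] C[OF \<kappa>] _ p])
        fix q :: "real \<times> 'a" assume q: "q \<in> UNIV \<times> B" "fst q \<noteq> 0"
        show "(half_ext c j \<phi> has_derivative (\<lambda>h. fst h *\<^sub>R half_ext c (Suc j) \<psi> q +
            (\<Sum>b\<in>Basis. (snd h \<bullet> b) *\<^sub>R half_ext c j (\<kappa> b) q))) (at q)"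
        proof (cases "fst q < 0")
          case True
          show ?thesis
            by (rule half_ext_has_derivative_neg[OF c B True _ M\<phi> M\<psi> M\<kappa> d]) (use q in auto)
        next
          case False
          then have q0: "fst q > 0" using q by auto
          have "(\<phi> has_derivative (\<lambda>h. fst h *\<^sub>R half_ext c (Suc j) \<psi> q +
            (\<Sum>b\<in>Basis. (snd h \<bullet> b) *\<^sub>R half_ext c j (\<kappa> b) q))) (at q)"
            using d[OF q0] q q0 by (auto simp: half_ext_def mem_Times_iff)
          then show ?thesis
            by (rule has_derivative_transform_within_open[where s="{0<..} \<times> UNIV"])
              (use q0 in \<open>auto simp: half_ext_def mem_Times_iff intro!: open_Times\<close>)
        qed
      qed
    next
      fix h
      show "Ck_on k (\<lambda>p. f' p h) (UNIV \<times> B)" unfolding f'_def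
        by (intro Ck_on_add[OF W] Ck_on_sum[OF W] Ck_on_bilinear[OF W bounded_bilinear_scaleR]
            Ck_on_const[OF W] Suc.IH \<psi> \<kappa>)
    qed
  qed
  then show ?thesis using \<phi> by (simp add: smooth_on_def)
qed


text \<open>
  The chain rule applied to the identity \<open>g (- t, z) = g (t, z)\<close>.
\<close>

lemma even_odd_partial_derivatives:
  fixes g :: "real \<times> 'a::euclidean_space \<Rightarrow> 'b::euclidean_space"
  assumes sm: "smooth_on ({-\<epsilon><..<\<epsilon>} \<times> B) g" and B: "open B"
    and even: "\<And>t z. \<bar>t\<bar> < \<epsilon> \<Longrightarrow> z \<in> B \<Longrightarrow> g (-t, z) = g (t, z)"
    and t: "\<bar>t\<bar> < \<epsilon>" and z: "z \<in> B"
  shows "fd g (-t, z) (\<tau>, v) = fd g (t, z) (-\<tau>, v)"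
proof -
  let ?T = "{-\<epsilon><..<\<epsilon>} \<times> B"
  define m where "m p = (- fst p, snd p)" for p :: "real \<times> 'a"
  have T: "open ?T" using B by (intro open_Times) auto
  have mder: "(m has_derivative m) (at (t, z))"
    unfolding m_def by (auto intro!: derivative_eq_intros)
  have mt: "m (t, z) \<in> ?T" using t z by (auto simp: m_def)
  have "((\<lambda>p. g (m p)) has_derivative (\<lambda>h. fd g (m (t, z)) (m h))) (at (t, z))"
    using has_derivative_compose[where f=m and g=g, OF mder smooth_on_has_derivative[OF sm mt]] .
  then have "(g has_derivative (\<lambda>h. fd g (m (t, z)) (m h))) (at (t, z))"
    by (rule has_derivative_transform_within_open[OF _ T]) (use t z even in \<open>auto simp: m_def abs_less_iff\<close>)
  from fderiv_eqI[OF this] show ?thesis by (simp add: m_def)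
qed

text \<open>
  On \<open>s \<ge> 0\<close> the function \<open>a (s, z)\<close> has to be \<open>h (sqrt s, z)\<close>, and Seeley's extension continues it to
  \<open>s < 0\<close>. The extension needs bounded functions on a whole half line, so the variable is first changed to
  \<open>\<rho> s = \<delta> * sqrt (s / (1 + s))\<close>, which runs through \<open>{0..<\<delta>}\<close>. The functions \<open>g (\<rho> s, z)\<close> with \<open>g\<close> even and
  smooth are closed under derivatives: \<open>\<rho>\<close> has derivative \<open>K (\<rho> s) / \<rho> s\<close> with a polynomial \<open>K\<close> that is
  even, and the division by \<open>\<rho> s\<close> is absorbed by the Hadamard quotient of the odd function \<open>\<partial>g/\<partial>t\<close>.
\<close>

theorem even_function_smooth_in_square:
  fixes h :: "real \<times> 'a::euclidean_space \<Rightarrow> 'b::euclidean_space"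
  assumes \<epsilon>: "\<epsilon> > 0" and sm: "smooth_on ({-\<epsilon><..<\<epsilon>} \<times> B) h" and B: "open B" "z0 \<in> B"
    and even: "\<And>t z. \<bar>t\<bar> < \<epsilon> \<Longrightarrow> z \<in> B \<Longrightarrow> h (-t, z) = h (t, z)"
  obtains \<delta> r a where "0 < \<delta>" "\<delta> < \<epsilon>" "0 < r" "ball z0 r \<subseteq> B"
    "smooth_on ({..<\<delta>\<^sup>2} \<times> ball z0 r) a"
    "\<And>t z. \<bar>t\<bar> < \<delta> \<Longrightarrow> z \<in> ball z0 r \<Longrightarrow> h (t, z) = a (t\<^sup>2, z)"
proof -
  obtain c :: "nat \<Rightarrow> real" where c: "\<And>j. summable (\<lambda>k. \<bar>c k * (-(4^k))^j\<bar>)" "\<And>j. (\<Sum>k. c k * (-(4^k))^j) = 1"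
    by (rule seeley_coefficients) (rule that)
  define \<delta> where "\<delta> = \<epsilon> / 2"
  have \<delta>: "0 < \<delta>" "\<delta> < \<epsilon>" using \<epsilon> by (auto simp: \<delta>_def)
  obtain r where r: "r > 0" "cball z0 r \<subseteq> B" using B open_contains_cball by metis
  let ?T = "{-\<epsilon><..<\<epsilon>} \<times> B" and ?B = "ball z0 r"
  have T: "open ?T" using B by (intro open_Times) auto
  have BB: "?B \<subseteq> B" using r ball_subset_cball by blast
  define \<rho> where "\<rho> s = \<delta> * sqrt (s / (1 + s))" for s :: real
  have \<rho>: "0 \<le> \<rho> s" "\<rho> s < \<delta>" if "s \<ge> 0" for s
    using that \<delta> by (auto simp: \<rho>_def)
  have \<rho>2: "(\<rho> s)\<^sup>2 = \<delta>\<^sup>2 * (s / (1 + s))" if "s \<ge> 0" for s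
    using that by (simp add: \<rho>_def power_mult_distrib)
  have \<rho>pos: "\<rho> s > 0" if "s > 0" for s using that \<delta> by (simp add: \<rho>_def)
  have \<rho>cont: "continuous_on {0..} \<rho>" unfolding \<rho>_def by (intro continuous_intros) auto
  define K where "K t = \<delta>\<^sup>2 / 2 * (1 - t\<^sup>2 / \<delta>\<^sup>2)\<^sup>2" for t :: real
  have \<rho>der: "(\<rho> has_real_derivative K (\<rho> s) / \<rho> s) (at s)" if s: "s > 0" for s
  proof -
    have "1 - s / (1 + s) = 1 / (1 + s)" using s by (simp add: field_simps)
    then have K: "K (\<rho> s) = \<delta>\<^sup>2 / 2 * (1 / (1 + s))\<^sup>2"
      using s \<delta> by (simp add: K_def \<rho>2)
    have "((\<lambda>s. s / (1 + s)) has_real_derivative (1 / (1 + s))\<^sup>2) (at s)"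
      using s by (auto intro!: derivative_eq_intros simp: field_simps power2_eq_square)
    then have "(\<rho> has_real_derivative \<delta> * ((1 / (1 + s))\<^sup>2 * (inverse (sqrt (s / (1 + s))) / 2))) (at s)"
      unfolding \<rho>_def using s
      by (intro DERIV_cmult DERIV_chain2[OF DERIV_real_sqrt, THEN DERIV_cong]) auto
    moreover have aux: "\<delta> * (u * (inverse X / 2)) = \<delta>\<^sup>2 / 2 * u / (\<delta> * X)" if "X > 0" for u X
      using that \<delta> by (simp add: field_simps power2_eq_square)
    have "\<delta> * ((1 / (1 + s))\<^sup>2 * (inverse (sqrt (s / (1 + s))) / 2)) = K (\<rho> s) / \<rho> s"
      unfolding K unfolding \<rho>_def by (rule aux) (use s in simp)
    ultimately show ?thesis by simp
  qed
  define E where "E = {g :: real \<times> 'a \<Rightarrow> 'b. smooth_on ?T g \<and> (\<forall>t z. \<bar>t\<bar> < \<epsilon> \<longrightarrow> z \<in> B \<longrightarrow> g (-t, z) = g (t, z))}"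
  define C where "C g p = g (\<rho> (fst p), snd p)" for g :: "real \<times> 'a \<Rightarrow> 'b" and p :: "real \<times> 'a"
  define a0 where "a0 = half_ext c 0 (C h)"
  have a0: "smooth_on (UNIV \<times> ?B) a0"
    unfolding a0_def
  proof (rule seeley_extension[where \<Phi>="C ` E"])
    fix \<phi> assume "\<phi> \<in> C ` E"
    then obtain g where g: "g \<in> E" and \<phi>: "\<phi> = C g" by auto
    have gsm: "smooth_on ?T g" and gev: "\<And>t z. \<bar>t\<bar> < \<epsilon> \<Longrightarrow> z \<in> B \<Longrightarrow> g (-t, z) = g (t, z)"
      using g by (auto simp: E_def)
    note gcont = smooth_on_continuous_on[OF gsm]
    have mem: "(\<rho> (fst p), snd p) \<in> ?T" if "p \<in> {0..} \<times> B" for p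
      using that \<rho>[of "fst p"] \<delta> by auto
    have cont: "continuous_on ({0..} \<times> ?B) \<phi>"
    proof -
      have 1: "continuous_on ({0..} \<times> ?B) (\<lambda>p. \<rho> (fst p))"
        by (rule continuous_on_compose2[OF \<rho>cont]) (auto intro!: continuous_intros)
      have 2: "continuous_on ({0..} \<times> ?B) (\<lambda>p. (\<rho> (fst p), snd p))"
        by (intro continuous_on_Pair 1 continuous_intros)
      have 3: "(\<lambda>p. (\<rho> (fst p), snd p)) ` ({0..} \<times> ?B) \<subseteq> ?T"
        using mem BB by (intro image_subsetI) blast
      show ?thesis unfolding \<phi> C_def by (rule continuous_on_compose2[OF gcont 2 3])
    qed
    then show "continuous_on ({0..} \<times> ?B) \<phi>" .
    have "compact (g ` ({0..\<delta>} \<times> cball z0 r))"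
      by (intro compact_continuous_image continuous_on_subset[OF gcont] compact_Times) (use \<delta> r in auto)
    then obtain M where M: "\<And>p. p \<in> {0..\<delta>} \<times> cball z0 r \<Longrightarrow> norm (g p) \<le> M"
      using compact_imp_bounded bounded_iff by (metis (no_types, lifting) imageI)
    have "norm (\<phi> p) \<le> M" if "p \<in> {0..} \<times> ?B" for p
      unfolding \<phi> C_def using that \<rho>[of "fst p"] by (intro M) auto
    then show "\<exists>M. \<forall>p\<in>{0..} \<times> ?B. norm (\<phi> p) \<le> M" by blast
    have ev: "fd g (-t, z) (\<tau>, v) = fd g (t, z) (-\<tau>, v)"
      if "\<bar>t\<bar> < \<epsilon>" "z \<in> B" for t z \<tau> v
      by (rule even_odd_partial_derivatives[OF gsm B(1) _ that]) (rule gev)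
    let ?D = "\<lambda>p. fd g p"
    have lin: "linear (?D p)" if "p \<in> ?T" for p using smooth_on_linear_fderiv[OF gsm that] .
    have odd: "?D (-t, z) (1, 0) = - ?D (t, z) (1, 0)" if "\<bar>t\<bar> < \<epsilon>" "z \<in> B" for t z
      using ev[OF that, of 1 0] linear_neg[OF lin, of "(t, z)" "(1, 0)"] that
      by (auto simp: abs_less_iff)
    have zero: "?D (0, z) (1, 0) = 0" if "z \<in> B" for z
      using odd[of 0 z] that \<epsilon> by (simp add: eq_neg_iff_add_eq_0 flip: scaleR_2)
    obtain q where q: "smooth_on ?T q" "\<And>t z. \<bar>t\<bar> < \<epsilon> \<Longrightarrow> z \<in> B \<Longrightarrow> ?D (t, z) (1, 0) = t *\<^sub>R q (t, z)"
      using smooth_Hadamard_quotient[OF smooth_on_fderiv[OF gsm] B(1) zero] by blast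
    have qev: "q (-t, z) = q (t, z)" if "\<bar>t\<bar> < \<epsilon>" "z \<in> B" for t z
    proof (cases "t = 0")
      case False
      have "(-t) *\<^sub>R q (-t, z) = - (t *\<^sub>R q (t, z))" using q(2)[of t z] q(2)[of "-t" z] odd[of t z] that by (metis abs_minus_cancel)
      then show ?thesis using False by (rule scaleR_uminus_cancel)
    qed simp
    define g1 where "g1 p = K (fst p) *\<^sub>R q p" for p :: "real \<times> 'a"
    have g1: "g1 \<in> E"
      unfolding E_def g1_def K_def
      by (auto intro!: smooth_on_scaleR T q smooth_intros simp: qev) (use \<delta> in auto)
    have gb: "(\<lambda>p. ?D p (0, b)) \<in> E" for b
      unfolding E_def using smooth_on_fderiv[OF gsm] ev[of _ _ 0 b] by auto
    have d: "(\<phi> has_derivative (\<lambda>h. fst h *\<^sub>R C g1 p +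
        (\<Sum>b\<in>Basis. (snd h \<bullet> b) *\<^sub>R C (\<lambda>p. ?D p (0, b)) p))) (at p)"
      if p: "fst p > 0" "snd p \<in> ?B" for p
    proof -
      define m where "m p = (\<rho> (fst p), snd p)" for p :: "real \<times> 'a"
      have mp: "m p \<in> ?T" unfolding m_def using p BB by (intro mem) (auto simp: mem_Times_iff)
      have "(\<rho> has_derivative (*) (K (\<rho> (fst p)) / \<rho> (fst p))) (at (fst p))"
        using \<rho>der[OF p(1)] by (simp add: has_field_derivative_def)
      then have "((\<lambda>p. \<rho> (fst p)) has_derivative (\<lambda>h. K (\<rho> (fst p)) / \<rho> (fst p) * fst h)) (at p)"
        using has_derivative_compose[where f=fst and g=\<rho>] has_derivative_fst[OF has_derivative_ident] by blast
      then have md: "(m has_derivative (\<lambda>h. (K (\<rho> (fst p)) / \<rho> (fst p) * fst h, snd h))) (at p)"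
        unfolding m_def by (intro has_derivative_Pair) (auto intro!: derivative_eq_intros)
      have "(\<phi> has_derivative (\<lambda>h. ?D (m p) (K (\<rho> (fst p)) / \<rho> (fst p) * fst h, snd h))) (at p)"
        using has_derivative_compose[where f=m and g=g, OF md smooth_on_has_derivative[OF gsm mp]]
        unfolding \<phi> C_def m_def .
      moreover have "?D (m p) (K (\<rho> (fst p)) / \<rho> (fst p) * fst h, snd h) = fst h *\<^sub>R C g1 p +
        (\<Sum>b\<in>Basis. (snd h \<bullet> b) *\<^sub>R C (\<lambda>p. ?D p (0, b)) p)" for h
      proof -
        let ?k = "K (\<rho> (fst p)) / \<rho> (fst p)"
        have "(?k * fst h, snd h) = (?k * fst h) *\<^sub>R (1, 0) + (0, snd h)" by simp
        then have "?D (m p) (?k * fst h, snd h) = (?k * fst h) *\<^sub>R ?D (m p) (1, 0) + ?D (m p) (0, snd h)"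
          using linear_add[OF lin[OF mp]] linear_cmul[OF lin[OF mp]] by metis
        moreover have "?D (m p) (1, 0) = \<rho> (fst p) *\<^sub>R q (m p)"
          using q(2)[of "\<rho> (fst p)" "snd p"] mp by (auto simp: m_def abs_less_iff)
        moreover have "?D (m p) (0, snd h) = (\<Sum>b\<in>Basis. (snd h \<bullet> b) *\<^sub>R ?D (m p) (0, b))"
        proof (rule linear_eq_Basis_sum[of "\<lambda>v. ?D (m p) (0, v)"])
          have "linear (\<lambda>v::'a. (0::real, v))" by (auto intro!: linearI)
          from linear_compose[OF this lin[OF mp]] show "linear (\<lambda>v. ?D (m p) (0, v))"
            by (simp add: o_def)
        qed
        ultimately show ?thesis
          using \<rho>pos[OF p(1)] by (simp add: C_def g1_def m_def mult_ac)
      qed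
      ultimately show ?thesis by simp
    qed
    show "\<exists>\<psi> \<kappa>. \<psi> \<in> C ` E \<and> (\<forall>b\<in>Basis. \<kappa> b \<in> C ` E) \<and>
      (\<forall>p. fst p > 0 \<longrightarrow> snd p \<in> ?B \<longrightarrow>
        (\<phi> has_derivative (\<lambda>h. fst h *\<^sub>R \<psi> p + (\<Sum>b\<in>Basis. (snd h \<bullet> b) *\<^sub>R \<kappa> b p))) (at p))"
      by (rule exI[of _ "C g1"], rule exI[of _ "\<lambda>b. C (\<lambda>p. ?D p (0, b))"])
        (use g1 gb d in auto)
  qed (use c sm even in \<open>auto simp: E_def\<close>)
  \<comment> \<open>\<open>s = u / (\<delta>\<^sup>2 - u)\<close> solves \<open>(\<rho> s)\<^sup>2 = u\<close>\<close>
  define a where "a p = a0 (fst p / (\<delta>\<^sup>2 - fst p), snd p)" for p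
  show thesis
  proof
    show "smooth_on ({..<\<delta>\<^sup>2} \<times> ?B) a"
      unfolding a_def
      by (rule smooth_on_compose[OF a0])
        (auto intro!: smooth_intros open_Times)
    show "h (t, z) = a (t\<^sup>2, z)" if "\<bar>t\<bar> < \<delta>" "z \<in> ?B" for t z
    proof -
      have t2: "t\<^sup>2 < \<delta>\<^sup>2" using power_strict_mono[OF that(1), of 2] by simp
      define s where "s = t\<^sup>2 / (\<delta>\<^sup>2 - t\<^sup>2)"
      have s: "s \<ge> 0" using t2 by (simp add: s_def)
      have "1 + s = \<delta>\<^sup>2 / (\<delta>\<^sup>2 - t\<^sup>2)" using t2 by (simp add: s_def field_simps)
      then have "s / (1 + s) = t\<^sup>2 / \<delta>\<^sup>2" using t2 by (simp add: s_def)
      then have "\<rho> s = \<bar>t\<bar>" using \<delta> by (simp add: \<rho>_def real_sqrt_divide)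
      then have "a (t\<^sup>2, z) = h (\<bar>t\<bar>, z)"
        using s by (simp add: a_def a0_def half_ext_def C_def flip: s_def)
      also have "\<dots> = h (t, z)" using even[of t z] that BB \<delta> by (auto simp: abs_if)
      finally show ?thesis ..
    qed
  qed (use \<delta> r BB in auto)
qed

section \<open>Sard's theorem and generic perturbations\<close>

text \<open>
  An index type with \<open>DIM('a)\<close> elements that carries a wellorder, so that \<open>'a\<close> is isometric to a space of
  vectors to which \<open>baby_Sard\<close> applies.
\<close>

typedef (overloaded) ('a::euclidean_space) basis_index = "{..<DIM('a)}"
  by (rule exI[of _ 0]) simp

instantiation basis_index :: (euclidean_space) linorder
begin
definition less_eq_basis_index :: "'a basis_index \<Rightarrow> 'a basis_index \<Rightarrow> bool"
  where "a \<le> b \<longleftrightarrow> Rep_basis_index a \<le> Rep_basis_index b"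
definition less_basis_index :: "'a basis_index \<Rightarrow> 'a basis_index \<Rightarrow> bool"
  where "a < b \<longleftrightarrow> Rep_basis_index a < Rep_basis_index b"
instance
  by intro_classes (auto simp: less_eq_basis_index_def less_basis_index_def Rep_basis_index_inject)
end

instance basis_index :: (euclidean_space) wellorder
proof
  fix P :: "'a basis_index \<Rightarrow> bool" and a
  assume step: "\<And>x. (\<And>y. y < x \<Longrightarrow> P y) \<Longrightarrow> P x"
  show "P a"
  proof (induction a rule: measure_induct_rule[where f=Rep_basis_index])
    case (less x)
    show ?case by (rule step, rule less) (simp add: less_basis_index_def)
  qed
qed

lemma finite_basis_index: "finite (UNIV :: 'a::euclidean_space basis_index set)"
  by (metis finite_imageI finite_lessThan type_definition.univ type_definition_basis_index)

instance basis_index :: (euclidean_space) finite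
  by standard (rule finite_basis_index)

lemma card_basis_index: "CARD('a::euclidean_space basis_index) = DIM('a)"
  by (simp add: type_definition.card[OF type_definition_basis_index])

lemma Sard_noninjective_derivative:
  fixes f :: "'a::euclidean_space \<Rightarrow> 'a"
  assumes der: "\<And>x. x \<in> S \<Longrightarrow> (f has_derivative f' x) (at x)"
    and inj: "\<And>x. x \<in> S \<Longrightarrow> \<not> inj (f' x)"
  shows "negligible (f ` S)"
proof -
  have "DIM('a) = DIM(real^'a basis_index)" by (simp add: card_basis_index)
  then obtain \<phi> :: "'a \<Rightarrow> real^'a basis_index" and \<psi> where lin: "linear \<phi>" "linear \<psi>"
    and norm: "\<And>y. norm (\<psi> y) = norm y" and inv: "\<And>x. \<psi> (\<phi> x) = x" "\<And>y. \<phi> (\<psi> y) = y"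
    by (rule isomorphisms_UNIV_UNIV) (rule that)
  let ?F = "\<lambda>y. \<phi> (f (\<psi> y))" and ?F' = "\<lambda>y h. \<phi> (f' (\<psi> y) (\<psi> h))"
  have "negligible (?F ` (\<phi> ` S))"
  proof (rule baby_Sard)
    fix y assume "y \<in> \<phi> ` S"
    then have y: "\<psi> y \<in> S" using inv by auto
    have \<psi>: "(\<psi> has_derivative \<psi>) (at y)" using lin(2) by (rule linear_imp_has_derivative)
    have "((\<lambda>y. f (\<psi> y)) has_derivative (\<lambda>h. f' (\<psi> y) (\<psi> h))) (at y)"
      using has_derivative_compose[where f=\<psi> and g=f] \<psi> der[OF y] by blast
    then have d: "(?F has_derivative ?F' y) (at y)"
      using bounded_linear.has_derivative[of \<phi>] lin(1) linear_conv_bounded_linear by blast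
    then show "(?F has_derivative ?F' y) (at y within \<phi> ` S)" by (rule has_derivative_at_withinI)
    have "\<not> inj (?F' y)"
    proof
      assume i: "inj (?F' y)"
      have "inj (f' (\<psi> y))"
      proof (rule injI)
        fix a b assume "f' (\<psi> y) a = f' (\<psi> y) b"
        then have "?F' y (\<phi> a) = ?F' y (\<phi> b)" by (simp add: inv)
        then have "\<phi> a = \<phi> b" by (rule injD[OF i])
        then show "a = b" by (metis inv(1))
      qed
      then show False using inj[OF y] by blast
    qed
    moreover have "(*v) (matrix (?F' y)) = ?F' y" using has_derivative_linear[OF d] by auto
    ultimately show "rank (matrix (?F' y)) < CARD('a basis_index)"
      by (simp add: less_rank_noninjective)
  qed simp
  then have "negligible (\<psi> ` (?F ` (\<phi> ` S)))"
  proof (rule negligible_locally_Lipschitz_image[rotated])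
    show "\<exists>T B. open T \<and> x \<in> T \<and> (\<forall>y\<in>?F ` \<phi> ` S \<inter> T. norm (\<psi> y - \<psi> x) \<le> B * norm (y - x))" for x
      by (rule exI[of _ UNIV], rule exI[of _ 1]) (simp add: norm flip: linear_diff[OF lin(2)])
  qed (simp add: card_basis_index)
  then show ?thesis by (simp add: image_image inv)
qed

text \<open>
  Singular points are described by the equation \<open>DG(x) v = 0\<close> in both \<open>x\<close> and \<open>v\<close>; this is its linearisation.
\<close>

lemma has_derivative_fderiv_pair:
  fixes f :: "'a::euclidean_space \<Rightarrow> 'b::euclidean_space"
  assumes sm: "smooth_on S f" and S: "open S" "x \<in> S"
  shows "((\<lambda>p. fd f (fst p) (snd p)) has_derivative
    (\<lambda>h. fd (\<lambda>y. fd f y v) x (fst h) +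
      fd f x (snd h))) (at (x, v))"
proof -
  let ?D = "\<lambda>y. fd f y"
  let ?D2 = "\<lambda>w. fd (\<lambda>y. ?D y w) x"
  have lin: "linear (?D y)" if "y \<in> S" for y using smooth_on_linear_fderiv[OF sm that] .
  have d: "((\<lambda>y. ?D y w) has_derivative ?D2 w) (at x)" for w
    using smooth_on_has_derivative[OF smooth_on_fderiv[OF sm] S(2)] .
  have "((\<lambda>y. \<Sum>b\<in>Basis. (v \<bullet> b) *\<^sub>R ?D y b) has_derivative (\<lambda>h. \<Sum>b\<in>Basis. (v \<bullet> b) *\<^sub>R ?D2 b h)) (at x)"
    by (intro has_derivative_sum has_derivative_scaleR_right d)
  then have "((\<lambda>y. ?D y v) has_derivative (\<lambda>h. \<Sum>b\<in>Basis. (v \<bullet> b) *\<^sub>R ?D2 b h)) (at x)"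
    by (rule has_derivative_transform_within_open[OF _ S]) (rule linear_eq_Basis_sum[OF lin, symmetric])
  from fderiv_eqI[OF this] have D2: "?D2 v h = (\<Sum>b\<in>Basis. (v \<bullet> b) *\<^sub>R ?D2 b h)" for h
    by (simp add: fun_eq_iff)
  have "((\<lambda>p. ?D (fst p) b) has_derivative (\<lambda>h. ?D2 b (fst h))) (at (x, v))" for b
    by (rule has_derivative_compose[where f=fst and g="\<lambda>y. ?D y b"])
      (auto intro: has_derivative_fst[OF has_derivative_ident] d)
  then have "((\<lambda>p. \<Sum>b\<in>Basis. (snd p \<bullet> b) *\<^sub>R ?D (fst p) b) has_derivative
      (\<lambda>h. \<Sum>b\<in>Basis. (snd (x, v) \<bullet> b) *\<^sub>R ?D2 b (fst h) + (snd h \<bullet> b) *\<^sub>R ?D (fst (x, v)) b)) (at (x, v))"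
    by (intro has_derivative_sum has_derivative_scaleR) (auto intro!: derivative_eq_intros)
  then have "((\<lambda>p. ?D (fst p) (snd p)) has_derivative
      (\<lambda>h. \<Sum>b\<in>Basis. (snd (x, v) \<bullet> b) *\<^sub>R ?D2 b (fst h) + (snd h \<bullet> b) *\<^sub>R ?D (fst (x, v)) b)) (at (x, v))"
    by (rule has_derivative_transform_within_open[where s="S \<times> UNIV"])
      (use S in \<open>auto intro!: open_Times linear_eq_Basis_sum[OF lin, symmetric]\<close>)
  moreover have "(\<Sum>b\<in>Basis. (snd (x, v) \<bullet> b) *\<^sub>R ?D2 b (fst h) + (snd h \<bullet> b) *\<^sub>R ?D (fst (x, v)) b)
      = ?D2 v (fst h) + ?D x (snd h)" for h
    using D2[of "fst h"] linear_eq_Basis_sum[OF lin[OF S(2)], of "snd h"] by (simp add: sum.distrib)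
  ultimately show ?thesis by simp
qed

text \<open>
  One column of a matrix with \<open>2n - 1\<close> rows has room for the \<open>n\<close> coordinates of a point and for the \<open>n - 1\<close>
  free coordinates of a direction whose \<open>i\<close>-th coordinate is prescribed.
\<close>

lemma exists_position_direction_coding:
  assumes card: "CARD('p::finite) = 2 * CARD('n::finite) - 1"
  obtains X V :: "real^'p \<Rightarrow> real^'n" where "linear X" "linear V" "\<And>c. V c $ i = 0"
    "\<And>\<xi> \<eta>. \<eta> $ i = 0 \<Longrightarrow> \<exists>c. X c = \<xi> \<and> V c = \<eta>"
proof -
  let ?K = "range Inl \<union> Inr ` (UNIV - {i}) :: ('n + 'n) set"
  have "card ?K = card (range Inl :: ('n + 'n) set) + card (Inr ` (UNIV - {i}) :: ('n + 'n) set)"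
    by (rule card_Un_disjoint) auto
  also have "\<dots> = CARD('n) + (CARD('n) - 1)" by (simp add: card_image)
  also have "\<dots> = CARD('p)" using card zero_less_card_finite[where 'a='n] by linarith
  finally obtain \<gamma> :: "'n + 'n \<Rightarrow> 'p" where \<gamma>: "bij_betw \<gamma> ?K UNIV"
    using finite_same_card_bij[of ?K "UNIV :: 'p set"] by auto
  define X where "X c = (\<chi> k. c $ \<gamma> (Inl k))" for c :: "real^'p"
  define V where "V c = (\<chi> k. if k = i then 0 else c $ \<gamma> (Inr k))" for c :: "real^'p"
  show thesis
  proof
    show "linear X" "linear V" by (auto intro!: linearI simp: X_def V_def vec_eq_iff)
    show "V c $ i = 0" for c by (simp add: V_def)
    show "\<exists>c. X c = \<xi> \<and> V c = \<eta>" if "\<eta> $ i = 0" for \<xi> \<eta>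
    proof -
      define c where "c = (\<chi> l. case inv_into ?K \<gamma> l of Inl k \<Rightarrow> \<xi> $ k | Inr k \<Rightarrow> \<eta> $ k)"
      have "inv_into ?K \<gamma> (\<gamma> a) = a" if "a \<in> ?K" for a
        using \<gamma> that by (simp add: bij_betw_def inv_into_f_f)
      then have "X c = \<xi>" "V c = \<eta>" using that by (auto simp: X_def V_def c_def vec_eq_iff)
      then show ?thesis by blast
    qed
  qed
qed

text \<open>
  Since \<open>u = De(x) v\<close> has a nonzero \<open>j\<close>-th entry, the equation \<open>D\<Phi>(x) v + A u = 0\<close> determines the
  \<open>j\<close>-th column of \<open>A\<close> from \<open>x\<close>, \<open>v\<close> and the other columns. The map \<open>P\<close> of the proof performs this:
  the \<open>j\<close>-th column of its argument \<open>B\<close> encodes \<open>x\<close> and \<open>v\<close>, and the other columns are kept. Differentiating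
  the identity \<open>D\<Phi>(x) v + P(B) u = 0\<close> shows that the derivative of \<open>P\<close> kills the direction that encodes a
  degenerate pair \<open>(\<xi>, \<eta>)\<close>. Hence the matrices in question are critical values of \<open>P\<close>.
\<close>

lemma negligible_degenerate_in_chart:
  fixes e :: "real^'n::finite \<Rightarrow> real^'m::finite" and \<Phi> :: "real^'n \<Rightarrow> real^'p::finite"
  assumes card: "CARD('p) = 2 * CARD('n) - 1" and \<Omega>: "open \<Omega>"
    and e: "smooth_on \<Omega> e" and \<Phi>: "smooth_on \<Omega> \<Phi>"
  shows "negligible {A :: real^'m^'p. \<exists>x\<in>\<Omega>. \<exists>v \<xi> \<eta>. v $ i = 1 \<and> \<eta> $ i = 0 \<and> (\<xi>, \<eta>) \<noteq> 0 \<and>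
    fd e x v $ j \<noteq> 0 \<and>
    fd \<Phi> x v + A *v fd e x v = 0 \<and>
    fd (\<lambda>y. fd \<Phi> y v) x \<xi> + fd \<Phi> x \<eta> +
    A *v (fd (\<lambda>y. fd e y v) x \<xi> + fd e x \<eta>) = 0}"
    (is "negligible ?Bad")
proof -
  obtain X V :: "real^'p \<Rightarrow> real^'n" where X: "linear X" and V: "linear V" and Vi: "\<And>c. V c $ i = 0"
    and surj: "\<And>\<xi> \<eta>. \<eta> $ i = 0 \<Longrightarrow> \<exists>c. X c = \<xi> \<and> V c = \<eta>"
    using exists_position_direction_coding[OF card, of i] by blast
  define col where "col B = (\<chi> l. B $ l $ j)" for B :: "real^'m^'p"
  define put where "put w = (\<chi> l k. if k = j then w $ l else 0)" for w :: "real^'p" 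
  define pos where "pos B = (X (col B), axis i 1 + V (col B))" for B :: "real^'m^'p"
  define Q where "Q B = fd \<Phi> (fst (pos B)) (snd (pos B))" for B :: "real^'m^'p"
  define u where "u B = fd e (fst (pos B)) (snd (pos B))" for B :: "real^'m^'p"
  \<comment> \<open>\<open>T B\<close> is the difference between the column that solves the equation and the \<open>j\<close>-th column of \<open>B\<close>\<close>
  define T where "T B = (- (1 / u B $ j)) *\<^sub>R (Q B + B *v u B - (u B $ j) *\<^sub>R col B) - col B" for B
  define P where "P B = B + put (T B)" for B :: "real^'m^'p"
  have lcol: "linear col" by (auto intro!: linearI simp: col_def vec_eq_iff)
  have lput: "linear (put :: real^'p \<Rightarrow> real^'m^'p)" by (auto intro!: linearI simp: put_def vec_eq_iff)
  have colput: "col (put w) = w" for w by (simp add: col_def put_def vec_eq_iff)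
  have putv: "put w *v y = (y $ j) *\<^sub>R w" for w :: "real^'p" and y :: "real^'m"
  proof -
    have "(\<Sum>k\<in>UNIV. (if k = j then w $ l else 0) * y $ k) = y $ j * w $ l" for l
    proof -
      have "(\<Sum>k\<in>UNIV. (if k = j then w $ l else 0) * y $ k) = (\<Sum>k\<in>UNIV. if k = j then w $ l * y $ k else 0)"
        by (intro sum.cong) auto
      then show ?thesis by (simp add: mult.commute)
    qed
    then show ?thesis by (simp add: put_def matrix_vector_mult_def vec_eq_iff)
  qed
  have bb: "bounded_bilinear ((*v) :: real^'m^'p \<Rightarrow> real^'m \<Rightarrow> real^'p)"
    unfolding bilinear_conv_bounded_bilinear[symmetric] bilinear_def
    by (auto intro!: linearI simp: matrix_vector_mult_def vec_eq_iff sum.distrib sum_distrib_left algebra_simps)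
  define pos' where "pos' C = (X (col C), V (col C))" for C :: "real^'m^'p"
  have posd: "(pos has_derivative pos') (at B)" for B
  proof -
    have "linear (\<lambda>B. X (col B))" "linear (\<lambda>B. V (col B))"
      using linear_compose[OF lcol X] linear_compose[OF lcol V] by (auto simp: o_def)
    then show ?thesis unfolding pos_def pos'_def
      by (auto intro!: derivative_eq_intros linear_imp_has_derivative)
  qed
  define Q' where "Q' B C = fd (\<lambda>y. fd \<Phi> y (snd (pos B))) (fst (pos B)) (fst (pos' C)) +
      fd \<Phi> (fst (pos B)) (snd (pos' C))" for B C
  define u' where "u' B C = fd (\<lambda>y. fd e y (snd (pos B))) (fst (pos B)) (fst (pos' C)) +
      fd e (fst (pos B)) (snd (pos' C))" for B C
  have Qd: "(Q has_derivative Q' B) (at B)" if "fst (pos B) \<in> \<Omega>" for B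
    using has_derivative_compose[where f=pos and g="\<lambda>p. fd \<Phi> (fst p) (snd p)", OF posd]
      has_derivative_fderiv_pair[OF \<Phi> \<Omega> that, of "snd (pos B)"]
    unfolding Q_def Q'_def by simp
  have ud: "(u has_derivative u' B) (at B)" if "fst (pos B) \<in> \<Omega>" for B
    using has_derivative_compose[where f=pos and g="\<lambda>p. fd e (fst p) (snd p)", OF posd]
      has_derivative_fderiv_pair[OF e \<Omega> that, of "snd (pos B)"]
    unfolding u_def u'_def by simp
  have Td: "T differentiable (at B)" if B: "fst (pos B) \<in> \<Omega>" "u B $ j \<noteq> 0" for B
  proof -
    have 1: "Q differentiable (at B)" "u differentiable (at B)" using Qd[OF B(1)] ud[OF B(1)] by (auto simp: differentiable_def)
    have 2: "col differentiable (at B)" using lcol by (simp add: linear_imp_differentiable)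
    have 3: "(\<lambda>B. u B $ j) differentiable (at B)"
      using bounded_linear.has_derivative[OF bounded_linear_vec_nth ud[OF B(1)]] by (auto simp: differentiable_def)
    have 4: "(\<lambda>B. B *v u B) differentiable (at B)"
      using bounded_bilinear.FDERIV[OF bb has_derivative_ident ud[OF B(1)]] by (auto simp: differentiable_def)
    show ?thesis unfolding T_def
      by (intro derivative_intros differentiable_scaleR differentiable_diff differentiable_add
          differentiable_minus differentiable_divide differentiable_const 1 2 3 4 B(2))
  qed
  define T' where "T' B = fd T B" for B
  define P' where "P' B C = C + put (T' B C)" for B and C :: "real^'m^'p"
  have Pd: "(P has_derivative P' B) (at B)" if "fst (pos B) \<in> \<Omega>" "u B $ j \<noteq> 0" for B
  proof -
    have "(T has_derivative T' B) (at B)" using Td[OF that] frechet_derivative_works unfolding T'_def by blast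
    then have "((\<lambda>B. put (T B)) has_derivative (\<lambda>C. put (T' B C))) (at B)"
      using bounded_linear.has_derivative[of put] lput linear_conv_bounded_linear by blast
    then show ?thesis unfolding P_def P'_def by (intro has_derivative_add has_derivative_ident)
  qed
  have ident: "Q B + P B *v u B = 0" if "u B $ j \<noteq> 0" for B
    using that by (simp add: P_def T_def matrix_vector_mult_add_rdistrib putv scaleR_diff_right algebra_simps)
  let ?S = "{B. fst (pos B) \<in> \<Omega> \<and> u B $ j \<noteq> 0 \<and> \<not> inj (P' B)}"
  have "negligible (P ` ?S)"
    by (rule Sard_noninjective_derivative[where f'=P']) (auto intro: Pd)
  moreover have "?Bad \<subseteq> P ` ?S"
  proof clarify
    fix A :: "real^'m^'p" and x v \<xi> \<eta>
    assume x: "x \<in> \<Omega>" and v: "v $ i = 1" and \<eta>: "\<eta> $ i = 0" and ne: "(\<xi>, \<eta>) \<noteq> 0"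
      and uj: "fd e x v $ j \<noteq> 0"
      and z1: "fd \<Phi> x v + A *v fd e x v = 0"
      and z2: "fd (\<lambda>y. fd \<Phi> y v) x \<xi> + fd \<Phi> x \<eta> +
        A *v (fd (\<lambda>y. fd e y v) x \<xi> + fd e x \<eta>) = 0"
    obtain c0 where c0: "X c0 = x" "V c0 = v - axis i 1" using surj[of "v - axis i 1" x] v by auto
    obtain c where c: "X c = \<xi>" "V c = \<eta>" using surj[of \<eta> \<xi>] \<eta> by auto
    have c_ne: "c \<noteq> 0" using ne c linear_0[OF X] linear_0[OF V] by (auto simp: zero_prod_def)
    \<comment> \<open>keep \<open>A\<close> except for the \<open>j\<close>-th column, which becomes the code of \<open>(x, v)\<close>\<close>
    define B where "B = A + put (c0 - col A)"
    have colB: "col B = c0" by (simp add: B_def linear_add[OF lcol] colput)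
    have posB: "pos B = (x, v)" by (simp add: pos_def colB c0)
    have uB: "u B = fd e x v" by (simp add: u_def posB)
    have QB: "Q B = fd \<Phi> x v" by (simp add: Q_def posB)
    have inS: "fst (pos B) \<in> \<Omega>" "u B $ j \<noteq> 0" using x uj posB uB by auto
    have PB: "P B = A"
    proof -
      have "Q B + A *v u B = 0" using z1 QB uB by simp
      then have "Q B + B *v u B - (u B $ j) *\<^sub>R c0 = - (u B $ j) *\<^sub>R col A"
        by (simp add: B_def matrix_vector_mult_add_rdistrib putv algebra_simps)
      then have "T B = col A - c0" using inS(2) by (simp add: T_def colB)
      moreover have "put (c0 - col A) + put (col A - c0) = (0 :: real^'m^'p)"
        by (simp add: put_def vec_eq_iff)
      ultimately show ?thesis by (simp add: P_def B_def)
    qed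
    \<comment> \<open>the direction in which \<open>(x, v)\<close> moves by \<open>(\<xi>, \<eta>)\<close> and the other columns stay fixed\<close>
    define C where "C = (put c :: real^'m^'p)"
    have pos'C: "pos' C = (\<xi>, \<eta>)" by (simp add: pos'_def C_def colput c)
    have z2': "Q' B C + A *v u' B C = 0"
      using z2 by (simp add: Q'_def u'_def pos'C posB)
    have "P' B C *v u B = 0"
    proof -
      have d: "((\<lambda>B. Q B + P B *v u B) has_derivative (\<lambda>C. Q' B C + (P B *v u' B C + P' B C *v u B))) (at B)"
        by (intro has_derivative_add Qd bounded_bilinear.FDERIV[OF bb] Pd ud inS)
      have "isCont u B" using ud[OF inS(1)] has_derivative_continuous by blast
      then have "((\<lambda>B. u B $ j) \<longlongrightarrow> u B $ j) (at B)" unfolding isCont_def by (rule tendsto_vec_nth)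
      then have "\<forall>\<^sub>F B' in at B. u B' $ j \<noteq> 0" using inS(2) tendsto_imp_eventually_ne by blast
      then have "\<forall>\<^sub>F B' in at B. Q B' + P B' *v u B' = 0" by eventually_elim (rule ident)
      then have "((\<lambda>B. 0) has_derivative (\<lambda>C. Q' B C + (P B *v u' B C + P' B C *v u B))) (at B)"
        using has_derivative_transform_eventually[OF d] ident[OF inS(2)] by auto
      then have "(\<lambda>C. Q' B C + (P B *v u' B C + P' B C *v u B)) = (\<lambda>C. 0)"
        using has_derivative_unique has_derivative_const by blast
      then have "Q' B C + (P B *v u' B C + P' B C *v u B) = 0" by metis
      then show ?thesis using z2' PB by (simp add: add.assoc[symmetric])
    qed
    moreover have "P' B C = put (c + T' B C)"
      by (simp add: P'_def C_def linear_add[OF lput])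
    ultimately have "P' B C = 0" using inS(2) by (simp add: putv linear_0[OF lput])
    moreover have "P' B 0 = 0" using linear_0[OF has_derivative_linear[OF Pd[OF inS]]] .
    moreover have "C \<noteq> 0" using c_ne colput linear_0[OF lcol] unfolding C_def by metis
    ultimately have "\<not> inj (P' B)" by (metis injD)
    then show "A \<in> P ` ?S" using PB inS by blast
  qed
  ultimately show ?thesis by (rule negligible_subset)
qed


text \<open>
  For a kernel vector \<open>v \<noteq> 0\<close> of \<open>DG(x)\<close>: the linearisation of the equation \<open>DG(x) v = 0\<close> is injective
  up to rescaling \<open>v\<close>. In other words, \<open>v\<close> spans the kernel, and \<open>\<xi> \<mapsto> D\<^sup>2G(x)(v, \<xi>)\<close> is injective modulo
  the image of \<open>DG(x)\<close>.
\<close>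

definition whitney_nondegenerate ::
  "('a::euclidean_space \<Rightarrow> 'b::euclidean_space) \<Rightarrow> 'a \<Rightarrow> 'a \<Rightarrow> bool" where
  "whitney_nondegenerate G x v \<longleftrightarrow> (\<forall>\<xi> \<eta>.
     fd (\<lambda>y. fd G y v) x \<xi> + fd G x \<eta> = 0
     \<longrightarrow> \<xi> = 0 \<and> \<eta> \<in> span {v})"

text \<open>
  A kernel vector can be scaled such that one coordinate is \<open>1\<close>, and a degenerate pair \<open>(\<xi>, \<eta>)\<close> can be
  changed along with it such that the same coordinate of \<open>\<eta>\<close> vanishes. As \<open>De(x)\<close> is injective, \<open>De(x) v\<close> has
  a nonzero entry. This leaves finitely many choices of these two positions, and each is covered by
  \<open>negligible_degenerate_in_chart\<close>.
\<close>

theorem negligible_degenerate_perturbations: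
  fixes e :: "real^'n::finite \<Rightarrow> real^'m::finite" and \<Phi> :: "real^'n \<Rightarrow> real^'p::finite"
  assumes card: "CARD('p) = 2 * CARD('n) - 1" and \<Omega>: "open \<Omega>"
    and e: "smooth_on \<Omega> e" and \<Phi>: "smooth_on \<Omega> \<Phi>"
    and imm: "\<And>x. x \<in> \<Omega> \<Longrightarrow> inj (fd e x)"
  shows "negligible {A :: real^'m^'p. \<exists>x\<in>\<Omega>. \<exists>v. v \<noteq> 0 \<and>
    fd (\<lambda>y. \<Phi> y + A *v e y) x v = 0 \<and>
    \<not> whitney_nondegenerate (\<lambda>y. \<Phi> y + A *v e y) x v}" (is "negligible ?Bad")
proof -
  let ?De = "\<lambda>x. fd e x" and ?D\<Phi> = "\<lambda>x. fd \<Phi> x"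
  let ?De2 = "\<lambda>v x. fd (\<lambda>y. ?De y v) x" and ?D\<Phi>2 = "\<lambda>v x. fd (\<lambda>y. ?D\<Phi> y v) x"
  define Bad where "Bad i j = {A :: real^'m^'p. \<exists>x\<in>\<Omega>. \<exists>v \<xi> \<eta>. v $ i = 1 \<and> \<eta> $ i = 0 \<and> (\<xi>, \<eta>) \<noteq> 0 \<and>
    ?De x v $ j \<noteq> 0 \<and> ?D\<Phi> x v + A *v ?De x v = 0 \<and>
    ?D\<Phi>2 v x \<xi> + ?D\<Phi> x \<eta> + A *v (?De2 v x \<xi> + ?De x \<eta>) = 0}" for i j
  have "negligible (Bad i j)" for i j
    unfolding Bad_def by (rule negligible_degenerate_in_chart[OF card \<Omega> e \<Phi>])
  then have "negligible (\<Union>(i, j)\<in>UNIV. Bad i j)" by (intro negligible_Union) auto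
  moreover have "?Bad \<subseteq> (\<Union>(i, j)\<in>UNIV. Bad i j)"
  proof clarify
    fix A :: "real^'m^'p" and x v
    let ?G = "\<lambda>y. \<Phi> y + A *v e y"
    assume x: "x \<in> \<Omega>" and v: "v \<noteq> 0" and Dv: "fd ?G x v = 0"
      and nd: "\<not> whitney_nondegenerate ?G x v"
    have blA: "bounded_linear ((*v) A)" by (simp add: matrix_vector_mul_bounded_linear)
    have D1: "fd ?G y = (\<lambda>w. ?D\<Phi> y w + A *v ?De y w)" if "y \<in> \<Omega>" for y
      by (intro fderiv_eqI has_derivative_add bounded_linear.has_derivative[OF blA]
          smooth_on_has_derivative[OF \<Phi> that] smooth_on_has_derivative[OF e that])
    have "((\<lambda>y. ?D\<Phi> y v + A *v ?De y v) has_derivative (\<lambda>\<xi>. ?D\<Phi>2 v x \<xi> + A *v ?De2 v x \<xi>)) (at x)"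
      by (intro has_derivative_add bounded_linear.has_derivative[OF blA]
          smooth_on_has_derivative[OF smooth_on_fderiv[OF \<Phi>] x] smooth_on_has_derivative[OF smooth_on_fderiv[OF e] x])
    then have "((\<lambda>y. fd ?G y v) has_derivative (\<lambda>\<xi>. ?D\<Phi>2 v x \<xi> + A *v ?De2 v x \<xi>)) (at x)"
      by (rule has_derivative_transform_within_open[OF _ \<Omega> x]) (simp add: D1)
    note D2 = fderiv_eqI[OF this]
    obtain \<xi> \<eta> where z: "?D\<Phi>2 v x \<xi> + A *v ?De2 v x \<xi> + (?D\<Phi> x \<eta> + A *v ?De x \<eta>) = 0"
      and ne: "\<not> (\<xi> = 0 \<and> \<eta> \<in> span {v})"
      using nd unfolding whitney_nondegenerate_def D2 D1[OF x] by blast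
    obtain i where i: "v $ i \<noteq> 0" using v by (auto simp: vec_eq_iff)
    note lin\<Phi> = smooth_on_linear_fderiv[OF \<Phi> x] and line = smooth_on_linear_fderiv[OF e x]
    have "?De x v \<noteq> 0" using injD[OF imm[OF x], of v 0] v linear_0[OF line] by auto
    then obtain j where j: "?De x v $ j \<noteq> 0" by (auto simp: vec_eq_iff)
    \<comment> \<open>rescale the kernel vector so that its \<open>i\<close>-th coordinate is 1\<close>
    define r where "r = inverse (v $ i)"
    have r: "r \<noteq> 0" "r * v $ i = 1" using i by (auto simp: r_def)
    define w where "w = r *\<^sub>R v"
    define \<xi>' where "\<xi>' = inverse r *\<^sub>R \<xi>"
    define \<eta>' where "\<eta>' = \<eta> - (\<eta> $ i) *\<^sub>R w"
    have sc: "fd (\<lambda>y. fd f y w) x \<xi>' =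
        fd (\<lambda>y. fd f y v) x \<xi>"
      if f: "smooth_on \<Omega> f" for f :: "real^'n \<Rightarrow> real^'k::finite"
    proof -
      note d = smooth_on_has_derivative[OF smooth_on_fderiv[OF f, of v] x]
      have "((\<lambda>y. r *\<^sub>R fd f y v) has_derivative
          (\<lambda>\<xi>. r *\<^sub>R fd (\<lambda>y. fd f y v) x \<xi>)) (at x)"
        by (rule has_derivative_scaleR_right[OF d])
      then have "((\<lambda>y. fd f y w) has_derivative
          (\<lambda>\<xi>. r *\<^sub>R fd (\<lambda>y. fd f y v) x \<xi>)) (at x)"
        by (rule has_derivative_transform_within_open[OF _ \<Omega> x])
          (simp add: w_def linear_cmul[OF smooth_on_linear_fderiv[OF f]])
      from fderiv_eqI[OF this] show ?thesis
        using r linear_cmul[OF has_derivative_linear[OF d]] by (simp add: \<xi>'_def)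
    qed
    have Dvw: "?D\<Phi> x v + A *v ?De x v = 0" using Dv D1[OF x] by metis
    have w0: "?D\<Phi> x w + A *v ?De x w = 0"
      using arg_cong[OF Dvw, of "(*\<^sub>R) r"]
      by (simp add: w_def linear_cmul[OF lin\<Phi>] linear_cmul[OF line] matrix_vector_mult_scaleR scaleR_add_right)
    have e1: "?D\<Phi> x \<eta>' + A *v ?De x \<eta>' = ?D\<Phi> x \<eta> + A *v ?De x \<eta> - (\<eta> $ i) *\<^sub>R (?D\<Phi> x w + A *v ?De x w)"
      by (simp add: \<eta>'_def linear_diff[OF lin\<Phi>] linear_diff[OF line] linear_cmul[OF lin\<Phi>] linear_cmul[OF line]
          matrix_vector_mult_scaleR matrix_vector_mult_diff_distrib algebra_simps)
    have "?D\<Phi>2 w x \<xi>' + ?D\<Phi> x \<eta>' + A *v (?De2 w x \<xi>' + ?De x \<eta>') = 0"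
    proof -
      have "?D\<Phi>2 w x \<xi>' + ?D\<Phi> x \<eta>' + A *v (?De2 w x \<xi>' + ?De x \<eta>') =
          ?D\<Phi>2 v x \<xi> + A *v ?De2 v x \<xi> + (?D\<Phi> x \<eta>' + A *v ?De x \<eta>')"
        by (simp add: sc[OF \<Phi>] sc[OF e] matrix_vector_right_distrib algebra_simps)
      then show ?thesis using z e1 w0 by simp
    qed
    moreover have "(\<xi>', \<eta>') \<noteq> 0"
    proof
      assume "(\<xi>', \<eta>') = 0"
      then have "\<xi> = 0" "\<eta> = (\<eta> $ i * r) *\<^sub>R v" using r by (auto simp: \<xi>'_def \<eta>'_def w_def zero_prod_def)
      then show False using ne span_base span_mul by (metis insertI1)
    qed
    moreover have "w $ i = 1" "\<eta>' $ i = 0" using r by (auto simp: w_def \<eta>'_def)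
    moreover have "?De x w $ j \<noteq> 0" using j r by (simp add: w_def linear_cmul[OF line])
    ultimately have "A \<in> Bad i j" unfolding Bad_def using x w0 by blast
    then show "A \<in> (\<Union>(i, j)\<in>UNIV. Bad i j)" by auto
  qed
  ultimately show ?thesis by (rule negligible_subset)
qed

section \<open>Germs of smooth maps\<close>

definition smooth_near :: "('a::euclidean_space \<Rightarrow> 'b::euclidean_space) \<Rightarrow> 'a \<Rightarrow> bool" where
  "smooth_near f x \<longleftrightarrow> (\<exists>S. open S \<and> x \<in> S \<and> smooth_on S f)"

lemma smooth_nearI: "open S \<Longrightarrow> x \<in> S \<Longrightarrow> smooth_on S f \<Longrightarrow> smooth_near f x"
  unfolding smooth_near_def by blast

lemma smooth_near_UNIV: "smooth_on UNIV f \<Longrightarrow> smooth_near f x"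
  by (rule smooth_nearI[of UNIV]) auto

lemma smooth_near_has_derivative: "smooth_near f x \<Longrightarrow> (f has_derivative fd f x) (at x)"
  unfolding smooth_near_def using smooth_on_has_derivative by blast

lemma smooth_near_linear_fd: "smooth_near f x \<Longrightarrow> linear (fd f x)"
  by (rule has_derivative_linear[OF smooth_near_has_derivative])

lemma smooth_near_fderiv: "smooth_near f x \<Longrightarrow> smooth_near (\<lambda>y. fd f y v) x"
  unfolding smooth_near_def using smooth_on_fderiv by blast

lemma eventually_smooth_near: "smooth_near f x \<Longrightarrow> \<forall>\<^sub>F y in nhds x. smooth_near f y"
  unfolding smooth_near_def eventually_nhds by blast

lemma fd_cong:
  assumes "\<forall>\<^sub>F y in nhds x. f y = g y" shows "fd f x = fd g x"
proof -
  have 1: "\<forall>\<^sub>F y in at x. f y = g y" and 2: "\<forall>\<^sub>F y in at x. g y = f y"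
    unfolding eventually_at_filter using assms by (auto elim: eventually_mono)
  have "(f has_derivative f') (at x) \<longleftrightarrow> (g has_derivative f') (at x)" for f'
    using has_derivative_transform_eventually[OF _ 1, of f'] has_derivative_transform_eventually[OF _ 2, of f']
      eventually_nhds_x_imp_x[OF assms] by auto
  then show ?thesis by (simp add: frechet_derivative_def)
qed

lemma eventually_fd_cong:
  "\<forall>\<^sub>F y in nhds x. f y = g y \<Longrightarrow> \<forall>\<^sub>F y in nhds x. fd f y = fd g y"
  by (subst (asm) eventually_eventually[symmetric]) (auto elim!: eventually_mono intro: fd_cong)

lemma eventually_smooth_near_compose:
  assumes "smooth_near f x" "\<forall>\<^sub>F z in nhds (f x). P z"
  shows "\<forall>\<^sub>F y in nhds x. P (f y)"
proof -
  have "isCont f x" using smooth_near_has_derivative[OF assms(1)] has_derivative_continuous by blast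
  then have "filterlim f (nhds (f x)) (nhds x)"
    by (simp add: isCont_def tendsto_nhds_iff)
  then show ?thesis using assms(2) by (rule eventually_compose_filterlim[rotated])
qed

lemma smooth_near_compose:
  assumes "smooth_near f x" "smooth_near g (f x)"
  shows "smooth_near (\<lambda>y. g (f y)) x"
proof -
  obtain S T where S: "open S" "x \<in> S" "smooth_on S f" and T: "open T" "f x \<in> T" "smooth_on T g"
    using assms unfolding smooth_near_def by blast
  have o: "open (S \<inter> f -` T)"
    using continuous_open_preimage[OF smooth_on_continuous_on[OF S(3)] S(1) T(1)] .
  have "smooth_on (S \<inter> f -` T) (\<lambda>y. g (f y))"
    by (rule smooth_on_compose[OF T(3) smooth_on_subset[OF S(3)] o T(1)]) auto
  then show ?thesis using o S T by (intro smooth_nearI[OF o]) auto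
qed

lemma smooth_near_Pair:
  assumes "smooth_near f x" "smooth_near g x"
  shows "smooth_near (\<lambda>y. (f y, g y)) x"
proof -
  obtain S T where S: "open S" "x \<in> S" "smooth_on S f" and T: "open T" "x \<in> T" "smooth_on T g"
    using assms unfolding smooth_near_def by blast
  then have "smooth_on (S \<inter> T) (\<lambda>y. (f y, g y))"
    by (intro smooth_on_Pair) (auto intro: smooth_on_subset)
  then show ?thesis using S T by (intro smooth_nearI[of "S \<inter> T"]) auto
qed

lemma smooth_near_linear:
  fixes L :: "'b::euclidean_space \<Rightarrow> 'c::euclidean_space"
  assumes "linear L" "smooth_near f x" shows "smooth_near (\<lambda>y. L (f y)) x"
  by (rule smooth_near_compose[OF assms(2) smooth_near_UNIV]) (simp add: smooth_on_linear assms(1))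

lemma smooth_near_ident: "smooth_near (\<lambda>x. x) x"
  by (intro smooth_near_UNIV smooth_intros) auto

lemma smooth_near_const: "smooth_near (\<lambda>x. c) x"
  by (intro smooth_near_UNIV smooth_intros) auto

lemma smooth_near_add:
  assumes "smooth_near f x" "smooth_near g x" shows "smooth_near (\<lambda>y. f y + g y) x"
  using smooth_near_linear[OF _ smooth_near_Pair[OF assms], of "\<lambda>p. fst p + snd p"]
  by (auto simp: linear_iff algebra_simps)

lemma smooth_near_scaleR:
  assumes "smooth_near f x" "smooth_near g x" shows "smooth_near (\<lambda>y. f y *\<^sub>R g y) x"
proof -
  have "smooth_on UNIV (\<lambda>p::real \<times> 'b. fst p *\<^sub>R snd p)" by (intro smooth_intros) auto
  from smooth_near_compose[OF smooth_near_Pair[OF assms] smooth_near_UNIV[OF this]] show ?thesis by simp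
qed

lemma smooth_near_diff:
  assumes "smooth_near f x" "smooth_near g x" shows "smooth_near (\<lambda>y. f y - g y) x"
  using smooth_near_linear[OF _ smooth_near_Pair[OF assms], of "\<lambda>p. fst p - snd p"]
  by (auto simp: linear_iff algebra_simps)

lemma smooth_near_vec_nth: "smooth_near f x \<Longrightarrow> smooth_near (\<lambda>y. f y $ i) x"
  for f :: "'a::euclidean_space \<Rightarrow> real^'n::finite"
  by (rule smooth_near_linear) (auto intro: linearI)

lemma smooth_near_vec_lambda:
  fixes f :: "'n::finite \<Rightarrow> 'a::euclidean_space \<Rightarrow> real"
  assumes "\<And>i. smooth_near (f i) x" shows "smooth_near (\<lambda>y. \<chi> i. f i y) x"
proof -
  have "\<forall>i. \<exists>S. open S \<and> x \<in> S \<and> smooth_on S (f i)" using assms unfolding smooth_near_def by blast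
  then obtain S where S: "\<And>i. open (S i)" "\<And>i. x \<in> S i" "\<And>i. smooth_on (S i) (f i)" by metis
  have o: "open (\<Inter>i. S i)" using S by (intro open_INT) auto
  then have "smooth_on (\<Inter>i. S i) (\<lambda>y. \<chi> i. f i y)"
    by (intro smooth_on_vec_lambda) (auto intro: smooth_on_subset[OF S(3)])
  then show ?thesis using S o by (intro smooth_nearI[OF o]) auto
qed

lemmas smooth_near_intros = smooth_near_ident smooth_near_const smooth_near_add smooth_near_diff
  smooth_near_scaleR smooth_near_vec_nth smooth_near_vec_lambda smooth_near_Pair

lemma fd_compose:
  assumes "smooth_near f x" "smooth_near g (f x)"
  shows "fd (\<lambda>y. g (f y)) x v = fd g (f x) (fd f x v)"
  using fderiv_eqI[OF has_derivative_compose[where f=f and g=g, OF smooth_near_has_derivative[OF assms(1)]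
      smooth_near_has_derivative[OF assms(2)]]] by simp

lemma fd_linear_compose:
  assumes "smooth_near f x" "linear L" shows "fd (\<lambda>y. L (f y)) x v = L (fd f x v)"
  using fderiv_eqI[OF bounded_linear.has_derivative[OF _ smooth_near_has_derivative[OF assms(1)], of L]]
    assms(2) by (simp add: linear_conv_bounded_linear)

lemma has_derivative_fd_pair:
  assumes "smooth_near f x"
  shows "((\<lambda>p. fd f (fst p) (snd p)) has_derivative
    (\<lambda>h. fd (\<lambda>y. fd f y v) x (fst h) + fd f x (snd h))) (at (x, v))"
  using assms has_derivative_fderiv_pair unfolding smooth_near_def by blast

text \<open>
  The last term drops out in the components of \<open>G\<close> that are critical at \<open>k x\<close>; in these components the
  second derivative is tensorial.
\<close>

lemma fd_fd_compose:
  assumes k: "smooth_near k x" and G: "smooth_near G (k x)"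
  shows "fd (\<lambda>y. fd (\<lambda>z. G (k z)) y w) x \<xi> =
    fd (\<lambda>y. fd G y (fd k x w)) (k x) (fd k x \<xi>) + fd G (k x) (fd (\<lambda>y. fd k y w) x \<xi>)"
proof -
  have "\<forall>\<^sub>F y in nhds x. fd G (k y) (fd k y w) = fd (\<lambda>z. G (k z)) y w"
    using eventually_smooth_near[OF k] eventually_smooth_near_compose[OF k eventually_smooth_near[OF G]]
    by eventually_elim (simp add: fd_compose)
  note eq = fd_cong[OF this]
  have d: "((\<lambda>y. (k y, fd k y w)) has_derivative (\<lambda>h. (fd k x h, fd (\<lambda>y. fd k y w) x h))) (at x)"
    by (intro has_derivative_Pair smooth_near_has_derivative k smooth_near_fderiv)
  have "((\<lambda>y. fd G (fst (k y, fd k y w)) (snd (k y, fd k y w))) has_derivative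
      (\<lambda>h. fd (\<lambda>y. fd G y (fd k x w)) (k x) (fst (fd k x h, fd (\<lambda>y. fd k y w) x h)) +
        fd G (k x) (snd (fd k x h, fd (\<lambda>y. fd k y w) x h)))) (at x)"
    by (rule has_derivative_compose[where g="\<lambda>p. fd G (fst p) (snd p)", OF d has_derivative_fd_pair[OF G]])
  from fderiv_eqI[OF this] show ?thesis unfolding eq[symmetric] by simp
qed

lemma fd_fd_scaleR:
  assumes "smooth_near G x"
  shows "fd (\<lambda>y. fd G y (r *\<^sub>R v)) x \<xi> = r *\<^sub>R fd (\<lambda>y. fd G y v) x \<xi>"
proof -
  have "\<forall>\<^sub>F y in nhds x. r *\<^sub>R fd G y v = fd G y (r *\<^sub>R v)"
    using eventually_smooth_near[OF assms]
    by eventually_elim (simp add: linear_cmul[OF smooth_near_linear_fd])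
  from fd_cong[OF this] have "fd (\<lambda>y. fd G y (r *\<^sub>R v)) x = fd (\<lambda>y. r *\<^sub>R fd G y v) x" by simp
  also have "\<dots> = (\<lambda>\<xi>. r *\<^sub>R fd (\<lambda>y. fd G y v) x \<xi>)"
    by (intro fderiv_eqI has_derivative_scaleR_right smooth_near_has_derivative smooth_near_fderiv assms)
  finally show ?thesis by simp
qed

text \<open>
  A local diffeomorphism at \<open>x\<close>, in the infinitesimal form that is easy to check for explicit coordinate
  changes; \<open>locdiff_diffeo_on\<close> supplies the neighbourhood.
\<close>

definition locdiff :: "(real^'k::finite \<Rightarrow> real^'k) \<Rightarrow> real^'k \<Rightarrow> bool" where
  "locdiff f x \<longleftrightarrow> smooth_near f x \<and> inj (fd f x)"

lemma locdiff_diffeo_on: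
  assumes "locdiff f x" "\<forall>\<^sub>F y in nhds x. P y"
  obtains U where "open U" "x \<in> U" "diffeo_on U f" "\<And>y. y \<in> U \<Longrightarrow> P y"
proof -
  obtain S T where S: "open S" "x \<in> S" "smooth_on S f" and T: "open T" "x \<in> T" "\<forall>y\<in>T. P y"
    using assms unfolding smooth_near_def eventually_nhds locdiff_def by blast
  have sm: "smooth_on (S \<inter> T) f" using S(3) by (rule smooth_on_subset) auto
  obtain U where "open U" "x \<in> U" "U \<subseteq> S \<inter> T" "diffeo_on U f"
    by (rule smooth_inverse_function[OF sm _ _ assms(1)[unfolded locdiff_def, THEN conjunct2]])
      (use S T in auto)
  then show thesis using that T by blast
qed

lemma locdiff_inverse:
  assumes f: "locdiff f x"
  obtains g where "locdiff g (f x)" "g (f x) = x" "\<forall>\<^sub>F y in nhds (f x). f (g y) = y"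
    "\<And>h. fd f x (fd g (f x) h) = h"
proof -
  obtain U where U: "open U" "x \<in> U" "diffeo_on U f"
    using locdiff_diffeo_on[OF f, of "\<lambda>_. True"] by auto
  define g where "g = inv_into U f"
  have fU: "open (f ` U)" "inj_on f U" "smooth_on (f ` U) g" "smooth_on U f"
    using U(3) by (auto simp: diffeo_on_def g_def)
  have sf: "smooth_near f x" using f by (simp add: locdiff_def)
  have sg: "smooth_near g (f x)" using fU U by (intro smooth_nearI[of "f ` U"]) auto
  have gf: "g (f y) = y" if "y \<in> U" for y using that fU by (simp add: g_def)
  have evfg: "\<forall>\<^sub>F y in nhds (f x). f (g y) = y"
    using U fU gf unfolding eventually_nhds by (intro exI[of _ "f ` U"]) auto
  have gx: "g (f x) = x" using gf U by blast
  have 2: "fd f x (fd g (f x) h) = h" for h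
    using fd_compose[OF sg, of f h] sf fd_cong[OF evfg] gx by simp
  have "locdiff g (f x)" unfolding locdiff_def using sg 2 by (metis injI)
  then show thesis using that gx evfg 2 by blast
qed

lemma locdiff_compose:
  assumes "locdiff f x" "locdiff g (f x)" shows "locdiff (\<lambda>y. g (f y)) x"
  using assms smooth_near_compose fd_compose unfolding locdiff_def inj_def by metis

lemma smooth_near_box:
  fixes F :: "real \<times> 'a::euclidean_space \<Rightarrow> 'b::euclidean_space"
  assumes "smooth_near F 0"
  obtains \<epsilon> where "\<epsilon> > 0" "smooth_on ({-\<epsilon><..<\<epsilon>} \<times> ball 0 \<epsilon>) F"
proof -
  obtain S where S: "open S" "0 \<in> S" "smooth_on S F" using assms unfolding smooth_near_def by blast
  obtain e where e: "e > 0" "ball 0 e \<subseteq> S" by (rule openE[OF S(1,2)])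
  have "{-(e/2)<..<e/2} \<times> ball 0 (e/2) \<subseteq> ball (0::real \<times> 'a) e"
  proof clarify
    fix t :: real and z :: 'a assume *: "t \<in> {-(e/2)<..<e/2}" "z \<in> ball 0 (e/2)"
    have "norm (t, z) \<le> norm t + norm z" by (rule norm_Pair_le)
    also have "\<dots> < e" using * by (auto simp: abs_less_iff)
    finally show "(t, z) \<in> ball 0 e" by (simp only: mem_ball_0)
  qed
  then show thesis using that[of "e/2"] e smooth_on_subset[OF S(3)] by (meson half_gt_zero order_trans)
qed

lemma eventually_box:
  assumes "\<epsilon> > 0" "\<And>t z. \<bar>t\<bar> < \<epsilon> \<Longrightarrow> z \<in> ball 0 \<epsilon> \<Longrightarrow> P (t, z)"
  shows "\<forall>\<^sub>F p in nhds (0 :: real \<times> 'a::euclidean_space). P p"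
  unfolding eventually_nhds
  by (rule exI[of _ "{-\<epsilon><..<\<epsilon>} \<times> ball 0 \<epsilon>"])
    (use assms in \<open>auto simp: abs_less_iff zero_prod_def intro!: open_Times\<close>)

text \<open>
  The odd part of \<open>F\<close> is \<open>t\<close> times an even function, its Hadamard quotient, so Whitney's theorem on even
  functions applies to both parts.
\<close>

lemma even_odd_decomposition:
  fixes F :: "real \<times> 'a::euclidean_space \<Rightarrow> 'b::euclidean_space"
  assumes "smooth_near F 0"
  obtains a b where "smooth_near a 0" "smooth_near b 0"
    "\<forall>\<^sub>F p in nhds 0. F p = a ((fst p)\<^sup>2, snd p) + fst p *\<^sub>R b ((fst p)\<^sup>2, snd p)"
proof -
  obtain \<epsilon> where \<epsilon>: "\<epsilon> > 0" and F: "smooth_on ({-\<epsilon><..<\<epsilon>} \<times> ball 0 \<epsilon>) F"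
    by (rule smooth_near_box[OF assms])
  let ?B = "ball (0::'a) \<epsilon>" and ?T = "{-\<epsilon><..<\<epsilon>} \<times> ball (0::'a) \<epsilon>"
  have T: "open ?T" by (intro open_Times) auto
  have F': "smooth_on ?T (\<lambda>p. F (- fst p, snd p))"
    by (rule smooth_on_compose[OF F _ T T]) (auto intro!: smooth_intros T)
  define E where "E p = (1/2) *\<^sub>R (F p + F (- fst p, snd p))" for p
  define O' where "O' p = (1/2) *\<^sub>R (F p - F (- fst p, snd p))" for p
  have E: "smooth_on ?T E" and O: "smooth_on ?T O'"
    unfolding E_def O'_def by (intro smooth_intros T F F')+
  obtain q where q: "smooth_on ?T q" "\<And>t z. \<bar>t\<bar> < \<epsilon> \<Longrightarrow> z \<in> ?B \<Longrightarrow> O' (t, z) = t *\<^sub>R q (t, z)"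
    by (rule smooth_Hadamard_quotient[OF O]) (auto simp: O'_def)
  have qe: "q (-t, z) = q (t, z)" if "\<bar>t\<bar> < \<epsilon>" "z \<in> ?B" for t z
  proof (cases "t = 0")
    case False
    have "O' (-t, z) = - O' (t, z)" by (simp add: O'_def algebra_simps)
    then have "(-t) *\<^sub>R q (-t, z) = - (t *\<^sub>R q (t, z))" using q(2)[of t z] q(2)[of "-t" z] that by auto
    then show ?thesis using False by (rule scaleR_uminus_cancel)
  qed simp
  have Ee: "E (-t, z) = E (t, z)" for t z by (simp add: E_def add.commute)
  have 0: "0 \<in> ?B" using \<epsilon> by simp
  obtain \<delta>1 r1 a where a: "0 < \<delta>1" "0 < r1" "smooth_on ({..<\<delta>1\<^sup>2} \<times> ball 0 r1) a"
    "\<And>t z. \<bar>t\<bar> < \<delta>1 \<Longrightarrow> z \<in> ball 0 r1 \<Longrightarrow> E (t, z) = a (t\<^sup>2, z)"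
    by (rule even_function_smooth_in_square[OF \<epsilon> E open_ball 0 Ee]) (rule that)
  obtain \<delta>2 r2 b where b: "0 < \<delta>2" "\<delta>2 < \<epsilon>" "0 < r2" "ball 0 r2 \<subseteq> ?B" "smooth_on ({..<\<delta>2\<^sup>2} \<times> ball 0 r2) b"
    "\<And>t z. \<bar>t\<bar> < \<delta>2 \<Longrightarrow> z \<in> ball 0 r2 \<Longrightarrow> q (t, z) = b (t\<^sup>2, z)"
    by (rule even_function_smooth_in_square[OF \<epsilon> q(1) open_ball 0]) (erule (1) qe, rule that)
  show thesis
  proof
    show "smooth_near a 0"
      by (rule smooth_nearI[OF _ _ a(3)]) (use a in \<open>auto intro!: open_Times simp: zero_prod_def\<close>)
    show "smooth_near b 0"
      by (rule smooth_nearI[OF _ _ b(5)]) (use b in \<open>auto intro!: open_Times simp: zero_prod_def\<close>)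
    define \<mu> where "\<mu> = min (min \<delta>1 r1) (min \<delta>2 r2)"
    show "\<forall>\<^sub>F p in nhds 0. F p = a ((fst p)\<^sup>2, snd p) + fst p *\<^sub>R b ((fst p)\<^sup>2, snd p)"
    proof (rule eventually_box[of \<mu>])
      fix t :: real and z :: 'a assume *: "\<bar>t\<bar> < \<mu>" "z \<in> ball 0 \<mu>"
      have "F (t, z) = E (t, z) + O' (t, z)"
        by (simp add: E_def O'_def flip: scaleR_add_right)
      also have "E (t, z) = a (t\<^sup>2, z)" using * by (intro a) (auto simp: \<mu>_def)
      also have "O' (t, z) = t *\<^sub>R q (t, z)" using * b by (intro q) (auto simp: \<mu>_def)
      also have "q (t, z) = b (t\<^sup>2, z)" using * by (intro b) (auto simp: \<mu>_def)
      finally show "F (t, z) = a ((fst (t, z))\<^sup>2, snd (t, z)) + fst (t, z) *\<^sub>R b ((fst (t, z))\<^sup>2, snd (t, z))"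
        by simp
    qed (use a b in \<open>auto simp: \<mu>_def\<close>)
  qed
qed

section \<open>Normal form of a nondegenerate singular point\<close>

text \<open>
  Names for the coordinates of the normal form \<open>(x\<^sub>1\<^sup>2, x\<^sub>1 x\<^sub>2, \<dots>, x\<^sub>1 x\<^sub>n, x\<^sub>2, \<dots>, x\<^sub>n)\<close>: \<open>i0\<close> is the
  index of \<open>x\<^sub>1\<close> in the source, \<open>yi k\<close> is the index of the component \<open>x\<^sub>1 x\<^sub>k\<close> in the target, and, for
  \<open>k \<noteq> i0\<close>, \<open>zi k\<close> is the index of the component \<open>x\<^sub>k\<close>.
\<close>

locale whitney_indices =
  fixes i0 :: "'n::finite" and yi zi :: "'n \<Rightarrow> 'p::finite"
  assumes inj_yi: "inj yi" and inj_zi: "inj_on zi (-{i0})"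
    and yi_neq_zi: "\<And>k l. l \<noteq> i0 \<Longrightarrow> yi k \<noteq> zi l"
    and index_cases: "\<And>j. (\<exists>k. j = yi k) \<or> (\<exists>k. k \<noteq> i0 \<and> j = zi k)"
begin

definition e0 :: "real^'n" where "e0 = axis i0 1"

definition proj :: "real^'n \<Rightarrow> real^'n" where
  "proj x = (\<chi> k. if k = i0 then 0 else x $ k)"

text \<open>
  The vector with y-part \<open>Y\<close> and z-part \<open>Z\<close>. Both parts are stored in \<open>real^'n\<close>, the z-part without its
  coordinate \<open>i0\<close>; \<open>pz\<close> reads it back with \<open>0\<close> in that place.
\<close>

definition mk :: "real^'n \<Rightarrow> real^'n \<Rightarrow> real^'p" where
  "mk Y Z = (\<chi> j. if j \<in> range yi then Y $ inv yi j else Z $ inv_into (-{i0}) zi j)"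

definition py :: "real^'p \<Rightarrow> real^'n" where "py w = (\<chi> k. w $ yi k)"

definition pz :: "real^'p \<Rightarrow> real^'n" where "pz w = (\<chi> k. if k = i0 then 0 else w $ zi k)"

definition umbrella :: "real^'n \<Rightarrow> real^'p" where "umbrella x = mk (x $ i0 *\<^sub>R x) x"

lemma e0_nth [simp]: "e0 $ k = (if k = i0 then 1 else 0)"
  by (simp add: e0_def axis_def)

lemma proj_nth [simp]: "proj x $ k = (if k = i0 then 0 else x $ k)"
  by (simp add: proj_def)

lemma mk_yi [simp]: "mk Y Z $ yi k = Y $ k"
  by (simp add: mk_def inv_f_f[OF inj_yi])

lemma mk_zi [simp]:
  assumes "k \<noteq> i0" shows "mk Y Z $ zi k = Z $ k"
proof -
  have "zi k \<notin> range yi" using yi_neq_zi[OF assms] by (metis rangeE)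
  then show ?thesis using assms by (simp add: mk_def inv_into_f_f[OF inj_zi])
qed

lemma py_nth [simp]: "py w $ k = w $ yi k"
  by (simp add: py_def)

lemma pz_nth [simp]: "pz w $ k = (if k = i0 then 0 else w $ zi k)"
  by (simp add: pz_def)

lemma yz_eqI:
  "(\<And>k. w1 $ yi k = w2 $ yi k) \<Longrightarrow> (\<And>k. k \<noteq> i0 \<Longrightarrow> w1 $ zi k = w2 $ zi k) \<Longrightarrow> w1 = w2"
  for w1 w2 :: "real^'p"
  by (metis index_cases vec_eq_iff)

lemma linear_proj: "linear proj" by (auto intro!: linearI simp: vec_eq_iff)

lemma linear_py: "linear py" by (auto intro!: linearI simp: vec_eq_iff)

lemma linear_pz: "linear pz" by (auto intro!: linearI simp: vec_eq_iff)

lemma linear_mk: "linear (\<lambda>p. mk (fst p) (snd p))" by (auto intro!: linearI yz_eqI)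

lemma split_e0: "x = proj x + (x $ i0) *\<^sub>R e0" by (simp add: vec_eq_iff)

lemma smooth_near_proj: "smooth_near f x \<Longrightarrow> smooth_near (\<lambda>y. proj (f y)) x"
  by (rule smooth_near_linear[OF linear_proj])

lemma has_derivative_mk:
  assumes "(f has_derivative f') (at x)" "(g has_derivative g') (at x)"
  shows "((\<lambda>y. mk (f y) (g y)) has_derivative (\<lambda>h. mk (f' h) (g' h))) (at x)"
  using bounded_linear.has_derivative[OF _ has_derivative_Pair[OF assms], of "\<lambda>p. mk (fst p) (snd p)"]
    linear_mk by (simp add: linear_conv_bounded_linear)

text \<open>
  Whitney umbrellas at the level of germs. As \<open>locdiff\<close> is an infinitesimal condition, successive changes of
  coordinates are composed by the chain rule, with no neighbourhoods to be matched.
\<close>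

definition umbrella_germ :: "(real^'n \<Rightarrow> real^'p) \<Rightarrow> real^'n \<Rightarrow> bool" where
  "umbrella_germ G x \<longleftrightarrow> (\<exists>\<kappa> H. locdiff \<kappa> x \<and> \<kappa> x = 0 \<and> locdiff H (G x) \<and> H (G x) = 0 \<and>
     (\<forall>\<^sub>F y in nhds x. H (G y) = umbrella (\<kappa> y)))"

lemma umbrella_germ_source:
  assumes k: "locdiff k y" and umb: "umbrella_germ (\<lambda>x. G (k x)) y"
  shows "umbrella_germ G (k y)"
proof -
  obtain \<kappa> H where \<kappa>: "locdiff \<kappa> y" "\<kappa> y = 0" and H: "locdiff H (G (k y))" "H (G (k y)) = 0"
    and ev: "\<forall>\<^sub>F x in nhds y. H (G (k x)) = umbrella (\<kappa> x)"
    using umb unfolding umbrella_germ_def by blast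
  obtain l where l: "locdiff l (k y)" "l (k y) = y" "\<forall>\<^sub>F x in nhds (k y). k (l x) = x"
    using locdiff_inverse[OF k] by metis
  have "\<forall>\<^sub>F x in nhds (k y). H (G (k (l x))) = umbrella (\<kappa> (l x))"
    by (rule eventually_smooth_near_compose[where f=l]) (use l ev in \<open>auto simp: locdiff_def\<close>)
  then have "\<forall>\<^sub>F x in nhds (k y). H (G x) = umbrella (\<kappa> (l x))"
    using l(3) by eventually_elim simp
  moreover have "locdiff (\<lambda>x. \<kappa> (l x)) (k y)" by (rule locdiff_compose) (use l \<kappa> in auto)
  ultimately show ?thesis unfolding umbrella_germ_def using H l \<kappa>
    by (intro exI[of _ "\<lambda>x. \<kappa> (l x)"] exI[of _ H]) auto
qed

lemma umbrella_germ_target: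
  assumes L: "locdiff L (G x)" and umb: "umbrella_germ (\<lambda>x. L (G x)) x"
  shows "umbrella_germ G x"
proof -
  obtain \<kappa> H where \<kappa>: "locdiff \<kappa> x" "\<kappa> x = 0" and H: "locdiff H (L (G x))" "H (L (G x)) = 0"
    and ev: "\<forall>\<^sub>F x in nhds x. H (L (G x)) = umbrella (\<kappa> x)"
    using umb unfolding umbrella_germ_def by blast
  show ?thesis unfolding umbrella_germ_def
    by (intro exI[of _ \<kappa>] exI[of _ "\<lambda>w. H (L w)"]) (use \<kappa> H ev locdiff_compose[OF L H(1)] in auto)
qed

definition zcoords :: "(real^'n \<Rightarrow> real^'p) \<Rightarrow> bool" where
  "zcoords G \<longleftrightarrow> (\<forall>\<^sub>F x in nhds 0. pz (G x) = proj x)"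

definition ycritical :: "(real^'n \<Rightarrow> real^'p) \<Rightarrow> bool" where
  "ycritical G \<longleftrightarrow> (\<forall>w. py (fd G 0 w) = 0)"

text \<open>
  The y-part of \<open>DG(0)\<close> vanishes, so second derivatives of the y-part in the kernel direction transform
  like a bilinear form. Every step of the reduction to normal form keeps track of them by this rule.
\<close>

lemma source_change:
  assumes k: "smooth_near k 0" "k 0 = 0" and G: "smooth_near G 0" "ycritical G"
    and k0: "fd k 0 e0 = \<mu> *\<^sub>R e0"
  shows "smooth_near (\<lambda>x. G (k x)) 0" "ycritical (\<lambda>x. G (k x))"
    "py (fd (\<lambda>x. fd (\<lambda>x. G (k x)) x e0) 0 \<xi>) = \<mu> *\<^sub>R py (fd (\<lambda>x. fd G x e0) 0 (fd k 0 \<xi>))"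
proof -
  have G': "smooth_near G (k 0)" using G k by simp
  show "smooth_near (\<lambda>x. G (k x)) 0" by (rule smooth_near_compose[OF k(1) G'])
  show "ycritical (\<lambda>x. G (k x))"
    unfolding ycritical_def using fd_compose[OF k(1) G'] G(2) k(2) by (simp add: ycritical_def)
  show "py (fd (\<lambda>x. fd (\<lambda>x. G (k x)) x e0) 0 \<xi>) = \<mu> *\<^sub>R py (fd (\<lambda>x. fd G x e0) 0 (fd k 0 \<xi>))"
    unfolding fd_fd_compose[OF k(1) G'] k0 k(2) fd_fd_scaleR[OF G(1)]
    using G(2) by (simp add: ycritical_def linear_add[OF linear_py] linear_cmul[OF linear_py])
qed

lemma linear_setc: "linear (\<lambda>p. proj (snd p) + fst p *\<^sub>R e0)"
  by (auto intro!: linearI simp: vec_eq_iff algebra_simps)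

lemma smooth_near_setc:
  fixes f :: "real^'n \<Rightarrow> 'b::euclidean_space"
  assumes "smooth_near f 0"
  shows "smooth_near (\<lambda>p. f (proj (snd p) + fst p *\<^sub>R e0)) 0"
proof (rule smooth_near_compose[where g=f])
  show "smooth_near (\<lambda>p. proj (snd p) + fst p *\<^sub>R e0) 0"
    by (rule smooth_near_linear[OF linear_setc smooth_near_ident])
  show "smooth_near f (proj (snd (0 :: real \<times> (real^'n))) + fst (0 :: real \<times> (real^'n)) *\<^sub>R e0)"
    using assms linear_0[OF linear_setc] by simp
qed

text \<open>
  Let \<open>F (t, z)\<close> be the y-part of \<open>G\<close>, written as \<open>a (t\<^sup>2, z) + t b (t\<^sup>2, z)\<close>, and let \<open>s = t\<^sup>2\<close> on the image
  of \<open>G\<close>, which is the first y-component minus \<open>c\<close>. The target map \<open>H\<close> replaces the first y-component by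
  \<open>s\<close>, subtracts \<open>a (s, z)\<close> from the others and replaces \<open>z\<close> by \<open>b (s, z)\<close>; the source map \<open>\<kappa>\<close> is
  \<open>(t, z) \<mapsto> (t, b (t\<^sup>2, z))\<close>. Then \<open>H \<circ> G = umbrella \<circ> \<kappa>\<close> by construction. Both maps are invertible because
  \<open>b (0, z) = \<partial>F/\<partial>t (0, z)\<close>, whose derivative in \<open>z\<close> is part of the Hessian of \<open>G\<close>.
\<close>

lemma umbrella_germ_of_square:
  assumes G: "smooth_near G 0" "G 0 = 0" "zcoords G" "ycritical G"
    and \<gamma>: "\<gamma> \<noteq> 0" and hess: "\<And>\<xi> l. l \<noteq> i0 \<Longrightarrow> py (fd (\<lambda>x. fd G x e0) 0 \<xi>) $ l = \<gamma> * \<xi> $ l"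
    and c: "smooth_near c 0" and sq: "\<forall>\<^sub>F x in nhds 0. G x $ yi i0 = c (proj x) + (x $ i0)\<^sup>2"
  shows "umbrella_germ G 0"
proof -
  define F where "F p = py (G (proj (snd p) + fst p *\<^sub>R e0))" for p
  have F: "smooth_near F 0"
    unfolding F_def by (rule smooth_near_linear[OF linear_py smooth_near_setc[OF G(1)]])
  obtain a b where a: "smooth_near a 0" and b: "smooth_near b 0"
    and ab: "\<forall>\<^sub>F p in nhds 0. F p = a ((fst p)\<^sup>2, snd p) + fst p *\<^sub>R b ((fst p)\<^sup>2, snd p)"
    by (rule even_odd_decomposition[OF F])
  have proj0: "proj 0 = 0" and pz0: "pz 0 = 0" by (simp_all add: vec_eq_iff)
  have pp: "proj (proj x) = proj x" for x by (simp add: vec_eq_iff)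
  have ppe: "proj (proj x + t *\<^sub>R e0) = proj x" for x t by (simp add: vec_eq_iff)
  have e0j: "(proj x + t *\<^sub>R e0) $ i0 = t" for x t by simp
  note Gd = smooth_near_has_derivative[OF G(1)]
  have c0: "c 0 = 0" using eventually_nhds_x_imp_x[OF sq] G(2) proj0 by simp
  \<comment> \<open>at \<open>t = 0\<close> the quotient \<open>b\<close> of the odd part is the derivative in the kernel direction\<close>
  have bz: "\<forall>\<^sub>F z in nhds 0. b (0, z) = py (fd G (proj z) e0)"
  proof -
    have "smooth_near (\<lambda>z::real^'n. (0::real, z)) 0" by (intro smooth_near_intros)
    from eventually_smooth_near_compose[OF this, of "\<lambda>p. \<forall>\<^sub>F q in nhds p. F q = a ((fst q)\<^sup>2, snd q) + fst q *\<^sub>R b ((fst q)\<^sup>2, snd q)"]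
    have 1: "\<forall>\<^sub>F z in nhds 0. \<forall>\<^sub>F q in nhds (0, z). F q = a ((fst q)\<^sup>2, snd q) + fst q *\<^sub>R b ((fst q)\<^sup>2, snd q)"
      using ab by (simp add: eventually_eventually zero_prod_def)
    have 2: "\<forall>\<^sub>F z in nhds 0. smooth_near a (0, z) \<and> smooth_near b (0, z)"
      by (rule eventually_smooth_near_compose[OF \<open>smooth_near (\<lambda>z. (0, z)) 0\<close>])
        (use eventually_conj[OF eventually_smooth_near[OF a] eventually_smooth_near[OF b]] in \<open>simp add: zero_prod_def\<close>)
    have 3: "\<forall>\<^sub>F z in nhds 0. smooth_near G (proj z)"
      by (rule eventually_smooth_near_compose[where f=proj])
        (use smooth_near_linear[OF linear_proj smooth_near_ident] eventually_smooth_near[OF G(1)] proj0 in auto)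
    show ?thesis using 1 2 3
    proof eventually_elim
      case (elim z)
      have l: "smooth_near (\<lambda>t::real. (t, z)) 0" by (intro smooth_near_intros)
      have "\<forall>\<^sub>F t in nhds 0. F (t, z) = a (t\<^sup>2, z) + t *\<^sub>R b (t\<^sup>2, z)"
        using eventually_smooth_near_compose[OF l] elim(1) by fastforce
      from fd_cong[OF this] have eq: "fd (\<lambda>t. F (t, z)) 0 1 = fd (\<lambda>t. a (t\<^sup>2, z) + t *\<^sub>R b (t\<^sup>2, z)) 0 1"
        by simp
      have sqd: "((\<lambda>t::real. (t\<^sup>2, z)) has_derivative (\<lambda>h. 0)) (at 0)"
        by (auto intro!: derivative_eq_intros simp: zero_prod_def)
      have ad: "((\<lambda>t. a (t\<^sup>2, z)) has_derivative (\<lambda>h. fd a (0, z) 0)) (at 0)"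
        by (rule has_derivative_compose[where g=a, OF sqd]) (use smooth_near_has_derivative elim(2) in auto)
      have bd: "((\<lambda>t. b (t\<^sup>2, z)) has_derivative (\<lambda>h. fd b (0, z) 0)) (at 0)"
        by (rule has_derivative_compose[where g=b, OF sqd]) (use smooth_near_has_derivative elim(2) in auto)
      have "fd a (0, z) 0 = 0" "fd b (0, z) 0 = 0" using linear_0 smooth_near_linear_fd elim(2) by auto
      then have "((\<lambda>t. a (t\<^sup>2, z) + t *\<^sub>R b (t\<^sup>2, z)) has_derivative (\<lambda>h. 0 + (0 *\<^sub>R 0 + h *\<^sub>R b (0\<^sup>2, z)))) (at 0)"
        using ad bd by (intro has_derivative_add has_derivative_scaleR has_derivative_ident) auto
      from fderiv_eqI[OF this] eq have "fd (\<lambda>t. F (t, z)) 0 1 = b (0, z)" by simp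
      moreover have "((\<lambda>t. F (t, z)) has_derivative (\<lambda>h. py (fd G (proj z) (h *\<^sub>R e0)))) (at 0)"
      proof -
        have "((\<lambda>t. proj z + t *\<^sub>R e0) has_derivative (\<lambda>h. h *\<^sub>R e0)) (at 0)"
          by (auto intro!: derivative_eq_intros)
        from has_derivative_compose[where g=G, OF this, of "fd G (proj z)"] smooth_near_has_derivative[OF elim(3)]
        have "((\<lambda>t. G (proj z + t *\<^sub>R e0)) has_derivative (\<lambda>h. fd G (proj z) (h *\<^sub>R e0))) (at 0)" by simp
        then show ?thesis unfolding F_def
          using bounded_linear.has_derivative[of py] linear_py linear_conv_bounded_linear by fastforce
      qed
      ultimately show ?case using fderiv_eqI by fastforce
    qed
  qed
  have b0: "b 0 = 0" using eventually_nhds_x_imp_x[OF bz] G(4) by (simp add: zero_prod_def proj0 ycritical_def)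
  have bd: "(b has_derivative fd b 0) (at 0)" by (rule smooth_near_has_derivative[OF b])
  have ad: "(a has_derivative fd a 0) (at 0)" by (rule smooth_near_has_derivative[OF a])
  have Db: "fd b 0 (0, \<zeta>) $ l = \<gamma> * \<zeta> $ l" if l: "l \<noteq> i0" for \<zeta> l
  proof -
    have "((\<lambda>z::real^'n. (0::real, z)) has_derivative (\<lambda>h. (0, h))) (at 0)" by (auto intro!: derivative_eq_intros)
    from has_derivative_compose[where g=b, OF this, of "fd b 0"] bd
    have 1: "((\<lambda>z. b (0, z)) has_derivative (\<lambda>h. fd b 0 (0, h))) (at 0)" by (simp add: zero_prod_def)
    have "((\<lambda>z. fd G (proj z) e0) has_derivative (\<lambda>h. fd (\<lambda>x. fd G x e0) 0 (proj h))) (at 0)"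
      by (rule has_derivative_compose[where f=proj, OF linear_imp_has_derivative[OF linear_proj]])
        (use smooth_near_has_derivative[OF smooth_near_fderiv[OF G(1)]] proj0 in auto)
    then have "((\<lambda>z. py (fd G (proj z) e0)) has_derivative (\<lambda>h. py (fd (\<lambda>x. fd G x e0) 0 (proj h)))) (at 0)"
      using bounded_linear.has_derivative[of py] linear_py linear_conv_bounded_linear by blast
    from fderiv_eqI[OF this] fderiv_eqI[OF 1] fd_cong[OF bz]
    have "fd b 0 (0, \<zeta>) = py (fd (\<lambda>x. fd G x e0) 0 (proj \<zeta>))" by metis
    then show ?thesis using hess[OF l, of "proj \<zeta>"] l by simp
  qed
  define s where "s w = w $ yi i0 - c (pz w)" for w :: "real^'p"
  define Y where "Y w = (\<chi> k. if k = i0 then s w else w $ yi k - a (s w, pz w) $ k)" for w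
  define H where "H w = mk (Y w) (b (s w, pz w))" for w
  define \<kappa> where "\<kappa> x = (\<chi> k. if k = i0 then x $ i0 else b ((x $ i0)\<^sup>2, proj x) $ k)" for x
  have s0: "s 0 = 0" by (simp add: s_def pz0 c0)
  have pzs: "smooth_near pz 0" by (rule smooth_near_linear[OF linear_pz smooth_near_ident])
  have cpz: "smooth_near (\<lambda>w. c (pz w)) 0" by (rule smooth_near_compose[OF pzs]) (simp add: pz0 c)
  have ssm: "smooth_near s 0" unfolding s_def by (intro smooth_near_diff cpz smooth_near_vec_nth smooth_near_ident)
  have spz: "smooth_near (\<lambda>w. (s w, pz w)) 0" by (intro smooth_near_Pair ssm pzs)
  have bs: "smooth_near (\<lambda>w. b (s w, pz w)) 0" and as: "smooth_near (\<lambda>w. a (s w, pz w)) 0"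
    using smooth_near_compose[OF spz, of b] smooth_near_compose[OF spz, of a] a b by (auto simp: s0 pz0 zero_prod_def)
  have Ysm: "smooth_near Y 0" unfolding Y_def
  proof (rule smooth_near_vec_lambda)
    show "smooth_near (\<lambda>w. if k = i0 then s w else w $ yi k - a (s w, pz w) $ k) 0" for k
      by (cases "k = i0") (auto intro!: ssm smooth_near_diff smooth_near_vec_nth as smooth_near_ident)
  qed
  have Hsm: "smooth_near H 0" unfolding H_def
    using smooth_near_linear[OF linear_mk smooth_near_Pair[OF Ysm bs]] by simp
  have sqsm: "smooth_near (\<lambda>x::real^'n. (x $ i0)\<^sup>2) 0"
    unfolding power2_eq_square using smooth_near_scaleR[OF smooth_near_vec_nth[OF smooth_near_ident] smooth_near_vec_nth[OF smooth_near_ident]] by simp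
  have sqp: "smooth_near (\<lambda>x. ((x $ i0)\<^sup>2, proj x)) 0"
    by (intro smooth_near_Pair sqsm smooth_near_proj smooth_near_ident)
  have bsq: "smooth_near (\<lambda>x. b ((x $ i0)\<^sup>2, proj x)) 0"
    using smooth_near_compose[OF sqp, of b] b by (simp add: proj0 zero_prod_def)
  have \<kappa>sm: "smooth_near \<kappa> 0" unfolding \<kappa>_def
  proof (rule smooth_near_vec_lambda)
    show "smooth_near (\<lambda>x. if k = i0 then x $ i0 else b ((x $ i0)\<^sup>2, proj x) $ k) 0" for k
      by (cases "k = i0") (auto intro!: smooth_near_vec_nth bsq smooth_near_ident)
  qed
  have H0: "H 0 = 0"
  proof -
    have "F 0 = a 0" using eventually_nhds_x_imp_x[OF ab] by (simp add: zero_prod_def)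
    then have "a 0 = 0" using G(2) proj0 linear_0[OF linear_py] by (simp add: F_def)
    then show ?thesis using b0 by (auto intro!: yz_eqI simp: H_def Y_def s0 pz0 simp flip: zero_prod_def)
  qed
  have \<kappa>0: "\<kappa> 0 = 0" using b0 by (simp add: \<kappa>_def proj0 vec_eq_iff flip: zero_prod_def)
  have "inj (fd \<kappa> 0)"
  proof -
    note \<kappa>d = smooth_near_has_derivative[OF \<kappa>sm]
    have 1: "fd \<kappa> 0 \<xi> $ i0 = \<xi> $ i0" for \<xi>
    proof -
      have "((\<lambda>x. \<kappa> x $ i0) has_derivative (\<lambda>\<xi>. fd \<kappa> 0 \<xi> $ i0)) (at 0)"
        by (rule bounded_linear.has_derivative[OF bounded_linear_vec_nth \<kappa>d])
      moreover have "((\<lambda>x. \<kappa> x $ i0) has_derivative (\<lambda>\<xi>. \<xi> $ i0)) (at 0)"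
        unfolding \<kappa>_def by (simp add: bounded_linear_imp_has_derivative bounded_linear_vec_nth)
      ultimately show ?thesis using has_derivative_unique by metis
    qed
    have 2: "fd \<kappa> 0 \<xi> $ l = \<gamma> * \<xi> $ l" if "l \<noteq> i0" for \<xi> l
    proof -
      have "((\<lambda>x. \<kappa> x $ l) has_derivative (\<lambda>\<xi>. fd \<kappa> 0 \<xi> $ l)) (at 0)"
        by (rule bounded_linear.has_derivative[OF bounded_linear_vec_nth \<kappa>d])
      moreover have "((\<lambda>x. \<kappa> x $ l) has_derivative (\<lambda>\<xi>. fd b 0 (0, proj \<xi>) $ l)) (at 0)"
      proof -
        have "((\<lambda>x::real^'n. x $ i0) has_derivative (\<lambda>h. h $ i0)) (at 0)"
          by (simp add: bounded_linear_imp_has_derivative bounded_linear_vec_nth)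
        from has_derivative_mult[OF this this] have "((\<lambda>x::real^'n. (x $ i0)\<^sup>2) has_derivative (\<lambda>h. 0)) (at 0)"
          by (simp add: power2_eq_square)
        then have "((\<lambda>x. ((x $ i0)\<^sup>2, proj x)) has_derivative (\<lambda>h. (0, proj h))) (at 0)"
          by (intro has_derivative_Pair linear_imp_has_derivative[OF linear_proj])
        from has_derivative_compose[where g=b, OF this, of "fd b 0"] bd
        have "((\<lambda>x. b ((x $ i0)\<^sup>2, proj x)) has_derivative (\<lambda>h. fd b 0 (0, proj h))) (at 0)"
          by (simp add: proj0 zero_prod_def)
        from bounded_linear.has_derivative[OF bounded_linear_vec_nth this]
        show ?thesis using that by (simp add: \<kappa>_def)
      qed
      ultimately have "fd \<kappa> 0 \<xi> $ l = fd b 0 (0, proj \<xi>) $ l" using has_derivative_unique by metis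
      then show ?thesis using Db[OF that] that by simp
    qed
    have "\<xi> = 0" if "fd \<kappa> 0 \<xi> = 0" for \<xi>
      unfolding vec_eq_iff using 1[of \<xi>] 2[of _ \<xi>] \<gamma> that by (metis mult_eq_0_iff zero_index)
    then show ?thesis using linear_injective_0[OF smooth_near_linear_fd[OF \<kappa>sm]] by blast
  qed
  then have \<kappa>: "locdiff \<kappa> 0" using \<kappa>sm by (simp add: locdiff_def)
  have "inj (fd H 0)"
  proof -
    define s' where "s' w = w $ yi i0 - fd c 0 (pz w)" for w
    have sd: "(s has_derivative s') (at 0)"
    proof -
      have "((\<lambda>w. c (pz w)) has_derivative (\<lambda>w. fd c 0 (pz w))) (at 0)"
        by (rule has_derivative_compose[where g=c, OF linear_imp_has_derivative[OF linear_pz]])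
          (use smooth_near_has_derivative[OF c] pz0 in simp)
      then show ?thesis unfolding s_def s'_def
        by (intro has_derivative_diff bounded_linear_imp_has_derivative bounded_linear_vec_nth)
    qed
    have spd: "((\<lambda>w. (s w, pz w)) has_derivative (\<lambda>w. (s' w, pz w))) (at 0)"
      by (intro has_derivative_Pair sd linear_imp_has_derivative linear_pz)
    have bsd: "((\<lambda>w. b (s w, pz w)) has_derivative (\<lambda>w. fd b 0 (s' w, pz w))) (at 0)"
      by (rule has_derivative_compose[where g=b, OF spd]) (use bd in \<open>simp add: s0 pz0 zero_prod_def\<close>)
    have asd: "((\<lambda>w. a (s w, pz w)) has_derivative (\<lambda>w. fd a 0 (s' w, pz w))) (at 0)"
      by (rule has_derivative_compose[where g=a, OF spd]) (use ad in \<open>simp add: s0 pz0 zero_prod_def\<close>)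
    define Y' where "Y' w = (\<chi> k. if k = i0 then s' w else w $ yi k - fd a 0 (s' w, pz w) $ k)" for w
    have Yd: "(Y has_derivative Y') (at 0)"
    proof (rule has_derivative_componentwise_within[THEN iffD2], rule ballI)
      fix u :: "real^'n" assume "u \<in> Basis"
      then obtain k where u: "u = axis k 1" by (auto simp: Basis_vec_def)
      have "((\<lambda>w. Y w $ k) has_derivative (\<lambda>w. Y' w $ k)) (at 0)"
        by (cases "k = i0") (auto simp: Y_def Y'_def intro!: sd has_derivative_diff
            bounded_linear_imp_has_derivative bounded_linear_vec_nth
            bounded_linear.has_derivative[OF bounded_linear_vec_nth asd])
      then show "((\<lambda>w. Y w \<bullet> u) has_derivative (\<lambda>w. Y' w \<bullet> u)) (at 0)"
        by (simp add: u inner_axis)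
    qed
    have Hd: "(H has_derivative (\<lambda>w. mk (Y' w) (fd b 0 (s' w, pz w)))) (at 0)"
      unfolding H_def by (rule has_derivative_mk[OF Yd bsd])
    have "w = 0" if w: "fd H 0 w = 0" for w
    proof -
      have mk0: "mk (Y' w) (fd b 0 (s' w, pz w)) = 0" using w fderiv_eqI[OF Hd] by metis
      then have Y0: "Y' w $ k = 0" for k
        using mk_yi[of "Y' w" "fd b 0 (s' w, pz w)" k] unfolding mk0 by simp
      have s0': "s' w = 0" using Y0[of i0] by (simp add: Y'_def)
      have "pz w = 0"
      proof (unfold vec_eq_iff, rule allI)
        fix l
        show "pz w $ l = 0 $ l"
        proof (cases "l = i0")
          case False
          have "\<gamma> * pz w $ l = 0"
            using mk_zi[OF False, of "Y' w" "fd b 0 (s' w, pz w)"] s0' Db[OF False, of "pz w"]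
            unfolding mk0 by (simp del: mk_zi)
          then show ?thesis using \<gamma> by simp
        qed simp
      qed
      moreover have "fd c 0 0 = 0" "fd a 0 0 = 0"
        using linear_0[OF smooth_near_linear_fd] c a by auto
      ultimately have "w $ yi k = 0" for k
        using Y0[of k] s0' by (cases "k = i0") (auto simp: Y'_def s'_def zero_prod_def)
      moreover have "w $ zi k = 0" if "k \<noteq> i0" for k
        using \<open>pz w = 0\<close> pz_nth[of w k] that by simp
      ultimately show ?thesis by (auto intro: yz_eqI)
    qed
    then show ?thesis using linear_injective_0[OF smooth_near_linear_fd[OF Hsm]] by blast
  qed
  then have H: "locdiff H 0" using Hsm by (simp add: locdiff_def)
  have "\<forall>\<^sub>F x in nhds 0. F (x $ i0, proj x) =
      a ((x $ i0)\<^sup>2, proj x) + (x $ i0) *\<^sub>R b ((x $ i0)\<^sup>2, proj x)"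
  proof -
    have "smooth_near (\<lambda>x::real^'n. (x $ i0, proj x)) 0"
      by (intro smooth_near_Pair smooth_near_vec_nth smooth_near_proj smooth_near_ident)
    from eventually_smooth_near_compose[OF this, of "\<lambda>p. F p = a ((fst p)\<^sup>2, snd p) + fst p *\<^sub>R b ((fst p)\<^sup>2, snd p)"]
    show ?thesis using ab by (simp add: proj0 zero_prod_def)
  qed
  then have "\<forall>\<^sub>F x in nhds 0. H (G x) = umbrella (\<kappa> x)"
    using sq G(3)[unfolded zcoords_def]
  proof eventually_elim
    case (elim x)
    have pyG: "py (G x) = a ((x $ i0)\<^sup>2, proj x) + (x $ i0) *\<^sub>R b ((x $ i0)\<^sup>2, proj x)"
      using elim(1) split_e0[of x] by (simp add: F_def pp)
    have sG: "s (G x) = (x $ i0)\<^sup>2" using elim by (simp add: s_def)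
    show ?case
    proof (rule yz_eqI)
      show "H (G x) $ yi k = umbrella (\<kappa> x) $ yi k" for k
        using arg_cong[OF pyG, of "\<lambda>w. w $ k"] elim(3)
        by (cases "k = i0") (auto simp: H_def Y_def umbrella_def sG \<kappa>_def power2_eq_square)
      show "H (G x) $ zi k = umbrella (\<kappa> x) $ zi k" if "k \<noteq> i0" for k
        using that elim(3) by (simp add: H_def umbrella_def sG \<kappa>_def)
    qed
  qed
  then show ?thesis unfolding umbrella_germ_def using H H0 \<kappa> \<kappa>0 G(2) by auto
qed


text \<open>
  The inverse of the coordinate change that replaces the coordinate \<open>i0\<close> by the function \<open>m\<close> and keeps
  the others.
\<close>

lemma vertical_change:
  assumes m: "smooth_near m 0" "m 0 = 0" and fdm: "\<And>\<xi>. fd m 0 \<xi> = \<rho> * \<xi> $ i0" and \<rho>: "\<rho> \<noteq> 0"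
  obtains k where "locdiff k 0" "k 0 = 0" "\<forall>\<^sub>F x in nhds 0. m (k x) = x $ i0"
    "\<forall>\<^sub>F x in nhds 0. proj (k x) = proj x" "\<And>\<xi>. fd k 0 \<xi> = proj \<xi> + (\<xi> $ i0 / \<rho>) *\<^sub>R e0"
proof -
  define \<kappa> where "\<kappa> x = proj x + m x *\<^sub>R e0" for x
  have \<kappa>sm: "smooth_near \<kappa> 0" unfolding \<kappa>_def
    by (intro smooth_near_add smooth_near_proj smooth_near_scaleR smooth_near_ident smooth_near_const m)
  have "(\<kappa> has_derivative (\<lambda>\<xi>. proj \<xi> + (m 0 *\<^sub>R 0 + fd m 0 \<xi> *\<^sub>R e0))) (at 0)"
    unfolding \<kappa>_def
    by (intro has_derivative_add linear_imp_has_derivative linear_proj has_derivative_scaleR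
        smooth_near_has_derivative m has_derivative_const)
  from fderiv_eqI[OF this] have fd\<kappa>: "fd \<kappa> 0 \<xi> = proj \<xi> + (\<rho> * \<xi> $ i0) *\<^sub>R e0" for \<xi>
    by (simp add: fdm)
  have \<kappa>0: "\<kappa> 0 = 0" by (simp add: \<kappa>_def m linear_0[OF linear_proj])
  have "\<xi> = 0" if "fd \<kappa> 0 \<xi> = 0" for \<xi>
  proof (unfold vec_eq_iff, rule allI)
    fix l show "\<xi> $ l = 0 $ l" using arg_cong[OF that, of "\<lambda>x. x $ l"] \<rho> by (auto simp: fd\<kappa> split: if_splits)
  qed
  then have loc: "locdiff \<kappa> 0"
    unfolding locdiff_def using \<kappa>sm linear_injective_0[OF smooth_near_linear_fd[OF \<kappa>sm]] by blast
  obtain k where k: "locdiff k 0" "k 0 = 0" "\<forall>\<^sub>F y in nhds 0. \<kappa> (k y) = y"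
    and inv: "\<And>h. fd \<kappa> 0 (fd k 0 h) = h"
    by (rule locdiff_inverse[OF loc, unfolded \<kappa>0]) (rule that)
  show thesis
  proof
    show "locdiff k 0" "k 0 = 0" by (fact k)+
    show "\<forall>\<^sub>F x in nhds 0. m (k x) = x $ i0"
      using k(3)
    proof eventually_elim
      case (elim x)
      show ?case using arg_cong[OF elim, of "\<lambda>x. x $ i0"] by (simp add: \<kappa>_def)
    qed
    show "\<forall>\<^sub>F x in nhds 0. proj (k x) = proj x"
      using k(3)
    proof eventually_elim
      case (elim x)
      have "proj (\<kappa> (k x)) = proj (k x)" by (auto simp: \<kappa>_def vec_eq_iff)
      then show ?case using elim by simp
    qed
    show "fd k 0 \<xi> = proj \<xi> + (\<xi> $ i0 / \<rho>) *\<^sub>R e0" for \<xi>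
    proof (unfold vec_eq_iff, rule allI)
      fix l show "fd k 0 \<xi> $ l = (proj \<xi> + (\<xi> $ i0 / \<rho>) *\<^sub>R e0) $ l"
        using arg_cong[OF inv[of \<xi>], of "\<lambda>x. x $ l"] \<rho> by (cases "l = i0") (auto simp: fd\<kappa> field_simps)
    qed
  qed
qed

lemma zcoords_source:
  assumes "zcoords G" "smooth_near k 0" "k 0 = 0" "\<forall>\<^sub>F x in nhds 0. proj (k x) = proj x"
  shows "zcoords (\<lambda>x. G (k x))"
proof -
  have "\<forall>\<^sub>F x in nhds 0. pz (G (k x)) = proj (k x)"
    by (rule eventually_smooth_near_compose[OF assms(2)]) (use assms in \<open>simp add: zcoords_def\<close>)
  then show ?thesis unfolding zcoords_def using assms(4) by eventually_elim simp
qed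

text \<open>
  With \<open>t sqrt u\<close> in place of \<open>t\<close> the unit \<open>u\<close> disappears.
\<close>

lemma umbrella_germ_of_square_times_unit:
  assumes G: "smooth_near G 0" "G 0 = 0" "zcoords G" "ycritical G"
    and \<gamma>: "\<gamma> \<noteq> 0" and hess: "\<And>\<xi> l. l \<noteq> i0 \<Longrightarrow> py (fd (\<lambda>x. fd G x e0) 0 \<xi>) $ l = \<gamma> * \<xi> $ l"
    and c: "smooth_near c 0" and u: "smooth_near u 0" "u 0 > 0"
    and sq: "\<forall>\<^sub>F x in nhds 0. G x $ yi i0 = c (proj x) + (x $ i0)\<^sup>2 * u x"
  shows "umbrella_germ G 0"
proof -
  define m where "m x = (x $ i0) * sqrt (u x)" for x
  have r: "smooth_near (\<lambda>x. sqrt (u x)) 0"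
    by (rule smooth_near_compose[OF u(1) smooth_nearI[OF _ _ smooth_on_real_sqrt]]) (use u in auto)
  have "((\<lambda>x. (x $ i0) *\<^sub>R sqrt (u x)) has_derivative
      (\<lambda>\<xi>. (0 $ i0) *\<^sub>R fd (\<lambda>x. sqrt (u x)) 0 \<xi> + (\<xi> $ i0) *\<^sub>R sqrt (u 0))) (at 0)"
    by (intro has_derivative_scaleR smooth_near_has_derivative r bounded_linear_imp_has_derivative bounded_linear_vec_nth)
  from fderiv_eqI[OF this] have fdm: "fd m 0 \<xi> = sqrt (u 0) * \<xi> $ i0" for \<xi>
    by (simp add: m_def[abs_def] mult.commute)
  have m: "smooth_near m 0" "m 0 = 0"
    using smooth_near_scaleR[OF smooth_near_vec_nth[OF smooth_near_ident] r, of i0] by (simp_all add: m_def[abs_def])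
  obtain k where k: "locdiff k 0" "k 0 = 0" "\<forall>\<^sub>F x in nhds 0. m (k x) = x $ i0"
    "\<forall>\<^sub>F x in nhds 0. proj (k x) = proj x" "\<And>\<xi>. fd k 0 \<xi> = proj \<xi> + (\<xi> $ i0 / sqrt (u 0)) *\<^sub>R e0"
    by (rule vertical_change[OF m fdm]) (use u in \<open>auto intro: that\<close>)
  have ksm: "smooth_near k 0" using k by (simp add: locdiff_def)
  have ke0: "fd k 0 e0 = (1 / sqrt (u 0)) *\<^sub>R e0" by (simp add: k vec_eq_iff)
  note sc = source_change[OF ksm k(2) G(1,4) ke0]
  have "umbrella_germ (\<lambda>x. G (k x)) 0"
  proof (rule umbrella_germ_of_square[OF sc(1) _ zcoords_source[OF G(3) ksm k(2,4)] sc(2) _ _ c])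
    show "1 / sqrt (u 0) * \<gamma> \<noteq> 0" using \<gamma> u by simp
    show "py (fd (\<lambda>x. fd (\<lambda>x. G (k x)) x e0) 0 \<xi>) $ l = 1 / sqrt (u 0) * \<gamma> * \<xi> $ l" if "l \<noteq> i0" for \<xi> l
      unfolding sc(3) using hess[OF that] that by (simp add: k del: py_nth)
    have "\<forall>\<^sub>F y in nhds 0. u y > 0"
    proof -
      have "\<forall>\<^sub>F v in nhds (u 0). v > 0" using u(2) by (intro eventually_nhds_in_open[of "{0<..}", simplified]) auto
      then show ?thesis by (rule eventually_smooth_near_compose[OF u(1)])
    qed
    then have "\<forall>\<^sub>F y in nhds 0. u y > 0 \<and> G y $ yi i0 = c (proj y) + (y $ i0)\<^sup>2 * u y"
      using sq by eventually_elim simp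
    then have "\<forall>\<^sub>F x in nhds 0. u (k x) > 0 \<and> G (k x) $ yi i0 = c (proj (k x)) + (k x $ i0)\<^sup>2 * u (k x)"
      by (intro eventually_smooth_near_compose[OF ksm]) (simp add: k)
    then show "\<forall>\<^sub>F x in nhds 0. G (k x) $ yi i0 = c (proj x) + (x $ i0)\<^sup>2"
      using k(3,4)
    proof eventually_elim
      case (elim x)
      have "(k x $ i0)\<^sup>2 * u (k x) = (m (k x))\<^sup>2" using elim(1) by (simp add: m_def power_mult_distrib)
      then show ?case using elim by simp
    qed
  qed (simp add: k G)
  then show ?thesis using umbrella_germ_source[OF k(1)] k(2) by simp
qed

text \<open>
  A Morse lemma with parameters for the first y-component \<open>g\<close>. Taking the derivative of \<open>g\<close> in the kernel
  direction as new coordinate \<open>t\<close>, one reaches the situation where this derivative vanishes for \<open>t = 0\<close>. Two Hadamard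
  quotients then give \<open>g = c(z) + t\<^sup>2 u\<close>, and \<open>2 u(0)\<close> is an entry of the Hessian, which is \<open>1\<close>.
\<close>

lemma umbrella_germ_of_zcoords:
  assumes G: "smooth_near G 0" "G 0 = 0" "zcoords G" "ycritical G"
    and hess: "\<And>\<xi>. py (fd (\<lambda>x. fd G x e0) 0 \<xi>) = \<xi>"
  shows "umbrella_germ G 0"
proof -
  define m where "m x = fd G x e0 $ yi i0" for x
  note Gf = smooth_near_fderiv[OF G(1), of e0]
  have m: "smooth_near m 0" unfolding m_def by (rule smooth_near_vec_nth[OF Gf])
  have m0: "m 0 = 0" using G(4) py_nth[of "fd G 0 e0" i0] by (simp add: m_def ycritical_def)
  have fdm: "fd m 0 \<xi> = 1 * \<xi> $ i0" for \<xi>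
  proof -
    have "linear (\<lambda>w::real^'p. w $ yi i0)" by (auto intro: linearI)
    from fd_linear_compose[OF Gf this] show ?thesis
      using arg_cong[OF hess[of \<xi>], of "\<lambda>v. v $ i0"] by (simp add: m_def[abs_def])
  qed
  obtain k where k: "locdiff k 0" "k 0 = 0" "\<forall>\<^sub>F x in nhds 0. m (k x) = x $ i0"
    "\<forall>\<^sub>F x in nhds 0. proj (k x) = proj x" and fdk1: "\<And>\<xi>. fd k 0 \<xi> = proj \<xi> + (\<xi> $ i0 / 1) *\<^sub>R e0"
    by (rule vertical_change[OF m m0 fdm]) (auto intro: that)
  have fdk: "fd k 0 \<xi> = \<xi>" for \<xi> using fdk1 split_e0[of \<xi>] by simp
  have ksm: "smooth_near k 0" using k by (simp add: locdiff_def)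
  have ke0: "fd k 0 e0 = 1 *\<^sub>R e0" by (simp add: fdk)
  define G' where "G' x = G (k x)" for x
  note sc = source_change[OF ksm k(2) G(1,4) ke0, folded G'_def]
  have hess': "py (fd (\<lambda>x. fd G' x e0) 0 \<xi>) = \<xi>" for \<xi> using sc(3) fdk hess by simp
  define g where "g x = G' x $ yi i0" for x
  have g: "smooth_near g 0" unfolding g_def by (rule smooth_near_vec_nth[OF sc(1)])
  have lin_nth: "linear (\<lambda>w::real^'p. w $ yi i0)" by (auto intro: linearI)
  \<comment> \<open>on the hyperplane the first component is critical in the kernel direction\<close>
  have crit: "\<forall>\<^sub>F x in nhds 0. x $ i0 = 0 \<longrightarrow> fd g x e0 = 0"
  proof -
    have Gk: "\<forall>\<^sub>F x in nhds 0. smooth_near G (k x)"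
      by (rule eventually_smooth_near_compose[OF ksm]) (use eventually_smooth_near[OF G(1)] k(2) in simp)
    show ?thesis using Gk eventually_smooth_near[OF ksm] k(3) eventually_fd_cong[OF k(4)]
      eventually_smooth_near[OF sc(1)]
    proof eventually_elim
      case (elim x)
      have "proj (fd k x e0) = proj e0"
        using elim(4) fd_linear_compose[OF elim(2) linear_proj, of e0]
          fderiv_eqI[OF linear_imp_has_derivative[OF linear_proj], of x] by metis
      then have "proj (fd k x e0) = 0" by (simp add: vec_eq_iff)
      then have e: "fd k x e0 = (fd k x e0 $ i0) *\<^sub>R e0" using split_e0[of "fd k x e0"] by simp
      have "fd G' x e0 = fd G (k x) (fd k x e0)"
        unfolding G'_def by (rule fd_compose[OF elim(2,1)])
      also have "\<dots> = (fd k x e0 $ i0) *\<^sub>R fd G (k x) e0"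
        by (subst e) (rule linear_cmul[OF smooth_near_linear_fd[OF elim(1)]])
      finally have "fd g x e0 = fd k x e0 $ i0 * m (k x)"
        unfolding g_def fd_linear_compose[OF elim(5) lin_nth] by (simp add: m_def)
      then show ?case using elim(3) by simp
    qed
  qed
  define F where "F p = g (proj (snd p) + fst p *\<^sub>R e0)" for p
  have F: "smooth_near F 0" unfolding F_def by (rule smooth_near_setc[OF g])
  have proj0: "proj 0 = 0" by (simp add: vec_eq_iff)
  obtain \<epsilon> where \<epsilon>: "\<epsilon> > 0" "smooth_on ({-\<epsilon><..<\<epsilon>} \<times> ball 0 \<epsilon>) F" by (rule smooth_near_box[OF F])
  let ?T = "{-\<epsilon><..<\<epsilon>} \<times> ball (0 :: real^'n) \<epsilon>"
  have T: "open ?T" by (intro open_Times) auto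
  have F0: "smooth_on ?T (\<lambda>p. F (0, snd p))"
    by (rule smooth_on_compose[OF \<epsilon>(2) _ T T]) (use \<epsilon>(1) in \<open>auto intro!: smooth_intros T\<close>)
  obtain q where q: "smooth_on ?T q" "\<And>t z. \<bar>t\<bar> < \<epsilon> \<Longrightarrow> z \<in> ball 0 \<epsilon> \<Longrightarrow> F (t, z) - F (0, z) = t *\<^sub>R q (t, z)"
    by (rule smooth_Hadamard_quotient[OF smooth_on_diff[OF T \<epsilon>(2) F0]]) (auto intro: that)
  have projsm: "smooth_near proj (0 :: real^'n)" by (rule smooth_near_linear[OF linear_proj smooth_near_ident])
  have "\<forall>\<^sub>F z in nhds 0. (proj z $ i0 = 0 \<longrightarrow> fd g (proj z) e0 = 0) \<and> smooth_near g (proj z)"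
    by (rule eventually_smooth_near_compose[OF projsm, where P="\<lambda>x. (x $ i0 = 0 \<longrightarrow> fd g x e0 = 0) \<and> smooth_near g x"])
      (use eventually_conj[OF crit eventually_smooth_near[OF g]] in \<open>simp only: proj0\<close>)
  then have "\<forall>\<^sub>F z in nhds 0. fd g (proj z) e0 = 0 \<and> smooth_near g (proj z)" by simp
  then obtain \<delta>' where \<delta>': "\<delta>' > 0" "\<And>z. z \<in> ball 0 \<delta>' \<Longrightarrow> fd g (proj z) e0 = 0 \<and> smooth_near g (proj z)"
    unfolding eventually_nhds_metric by (auto simp: dist_commute)
  define \<delta> where "\<delta> = min \<epsilon> \<delta>'"
  have \<delta>: "\<delta> > 0" "\<delta> \<le> \<epsilon>" "\<delta> \<le> \<delta>'" using \<epsilon> \<delta>' by (auto simp: \<delta>_def)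
  have q0: "q (0, z) = 0" if z: "z \<in> ball 0 \<delta>" for z
  proof -
    have z': "z \<in> ball 0 \<epsilon>" "z \<in> ball 0 \<delta>'" using z \<delta> by auto
    have "((\<lambda>t. proj z + t *\<^sub>R e0) has_derivative (\<lambda>h. h *\<^sub>R e0)) (at 0)" by (auto intro!: derivative_eq_intros)
    from has_derivative_compose[where g=g, OF this, of "fd g (proj z)"]
      smooth_near_has_derivative[OF conjunct2[OF \<delta>'(2)[OF z'(2)]]]
    have 1: "((\<lambda>t. F (t, z)) has_derivative (\<lambda>h. fd g (proj z) (h *\<^sub>R e0))) (at 0)" by (simp add: F_def)
    have "(0, z) \<in> ?T" using z' \<epsilon> by simp
    note qd = smooth_on_has_derivative[OF q(1) this]
    have "((\<lambda>t. (t, z)) has_derivative (\<lambda>h. (h, 0))) (at (0::real))" by (auto intro!: derivative_eq_intros)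
    from has_derivative_compose[where g=q, OF this qd]
    have "((\<lambda>t. F (0, z) + t *\<^sub>R q (t, z)) has_derivative (\<lambda>h. 0 + (0 *\<^sub>R fd q (0, z) (h, 0) + h *\<^sub>R q (0, z)))) (at 0)"
      by (intro has_derivative_add has_derivative_const has_derivative_scaleR has_derivative_ident)
    then have "((\<lambda>t. F (t, z)) has_derivative (\<lambda>h. 0 + (0 *\<^sub>R fd q (0, z) (h, 0) + h *\<^sub>R q (0, z)))) (at 0)"
    proof (rule has_derivative_transform_within_open[where s="{-\<epsilon><..<\<epsilon>}"])
      show "F (0, z) + t *\<^sub>R q (t, z) = F (t, z)" if "t \<in> {-\<epsilon><..<\<epsilon>}" for t
      proof -
        have "\<bar>t\<bar> < \<epsilon>" using that by auto
        from q(2)[OF this z'(1)] show ?thesis by (simp add: algebra_simps)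
      qed
    qed (use \<epsilon> in auto)
    from has_derivative_unique[OF this 1] have "0 + (0 *\<^sub>R fd q (0, z) (1, 0) + 1 *\<^sub>R q (0, z)) = fd g (proj z) (1 *\<^sub>R e0)" by metis
    then show ?thesis using \<delta>'(2)[OF z'(2)] by simp
  qed
  have q': "smooth_on ({-\<delta><..<\<delta>} \<times> ball 0 \<delta>) q" by (rule smooth_on_subset[OF q(1)]) (use \<delta> in auto)
  obtain r where r: "smooth_on ({-\<delta><..<\<delta>} \<times> ball 0 \<delta>) r" "\<And>t z. \<bar>t\<bar> < \<delta> \<Longrightarrow> z \<in> ball 0 \<delta> \<Longrightarrow> q (t, z) = t *\<^sub>R r (t, z)"
    by (rule smooth_Hadamard_quotient[OF q' open_ball q0]) (auto intro: that)
  have Feq: "F (t, z) = F (0, z) + t\<^sup>2 * r (t, z)" if "\<bar>t\<bar> < \<delta>" "z \<in> ball 0 \<delta>" for t z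
    using q(2)[of t z] r(2)[OF that] that \<delta> by (simp add: power2_eq_square algebra_simps)
  define u where "u x = r (x $ i0, proj x)" for x
  define c where "c z = F (0, z)" for z
  have xp: "smooth_near (\<lambda>x::real^'n. (x $ i0, proj x)) 0"
    by (intro smooth_near_Pair smooth_near_vec_nth smooth_near_proj smooth_near_ident)
  have rsm: "smooth_near r 0"
    by (rule smooth_nearI[OF _ _ r(1)]) (use \<delta> in \<open>auto intro!: open_Times simp: zero_prod_def\<close>)
  have u: "smooth_near u 0" unfolding u_def
    using smooth_near_compose[OF xp, of r] rsm by (simp add: proj0 zero_prod_def)
  have zs: "smooth_near (\<lambda>z::real^'n. (0::real, z)) 0"
    by (intro smooth_near_Pair smooth_near_const smooth_near_ident)
  have c: "smooth_near c 0" unfolding c_def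
    by (rule smooth_near_compose[OF zs]) (fact F[unfolded zero_prod_def])
  have sq: "\<forall>\<^sub>F x in nhds 0. g x = c (proj x) + (x $ i0)\<^sup>2 * u x"
  proof -
    have "\<forall>\<^sub>F p in nhds 0. F p = F (0, snd p) + (fst p)\<^sup>2 * r p"
      by (rule eventually_box[OF \<delta>(1)], unfold fst_conv snd_conv, rule Feq)
    then have "\<forall>\<^sub>F x in nhds 0. F (x $ i0, proj x) = F (0, proj x) + (x $ i0)\<^sup>2 * r (x $ i0, proj x)"
      using eventually_smooth_near_compose[OF xp, of "\<lambda>p. F p = F (0, snd p) + (fst p)\<^sup>2 * r p"]
      by (simp add: proj0 zero_prod_def)
    then show ?thesis
    proof eventually_elim
      case (elim x)
      have "proj (proj x) + (x $ i0) *\<^sub>R e0 = x" by (simp add: vec_eq_iff)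
      then have "F (x $ i0, proj x) = g x" by (simp add: F_def)
      then show ?case using elim by (simp add: c_def u_def)
    qed
  qed
  have "u 0 > 0"
  proof -
    define w where "w x = 2 * u x + (x $ i0) * fd u x e0" for x
    have cp: "smooth_near (\<lambda>x. c (proj x)) 0"
      by (rule smooth_near_compose[OF smooth_near_proj[OF smooth_near_ident]]) (simp add: proj0 c)
    have pc: "\<forall>\<^sub>F x in nhds 0. smooth_near c (proj x)"
      by (rule eventually_smooth_near_compose[OF smooth_near_proj[OF smooth_near_ident]])
        (use eventually_smooth_near[OF c] in \<open>simp add: proj0\<close>)
    have "\<forall>\<^sub>F x in nhds 0. fd g x e0 = (x $ i0) * w x"
      using eventually_fd_cong[OF sq] eventually_smooth_near[OF u] pc
    proof eventually_elim
      case (elim x)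
      have nd: "((\<lambda>x::real^'n. x $ i0) has_derivative (\<lambda>h. h $ i0)) (at x)"
        by (intro bounded_linear_imp_has_derivative bounded_linear_vec_nth)
      have cd: "((\<lambda>x. c (proj x)) has_derivative (\<lambda>h. fd c (proj x) (proj h))) (at x)"
        by (rule has_derivative_compose[where g=c, OF linear_imp_has_derivative[OF linear_proj] smooth_near_has_derivative[OF elim(3)]])
      have "((\<lambda>x. c (proj x) + (x $ i0 * x $ i0) * u x) has_derivative
          (\<lambda>h. fd c (proj x) (proj h) + ((x $ i0 * x $ i0) * fd u x h + (x $ i0 * h $ i0 + h $ i0 * x $ i0) * u x))) (at x)"
        by (intro has_derivative_add cd has_derivative_mult nd smooth_near_has_derivative[OF elim(2)])
      from fderiv_eqI[OF this]
      have "fd g x e0 = fd c (proj x) (proj e0) + ((x $ i0 * x $ i0) * fd u x e0 + (x $ i0 + x $ i0) * u x)"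
        unfolding elim(1) power2_eq_square by simp
      moreover have "proj e0 = 0" by (simp add: vec_eq_iff)
      ultimately show ?case using linear_0[OF smooth_near_linear_fd[OF elim(3)]]
        by (simp add: w_def algebra_simps)
    qed
    from fd_cong[OF this] have "fd (\<lambda>x. fd g x e0) 0 e0 = fd (\<lambda>x. (x $ i0) * w x) 0 e0" by simp
    also have "\<dots> = 2 * u 0"
    proof -
      have ws: "smooth_near w 0" unfolding w_def
        using smooth_near_add[OF smooth_near_scaleR[OF smooth_near_const u, of 2]
          smooth_near_scaleR[OF smooth_near_vec_nth[OF smooth_near_ident] smooth_near_fderiv[OF u]]] by simp
      have "((\<lambda>x. (x $ i0) * w x) has_derivative (\<lambda>h. (0 $ i0) * fd w 0 h + (h $ i0) * w 0)) (at 0)"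
        by (intro has_derivative_mult smooth_near_has_derivative ws bounded_linear_imp_has_derivative bounded_linear_vec_nth)
      from fderiv_eqI[OF this] show ?thesis by (simp add: w_def)
    qed
    finally have 1: "fd (\<lambda>x. fd g x e0) 0 e0 = 2 * u 0" .
    have "\<forall>\<^sub>F x in nhds 0. fd g x e0 = fd G' x e0 $ yi i0"
      using eventually_smooth_near[OF sc(1)]
      by eventually_elim (simp add: g_def[abs_def] fd_linear_compose[OF _ lin_nth])
    from fd_cong[OF this] have "fd (\<lambda>x. fd g x e0) 0 e0 = fd (\<lambda>x. fd G' x e0) 0 e0 $ yi i0"
      using fd_linear_compose[OF smooth_near_fderiv[OF sc(1)] lin_nth] by simp
    also have "\<dots> = 1" using arg_cong[OF hess'[of e0], of "\<lambda>v. v $ i0"] by simp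
    finally show ?thesis using 1 by simp
  qed
  have "umbrella_germ G' 0"
  proof (rule umbrella_germ_of_square_times_unit[where \<gamma>=1, OF sc(1) _ _ sc(2) _ _ c u \<open>u 0 > 0\<close>])
    show "zcoords G'" unfolding G'_def by (rule zcoords_source[OF G(3) ksm k(2,4)])
    show "\<forall>\<^sub>F x in nhds 0. G' x $ yi i0 = c (proj x) + (x $ i0)\<^sup>2 * u x" using sq by (simp add: g_def)
    show "py (fd (\<lambda>x. fd G' x e0) 0 \<xi>) $ l = 1 * \<xi> $ l" for \<xi> l by (simp only: hess' mult_1)
  qed (simp_all add: G'_def k G)
  then show ?thesis using umbrella_germ_source[OF k(1), of G] k(2) by (simp add: G'_def[abs_def])
qed

text \<open>
  The coordinate \<open>i0\<close> and the z-part of \<open>G\<close> have the identity as derivative at \<open>0\<close>, so they may serve as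
  coordinates.
\<close>

lemma umbrella_germ_of_linear_part:
  assumes G: "smooth_near G 0" "G 0 = 0" and lin: "\<And>w. fd G 0 w = mk 0 w"
    and hess: "\<And>\<xi>. py (fd (\<lambda>x. fd G x e0) 0 \<xi>) = \<xi>"
  shows "umbrella_germ G 0"
proof -
  have yc: "ycritical G" unfolding ycritical_def lin by (simp add: vec_eq_iff)
  define \<kappa> where "\<kappa> x = (x $ i0) *\<^sub>R e0 + pz (G x)" for x
  have pzG: "smooth_near (\<lambda>x. pz (G x)) 0" by (rule smooth_near_linear[OF linear_pz G(1)])
  have \<kappa>sm: "smooth_near \<kappa> 0" unfolding \<kappa>_def
    by (intro smooth_near_add smooth_near_scaleR smooth_near_vec_nth smooth_near_ident smooth_near_const pzG)
  have pz0: "pz 0 = 0" by (simp add: vec_eq_iff)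
  have \<kappa>0: "\<kappa> 0 = 0" by (simp add: \<kappa>_def G pz0)
  have "(\<kappa> has_derivative (\<lambda>\<xi>. ((0 $ i0) *\<^sub>R 0 + (\<xi> $ i0) *\<^sub>R e0) + fd (\<lambda>x. pz (G x)) 0 \<xi>)) (at 0)"
    unfolding \<kappa>_def
    by (intro has_derivative_add has_derivative_scaleR has_derivative_const smooth_near_has_derivative pzG
        bounded_linear_imp_has_derivative bounded_linear_vec_nth)
  from fderiv_eqI[OF this] have fd\<kappa>: "fd \<kappa> 0 \<xi> = \<xi>" for \<xi>
    by (simp add: fd_linear_compose[OF G(1) linear_pz] lin vec_eq_iff)
  have loc: "locdiff \<kappa> 0" unfolding locdiff_def using \<kappa>sm by (simp add: fd\<kappa> inj_def)
  obtain k where k: "locdiff k 0" "k 0 = 0" "\<forall>\<^sub>F y in nhds 0. \<kappa> (k y) = y"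
    and inv: "\<And>h. fd \<kappa> 0 (fd k 0 h) = h"
    by (rule locdiff_inverse[OF loc, unfolded \<kappa>0]) (rule that)
  have fdk: "fd k 0 \<xi> = \<xi>" for \<xi> using inv by (simp add: fd\<kappa>)
  have ksm: "smooth_near k 0" using k by (simp add: locdiff_def)
  have ke0: "fd k 0 e0 = 1 *\<^sub>R e0" by (simp add: fdk)
  note sc = source_change[OF ksm k(2) G(1) yc ke0]
  have "zcoords (\<lambda>x. G (k x))"
    unfolding zcoords_def using k(3)
  proof eventually_elim
    case (elim x)
    have "pz (G (k x)) $ l = proj x $ l" for l
      using arg_cong[OF elim, of "\<lambda>x. x $ l"] by (cases "l = i0") (auto simp: \<kappa>_def)
    then show ?case by (simp only: vec_eq_iff) simp
  qed
  then have "umbrella_germ (\<lambda>x. G (k x)) 0"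
    by (intro umbrella_germ_of_zcoords sc) (simp_all add: sc(3) k G fdk hess)
  then show ?thesis using umbrella_germ_source[OF k(1), of G] k(2) by simp
qed

text \<open>
  Choose a linear isomorphism \<open>M\<close> of the source that maps \<open>e0\<close> to \<open>v\<close>. Nondegeneracy says that the values
  of \<open>D\<^sup>2G(x0)(v, M \<xi>)\<close> and of \<open>DG(x0)(M \<zeta>)\<close>, with \<open>\<zeta>\<close> in the complement of \<open>e0\<close>, together span the target
  without overlap. The inverse of this identification normalises first and second derivatives at once.
\<close>

theorem umbrella_germ_of_whitney_nondegenerate:
  assumes G: "smooth_near G x0" and v: "v \<noteq> 0" "fd G x0 v = 0" and nd: "whitney_nondegenerate G x0 v"
  shows "umbrella_germ G x0"
proof -
  have "norm (norm v *\<^sub>R e0) = norm v" by (simp add: e0_def)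
  then obtain f where f: "orthogonal_transformation f" "f (norm v *\<^sub>R e0) = v"
    using orthogonal_transformation_exists by metis
  \<comment> \<open>a linear isomorphism with \<open>M e0 = v\<close>: an orthogonal map followed by a dilation\<close>
  define M where "M x = norm v *\<^sub>R f x" for x
  have flin: "linear f" using f(1) orthogonal_transformation_linear by blast
  have Mlin: "linear M" unfolding M_def by (intro linear_compose_scale_right flin)
  have Me0: "M e0 = v" unfolding M_def using f(2) linear_cmul[OF flin] by metis
  have Minj: "x = 0" if "M x = 0" for x
    using that v(1) orthogonal_transformation_norm[OF f(1), of x] by (simp add: M_def)
  let ?D2 = "fd (\<lambda>y. fd G y v) x0"
  note Glin = smooth_near_linear_fd[OF G] and D2lin = smooth_near_linear_fd[OF smooth_near_fderiv[OF G]]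
  define B where "B w = fd G x0 (M (pz w)) + ?D2 (M (py w))" for w
  have Blin: "linear B" unfolding B_def
    using linear_compose[OF linear_compose[OF linear_pz Mlin] Glin]
      linear_compose[OF linear_compose[OF linear_py Mlin] D2lin]
    by (auto intro!: linear_compose_add simp: o_def)
  have "w = 0" if "B w = 0" for w
  proof -
    have *: "M (py w) = 0" "M (pz w) \<in> span {v}"
      using nd that unfolding whitney_nondegenerate_def B_def by (auto simp: add.commute)
    have pyw: "py w = 0" using * Minj by blast
    obtain r where "M (pz w) = r *\<^sub>R v" using *(2) by (auto simp: span_singleton)
    then have "M (pz w - r *\<^sub>R e0) = 0" by (simp add: linear_diff[OF Mlin] linear_cmul[OF Mlin] Me0)
    then have e: "pz w = r *\<^sub>R e0" using Minj by fastforce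
    have "r = 0" using arg_cong[OF e, of "\<lambda>x. x $ i0"] by simp
    then have "pz w = 0" using e by simp
    then show ?thesis using pyw pz_nth[of w] py_nth[of w] by (intro yz_eqI) (metis zero_index)+
  qed
  then have "inj B" using linear_injective_0[OF Blin] by blast
  then obtain L where L: "linear L" "\<And>w. L (B w) = w" "\<And>w. B (L w) = w"
    using linear_injective_isomorphism[OF Blin] by blast
  have DM: "L (fd G x0 (M w)) = mk 0 w" for w
  proof -
    have "M w = M (proj w) + (w $ i0) *\<^sub>R v"
      using arg_cong[OF split_e0[of w], of M] by (simp add: linear_add[OF Mlin] linear_cmul[OF Mlin] Me0)
    then have "fd G x0 (M w) = fd G x0 (M (proj w))"
      by (simp add: linear_add[OF Glin] linear_cmul[OF Glin] v)
    also have "\<dots> = B (mk 0 w)"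
    proof -
      have "pz (mk 0 w) = proj w" "py (mk 0 w) = 0" by (simp_all add: vec_eq_iff)
      then show ?thesis by (simp add: B_def linear_0[OF Mlin] linear_0[OF D2lin])
    qed
    finally show ?thesis by (simp add: L)
  qed
  have DD: "L (?D2 (M \<xi>)) = mk \<xi> 0" for \<xi>
  proof -
    have "pz (mk \<xi> 0) = 0" "py (mk \<xi> 0) = \<xi>" by (simp_all add: vec_eq_iff)
    then have "B (mk \<xi> 0) = ?D2 (M \<xi>)" by (simp add: B_def linear_0[OF Mlin] linear_0[OF Glin])
    then show ?thesis using L(2) by metis
  qed
  define k where "k x = x0 + M x" for x
  have kd: "(k has_derivative M) (at x)" for x
    unfolding k_def using has_derivative_add[OF has_derivative_const linear_imp_has_derivative[OF Mlin]] by simp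
  have fdk: "fd k x = M" for x by (rule fderiv_eqI[OF kd])
  have ksm: "smooth_near k x" for x unfolding k_def
    by (intro smooth_near_add smooth_near_const smooth_near_linear[OF Mlin] smooth_near_ident)
  have k0: "k 0 = x0" by (simp add: k_def linear_0[OF Mlin])
  have kloc: "locdiff k 0" unfolding locdiff_def fdk using ksm linear_injective_0[OF Mlin] Minj by blast
  define T where "T w = L (w - G x0)" for w
  have Td: "(T has_derivative L) (at w)" for w
  proof -
    have "((\<lambda>w. w - G x0) has_derivative (\<lambda>h. h - 0)) (at w)"
      by (intro has_derivative_diff has_derivative_ident has_derivative_const)
    then show ?thesis unfolding T_def
      using bounded_linear.has_derivative[of L] L(1) linear_conv_bounded_linear by fastforce
  qed
  have fdT: "fd T w = L" for w by (rule fderiv_eqI[OF Td])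
  have Tsm: "smooth_near T w" for w unfolding T_def
    by (intro smooth_near_linear[OF L(1)] smooth_near_diff smooth_near_ident smooth_near_const)
  have Tloc: "locdiff T (G x0)" unfolding locdiff_def fdT using Tsm L(3) by (metis injI)
  have Gk: "smooth_near (\<lambda>x. G (k x)) 0" by (rule smooth_near_compose[OF ksm]) (simp add: k0 G)
  have TGk: "smooth_near (\<lambda>x. T (G (k x))) 0" by (rule smooth_near_compose[OF Gk Tsm])
  have ev: "\<forall>\<^sub>F x in nhds 0. \<forall>w. fd (\<lambda>x. T (G (k x))) x w = L (fd G (k x) (M w))"
  proof -
    have "\<forall>\<^sub>F x in nhds 0. smooth_near G (k x)"
      by (rule eventually_smooth_near_compose[OF ksm]) (use eventually_smooth_near[OF G] k0 in simp)
    then show ?thesis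
    proof eventually_elim
      case (elim x)
      show ?case
        using fd_compose[OF smooth_near_compose[OF ksm elim] Tsm] fd_compose[OF ksm elim] by (simp add: fdk fdT)
    qed
  qed
  have "umbrella_germ (\<lambda>x. T (G (k x))) 0"
  proof (rule umbrella_germ_of_linear_part[OF TGk])
    show "T (G (k 0)) = 0" by (simp add: T_def k0 linear_0[OF L(1)])
    show "fd (\<lambda>x. T (G (k x))) 0 w = mk 0 w" for w
      using eventually_nhds_x_imp_x[OF ev] by (simp add: k0 DM)
    have "\<forall>\<^sub>F x in nhds 0. fd (\<lambda>x. T (G (k x))) x e0 = L (fd G (k x) v)"
      using ev by eventually_elim (simp add: Me0)
    from fd_cong[OF this] have "fd (\<lambda>x. fd (\<lambda>x. T (G (k x))) x e0) 0 \<xi> = L (?D2 (M \<xi>))" for \<xi>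
    proof -
      have s: "smooth_near (\<lambda>y. fd G y v) (k 0)" unfolding k0 by (rule smooth_near_fderiv[OF G])
      have "fd (\<lambda>x. L (fd G (k x) v)) 0 \<xi> = L (fd (\<lambda>x. fd G (k x) v) 0 \<xi>)"
        by (rule fd_linear_compose[OF smooth_near_compose[OF ksm s] L(1)])
      also have "fd (\<lambda>x. fd G (k x) v) 0 \<xi> = ?D2 (M \<xi>)"
        using fd_compose[OF ksm s] by (simp add: fdk k0)
      finally show ?thesis using \<open>fd (\<lambda>x. fd (\<lambda>x. T (G (k x))) x e0) 0 = _\<close> by simp
    qed
    then show "py (fd (\<lambda>x. fd (\<lambda>x. T (G (k x))) x e0) 0 \<xi>) = \<xi>" for \<xi>
      by (simp add: DD vec_eq_iff)
  qed
  then have "umbrella_germ (\<lambda>x. G (k x)) 0"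
    by (rule umbrella_germ_target[rotated]) (simp add: k0 Tloc)
  then show ?thesis using umbrella_germ_source[OF kloc, of G] k0 by simp
qed

end

section \<open>Charts and singular points on manifolds\<close>

text \<open>
  The numbering behind \<open>umbrella_normal_form\<close>: the first \<open>CARD('n)\<close> components are the y-part, and the
  component \<open>x\<^sub>k\<^sub>+\<^sub>1\<close> of the z-part has number \<open>CARD('n) - 1 + k\<close>.
\<close>

lemma whitney_indices_enumeration:
  assumes card: "CARD('p::finite) = 2 * CARD('n::finite) - 1"
  obtains i0 :: "'n::finite" and yi zi :: "'n::finite \<Rightarrow> 'p::finite" where "whitney_indices i0 yi zi"
    "\<And>x. whitney_indices.umbrella i0 yi zi x = umbrella_normal_form x"
proof -
  define idx where "idx = to_nat_on (UNIV :: 'n set)"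
  define idp where "idp = to_nat_on (UNIV :: 'p set)"
  define nth_n :: "nat \<Rightarrow> 'n" where "nth_n = from_nat_into UNIV"
  define nth_p :: "nat \<Rightarrow> 'p" where "nth_p = from_nat_into UNIV"
  have bn: "bij_betw idx UNIV {..<CARD('n)}" and bp: "bij_betw idp UNIV {..<CARD('p)}"
    unfolding idx_def idp_def by (auto intro: to_nat_on_finite)
  have idx_lt: "idx k < CARD('n)" for k using bn by (auto simp: bij_betw_def)
  have idp_lt: "idp j < CARD('p)" for j using bp by (auto simp: bij_betw_def)
  have n1: "nth_n (idx k) = k" for k
    unfolding nth_n_def idx_def by (rule from_nat_into_to_nat_on) (auto intro: countable_finite)
  have p1: "nth_p (idp j) = j" for j
    unfolding nth_p_def idp_def by (rule from_nat_into_to_nat_on) (auto intro: countable_finite)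
  have n2: "idx (nth_n i) = i" if "i < CARD('n)" for i
  proof -
    have "i \<in> range idx" using bn that by (simp add: bij_betw_def)
    then show ?thesis by (auto simp: n1)
  qed
  have p2: "idp (nth_p i) = i" if "i < CARD('p)" for i
  proof -
    have "i \<in> range idp" using bp that by (simp add: bij_betw_def)
    then show ?thesis by (auto simp: p1)
  qed
  define i0 where "i0 = nth_n 0"
  define yi where "yi k = nth_p (idx k)" for k
  define zi where "zi k = nth_p (CARD('n) - 1 + idx k)" for k
  have i00: "idx i0 = 0" unfolding i0_def by (rule n2) simp
  have pos: "idx k \<ge> 1" if "k \<noteq> i0" for k
  proof (rule ccontr)
    assume "\<not> idx k \<ge> 1"
    then have "idx k = idx i0" using i00 by simp
    from arg_cong[OF this, of nth_n] show False using that by (simp add: n1)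
  qed
  have y: "idp (yi k) = idx k" for k
    unfolding yi_def using idx_lt[of k] card by (intro p2) linarith
  have z: "idp (zi k) = CARD('n) - 1 + idx k" for k
    unfolding zi_def using idx_lt[of k] card by (intro p2) linarith
  have W: "whitney_indices i0 yi zi"
  proof
    have inj_idx: "k = l" if "idx k = idx l" for k l using arg_cong[OF that, of nth_n] by (simp add: n1)
    show "inj yi"
    proof (rule injI)
      show "k = l" if "yi k = yi l" for k l using arg_cong[OF that, of idp] y inj_idx by simp
    qed
    show "inj_on zi (-{i0})"
    proof (rule inj_onI)
      show "k = l" if "zi k = zi l" for k l
        using arg_cong[OF that, of idp] unfolding z by (intro inj_idx) (simp only: add_left_cancel)
    qed
    show "yi k \<noteq> zi l" if "l \<noteq> i0" for k l
      using y[of k] z[of l] idx_lt[of k] pos[OF that] by auto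
    show "(\<exists>k. j = yi k) \<or> (\<exists>k. k \<noteq> i0 \<and> j = zi k)" for j
    proof (cases "idp j < CARD('n)")
      case True
      then have "j = yi (nth_n (idp j))" using n2 p1 by (simp add: yi_def)
      then show ?thesis by blast
    next
      case False
      define i where "i = idp j - (CARD('n) - 1)"
      have i: "0 < i" "i < CARD('n)" "CARD('n) - 1 + i = idp j"
        using False idp_lt[of j] card by (auto simp: i_def)
      then have "j = zi (nth_n i)" using n2 p1 by (simp add: zi_def)
      moreover have "nth_n i \<noteq> i0" using n2[OF i(2)] i00 i(1) by auto
      ultimately show ?thesis by blast
    qed
  qed
  interpret whitney_indices i0 yi zi by (rule W)
  have "umbrella x = umbrella_normal_form x" for x
  proof (rule yz_eqI)
    have co: "coord x (idx k) = x $ k" for k using n1 by (simp add: coord_def nth_n_def)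
    have c0: "coord x 0 = x $ i0" by (simp add: coord_def i0_def nth_n_def)
    show "umbrella x $ yi k = umbrella_normal_form x $ yi k" for k
      using y[of k] idx_lt[of k] co[of k] c0
      by (simp add: umbrella_def umbrella_normal_form_def Let_def flip: idp_def)
    show "umbrella x $ zi k = umbrella_normal_form x $ zi k" if "k \<noteq> i0" for k
    proof -
      have "\<not> CARD('n) - 1 + idx k < CARD('n)" "CARD('n) - 1 + idx k + 1 - CARD('n) = idx k"
        using pos[OF that] by auto
      then show ?thesis using z[of k] co[of k] that
        by (simp add: umbrella_def umbrella_normal_form_def Let_def flip: idp_def)
    qed
  qed
  then show thesis using that W by blast
qed

lemma is_chart_facts:
  assumes "is_chart N (V, \<phi>)"
  shows "openin N V" "V \<subseteq> topspace N" "inj_on \<phi> V" "open (\<phi> ` V)"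
    "\<And>W. openin N W \<Longrightarrow> W \<subseteq> V \<Longrightarrow> open (\<phi> ` W)"
    "\<And>S. open S \<Longrightarrow> openin N {p \<in> V. \<phi> p \<in> S}"
proof -
  have V: "openin N V" and o: "open (\<phi> ` V)"
    and hom: "homeomorphic_map (subtopology N V) (top_of_set (\<phi> ` V)) \<phi>"
    using assms by (auto simp: is_chart_def)
  show "openin N V" "V \<subseteq> topspace N" "open (\<phi> ` V)" using V o openin_subset by auto
  have tV: "topspace (subtopology N V) = V" using openin_subset[OF V] by (simp add: inf.absorb2)
  show "inj_on \<phi> V" using homeomorphic_imp_injective_map[OF hom] tV by simp
  show "open (\<phi> ` W)" if "openin N W" "W \<subseteq> V" for W
  proof -
    have "openin (subtopology N V) W" using that V by (simp add: openin_open_subtopology)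
    then have "openin (top_of_set (\<phi> ` V)) (\<phi> ` W)"
      using homeomorphic_imp_open_map[OF hom] by (simp add: open_map_def)
    then show ?thesis using o openin_open_trans by blast
  qed
  show "openin N {p \<in> V. \<phi> p \<in> S}" if "open S" for S
  proof -
    have "openin (subtopology N V) {p \<in> topspace (subtopology N V). \<phi> p \<in> \<phi> ` V \<inter> S}"
      using openin_continuous_map_preimage[OF homeomorphic_imp_continuous_map[OF hom]] that
      by (meson openin_open_Int)
    then have "openin (subtopology N V) {p \<in> V. \<phi> p \<in> S}" unfolding tV
      by (rule back_subst[of "openin (subtopology N V)"]) auto
    then show ?thesis using V openin_trans_full by blast
  qed
qed

lemma diffeo_on_homeomorphic_map:
  assumes "diffeo_on S \<kappa>"
  shows "homeomorphic_map (top_of_set S) (top_of_set (\<kappa> ` S)) \<kappa>"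
proof -
  have inj: "inj_on \<kappa> S" and c: "continuous_on S \<kappa>" "continuous_on (\<kappa> ` S) (inv_into S \<kappa>)"
    using assms smooth_on_continuous_on by (auto simp: diffeo_on_def)
  have "homeomorphic_maps (top_of_set S) (top_of_set (\<kappa> ` S)) \<kappa> (inv_into S \<kappa>)"
    unfolding homeomorphic_maps_def using inj c by (auto simp: inv_into_into f_inv_into_f)
  then show ?thesis by (rule homeomorphic_maps_imp_map)
qed

text \<open>
  Coordinate changes in the image of a chart of \<open>A\<close> yield charts of the smooth structure: the transition
  maps of the new chart are the old ones composed with \<open>\<kappa>\<close> or its inverse.
\<close>

lemma compatible_chart_compose:
  assumes N: "smooth_manifold N A" and c: "(V, \<phi>) \<in> A"
    and \<kappa>: "diffeo_on S \<kappa>" and S: "S \<subseteq> \<phi> ` V"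
  shows "compatible_chart N A ({p \<in> V. \<phi> p \<in> S}, \<kappa> \<circ> \<phi>)"
    "\<And>y. y \<in> \<kappa> ` S \<Longrightarrow> inv_into {p \<in> V. \<phi> p \<in> S} (\<kappa> \<circ> \<phi>) y = inv_into V \<phi> (inv_into S \<kappa> y)"
proof -
  let ?V = "{p \<in> V. \<phi> p \<in> S}" and ?h = "\<kappa> \<circ> \<phi>"
  have ch: "is_chart N (V, \<phi>)" using N c by (auto simp: smooth_manifold_def)
  note chf = is_chart_facts[OF ch]
  have oS: "open S" "open (\<kappa> ` S)" "inj_on \<kappa> S" and sm: "smooth_on S \<kappa>" "smooth_on (\<kappa> ` S) (inv_into S \<kappa>)"
    using \<kappa> by (auto simp: diffeo_on_def)
  have \<phi>V: "\<phi> ` ?V = S" using S by auto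
  have hV: "?h ` ?V = \<kappa> ` S" using \<phi>V by (metis image_comp)
  have injh: "inj_on ?h ?V"
    by (rule comp_inj_on) (use chf(3) oS(3) \<phi>V in \<open>auto intro: inj_on_subset\<close>)
  show inv: "inv_into ?V ?h y = inv_into V \<phi> (inv_into S \<kappa> y)" if y: "y \<in> \<kappa> ` S" for y
  proof -
    obtain x where x: "x \<in> S" "y = \<kappa> x" using y by auto
    obtain p where p: "p \<in> V" "x = \<phi> p" using x S by auto
    have "inv_into ?V ?h (?h p) = p" by (rule inv_into_f_f[OF injh]) (use p x in auto)
    then show ?thesis using x p oS(3) chf(3) by (simp add: inv_into_f_f)
  qed
  have oV: "openin N ?V" by (rule chf(6)[OF oS(1)])
  have "homeomorphic_map (subtopology N V) (top_of_set (\<phi> ` V)) \<phi>" using ch by (simp add: is_chart_def)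
  then have "homeomorphic_map (subtopology (subtopology N V) ?V) (subtopology (top_of_set (\<phi> ` V)) S) \<phi>"
    by (rule homeomorphic_map_subtopologies) (use S chf(2) in auto)
  moreover have "V \<inter> ?V = ?V" "\<phi> ` V \<inter> S = S" using S by auto
  ultimately have "homeomorphic_map (subtopology N ?V) (top_of_set S) \<phi>"
    by (simp add: subtopology_subtopology)
  from homeomorphic_map_compose[OF this diffeo_on_homeomorphic_map[OF \<kappa>]]
  have chart: "is_chart N (?V, ?h)" unfolding is_chart_def using oV oS(2) hV by simp
  have "smooth_transition (?V, ?h) d \<and> smooth_transition d (?V, ?h)" if d: "d \<in> A" for d
  proof -
    obtain W \<psi> where dd: "d = (W, \<psi>)" by (cases d)
    have chd: "is_chart N (W, \<psi>)" using N d dd by (auto simp: smooth_manifold_def)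
    note chdf = is_chart_facts[OF chd]
    have t1: "smooth_on (\<phi> ` (V \<inter> W)) (\<psi> \<circ> inv_into V \<phi>)" and t2: "smooth_on (\<psi> ` (W \<inter> V)) (\<phi> \<circ> inv_into W \<psi>)"
      using N c d dd by (auto simp: smooth_manifold_def smooth_transition_def)
    have oVW: "openin N (V \<inter> W)" using chf(1) chdf(1) by blast
    have o1: "open (\<phi> ` (V \<inter> W))" by (rule chf(5)[OF oVW]) auto
    have o2: "open (\<psi> ` (W \<inter> V))" using chdf(5)[of "V \<inter> W"] oVW by (simp add: Int_commute)
    let ?R = "S \<inter> \<phi> ` (V \<inter> W)"
    have hVW: "?h ` (?V \<inter> W) = \<kappa> ` ?R"
    proof -
      have "\<phi> ` (?V \<inter> W) = ?R" using chf(3) by (auto simp: inj_on_def)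
      then show ?thesis by (metis image_comp)
    qed
    have oR: "open (?h ` (?V \<inter> W))"
      by (rule is_chart_facts(5)[OF chart]) (use oV chdf(1) in auto)
    have "smooth_on (?h ` (?V \<inter> W)) (\<psi> \<circ> inv_into ?V ?h)"
    proof (subst smooth_on_cong[OF oR])
      show "(\<psi> \<circ> inv_into ?V ?h) y = (\<psi> \<circ> inv_into V \<phi>) (inv_into S \<kappa> y)" if "y \<in> ?h ` (?V \<inter> W)" for y
        using inv[of y] that hVW by auto
      show "smooth_on (?h ` (?V \<inter> W)) (\<lambda>y. (\<psi> \<circ> inv_into V \<phi>) (inv_into S \<kappa> y))"
      proof (rule smooth_on_compose[OF t1 _ oR o1])
        show "smooth_on (?h ` (?V \<inter> W)) (inv_into S \<kappa>)"
          by (rule smooth_on_subset[OF sm(2)]) (use hVW in auto)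
        show "inv_into S \<kappa> ` ?h ` (?V \<inter> W) \<subseteq> \<phi> ` (V \<inter> W)"
          unfolding hVW using oS(3) by (auto simp: inv_into_f_f)
      qed
    qed
    moreover have "smooth_on (\<psi> ` (W \<inter> ?V)) (?h \<circ> inv_into W \<psi>)"
    proof -
      have o3: "open (\<psi> ` (W \<inter> ?V))" by (rule chdf(5)) (use oV chdf(1) in auto)
      have "smooth_on (\<psi> ` (W \<inter> ?V)) (\<lambda>y. \<kappa> ((\<phi> \<circ> inv_into W \<psi>) y))"
      proof (rule smooth_on_compose[OF sm(1) smooth_on_subset[OF t2] o3 oS(1)])
        show "(\<phi> \<circ> inv_into W \<psi>) ` \<psi> ` (W \<inter> ?V) \<subseteq> S" using chdf(3) by (auto simp: inv_into_f_f)
      qed auto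
      then show ?thesis by (simp add: o_def)
    qed
    ultimately show ?thesis by (simp add: dd smooth_transition_def)
  qed
  then show "compatible_chart N A (?V, ?h)" unfolding compatible_chart_def using chart by blast
qed

lemma whitney_umbrella_point_of_germ:
  fixes g :: "'a \<Rightarrow> real^'p::finite" and \<phi> :: "'a \<Rightarrow> real^'n::finite"
  assumes N: "smooth_manifold N A" and c: "(V, \<phi>) \<in> A" and q: "q \<in> V" and sing: "singular_point A g q"
    and W: "whitney_indices i0 yi zi"
    and U: "\<And>x. whitney_indices.umbrella i0 yi zi x = (umbrella_normal_form x :: real^'p)"
    and germ: "whitney_indices.umbrella_germ i0 yi zi (in_chart g (V, \<phi>)) (\<phi> q)"
  shows "whitney_umbrella_point N A g q"
proof -
  let ?G = "in_chart g (V, \<phi>)"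
  obtain \<kappa> H where \<kappa>: "locdiff \<kappa> (\<phi> q)" "\<kappa> (\<phi> q) = 0" and H: "locdiff H (?G (\<phi> q))" "H (?G (\<phi> q)) = 0"
    and ev: "\<forall>\<^sub>F y in nhds (\<phi> q). H (?G y) = umbrella_normal_form (\<kappa> y)"
    using germ unfolding whitney_indices.umbrella_germ_def[OF W] U by blast
  have ch: "is_chart N (V, \<phi>)" using N c by (auto simp: smooth_manifold_def)
  note chf = is_chart_facts[OF ch]
  have "\<forall>\<^sub>F y in nhds (\<phi> q). y \<in> \<phi> ` V" using chf(4) q by (intro eventually_nhds_in_open) auto
  then have "\<forall>\<^sub>F y in nhds (\<phi> q). H (?G y) = umbrella_normal_form (\<kappa> y) \<and> y \<in> \<phi> ` V"
    using ev by eventually_elim simp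
  then obtain S where S: "open S" "\<phi> q \<in> S" "diffeo_on S \<kappa>"
    and SG: "\<And>y. y \<in> S \<Longrightarrow> H (?G y) = umbrella_normal_form (\<kappa> y) \<and> y \<in> \<phi> ` V"
    by (rule locdiff_diffeo_on[OF \<kappa>(1)]) (rule that)
  obtain Y where Y: "?G (\<phi> q) \<in> Y" "diffeo_on Y H"
    using locdiff_diffeo_on[OF H(1), of "\<lambda>_. True"] by auto
  have SV: "S \<subseteq> \<phi> ` V" using SG by blast
  note cc = compatible_chart_compose[OF N c S(3) SV]
  have Gq: "?G (\<phi> q) = g q" using chf(3) q by (simp add: in_chart_def inv_into_f_f)
  have "open (\<kappa> ` S)" "0 \<in> \<kappa> ` S" using S \<kappa>(2) by (auto simp: diffeo_on_def image_iff)
  then have "\<forall>\<^sub>F x in nhds 0. x \<in> \<kappa> ` S" by (rule eventually_nhds_in_open)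
  then have "\<forall>\<^sub>F x in nhds 0. (H \<circ> g \<circ> inv_into {p \<in> V. \<phi> p \<in> S} (\<kappa> \<circ> \<phi>)) x = umbrella_normal_form x"
  proof eventually_elim
    case (elim x)
    then obtain y where y: "y \<in> S" "x = \<kappa> y" by auto
    have "inv_into S \<kappa> x = y" using y S(3) by (simp add: diffeo_on_def inv_into_f_f)
    then show ?case using cc(2)[OF elim] SG[OF y(1)] y(2) by (simp add: in_chart_def)
  qed
  then show ?thesis
    unfolding whitney_umbrella_point_def using sing cc(1) q S(2) \<kappa>(2) Y H(2) Gq
    by (intro conjI exI[of _ "{p \<in> V. \<phi> p \<in> S}"] exI[of _ "\<kappa> \<circ> \<phi>"] exI[of _ Y] exI[of _ H]) auto
qed

lemma rank_at_full_iff_inj: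
  fixes c :: "('a, 'n::finite) chart"
  assumes "smooth_map A g" "c \<in> A" "q \<in> fst c"
  shows "rank_at c g q = CARD('n) \<longleftrightarrow> inj (fd (in_chart g c) (snd c q))"
    "rank_at c g q < CARD('n) \<longleftrightarrow> \<not> inj (fd (in_chart g c) (snd c q))"
proof -
  have "linear (fd (in_chart g c) (snd c q))"
    by (rule smooth_on_linear_fderiv) (use assms in \<open>auto simp: smooth_map_def\<close>)
  then have "(*v) (jacobian (in_chart g c) (at (snd c q))) = fd (in_chart g c) (snd c q)"
    by (auto simp: jacobian_def)
  then show "rank_at c g q = CARD('n) \<longleftrightarrow> inj (fd (in_chart g c) (snd c q))"
    "rank_at c g q < CARD('n) \<longleftrightarrow> \<not> inj (fd (in_chart g c) (snd c q))"
    by (simp_all add: rank_at_def full_rank_injective less_rank_noninjective)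
qed

text \<open>
  The genericity argument controls the charts of a countable subatlas, whereas a singular point may be
  witnessed by any chart of \<open>A\<close>. Transition maps carry kernel vectors from one chart to the other.
\<close>

lemma singular_in_other_chart:
  fixes g :: "'a \<Rightarrow> real^'p::finite" and A :: "('a, 'n::finite) chart set"
  assumes N: "smooth_manifold N A" and g: "smooth_map A g" and sing: "singular_point A g q"
    and d: "(W, \<psi>) \<in> A" "q \<in> W"
  obtains v where "v \<noteq> 0" "fd (in_chart g (W, \<psi>)) (\<psi> q) v = 0"
proof -
  obtain V \<phi> where c: "(V, \<phi>) \<in> A" "q \<in> V" and rk: "rank_at (V, \<phi>) g q < CARD('n)"
    using sing unfolding singular_point_def by force
  have chc: "is_chart N (V, \<phi>)" and chd: "is_chart N (W, \<psi>)" using N c d by (auto simp: smooth_manifold_def)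
  note cf = is_chart_facts[OF chc] and df = is_chart_facts[OF chd]
  let ?G = "in_chart g (V, \<phi>)" and ?K = "in_chart g (W, \<psi>)"
  have smG: "smooth_on (\<phi> ` V) ?G" and smK: "smooth_on (\<psi> ` W) ?K"
    using g c d by (auto simp: smooth_map_def)
  define \<tau> where "\<tau> = \<psi> \<circ> inv_into V \<phi>"
  define \<sigma> where "\<sigma> = \<phi> \<circ> inv_into W \<psi>"
  have t: "smooth_on (\<phi> ` (V \<inter> W)) \<tau>" "smooth_on (\<psi> ` (W \<inter> V)) \<sigma>"
    using N c d by (auto simp: smooth_manifold_def smooth_transition_def \<tau>_def \<sigma>_def)
  have oVW: "openin N (V \<inter> W)" using cf(1) df(1) by blast
  have o1: "open (\<phi> ` (V \<inter> W))" by (rule cf(5)[OF oVW]) auto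
  have o2: "open (\<psi> ` (W \<inter> V))" using df(5)[of "V \<inter> W"] oVW by (simp add: Int_commute)
  have \<tau>: "\<tau> (\<phi> p) = \<psi> p" if "p \<in> V" for p using that cf(3) by (simp add: \<tau>_def inv_into_f_f)
  have \<sigma>: "\<sigma> (\<psi> p) = \<phi> p" if "p \<in> W" for p using that df(3) by (simp add: \<sigma>_def inv_into_f_f)
  have q1: "\<phi> q \<in> \<phi> ` (V \<inter> W)" and q2: "\<psi> q \<in> \<psi> ` (W \<inter> V)" using c d by auto
  have t\<tau>: "smooth_near \<tau> (\<phi> q)" by (rule smooth_nearI[OF o1 q1 t(1)])
  have t\<sigma>: "smooth_near \<sigma> (\<psi> q)" by (rule smooth_nearI[OF o2 q2 t(2)])
  have sK: "smooth_near ?K (\<psi> q)" by (rule smooth_nearI[OF df(4) _ smK]) (use d in auto)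
  have evG: "\<forall>\<^sub>F x in nhds (\<phi> q). ?G x = ?K (\<tau> x)"
    using eventually_nhds_in_open[OF o1 q1]
  proof eventually_elim
    case (elim x)
    then obtain p where p: "p \<in> V" "p \<in> W" "x = \<phi> p" by auto
    then show ?case using \<tau>[OF p(1)] cf(3) df(3) by (simp add: in_chart_def inv_into_f_f)
  qed
  have ev\<sigma>: "\<forall>\<^sub>F x in nhds (\<phi> q). \<sigma> (\<tau> x) = x"
    using eventually_nhds_in_open[OF o1 q1] by eventually_elim (auto simp: \<tau> \<sigma>)
  have "\<not> inj (fd ?G (\<phi> q))" using rank_at_full_iff_inj(2)[OF g c(1)] c(2) rk by simp
  moreover have "linear (fd ?G (\<phi> q))" by (rule smooth_on_linear_fderiv[OF smG]) (use c in auto)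
  ultimately obtain v where v: "v \<noteq> 0" "fd ?G (\<phi> q) v = 0" using linear_injective_0 by blast
  show thesis
  proof
    have "fd ?G (\<phi> q) v = fd ?K (\<psi> q) (fd \<tau> (\<phi> q) v)"
      using fd_cong[OF evG] fd_compose[OF t\<tau>, of ?K v] sK \<tau>[OF c(2)] by simp
    then show "fd ?K (\<psi> q) (fd \<tau> (\<phi> q) v) = 0" using v by simp
    have "fd \<sigma> (\<psi> q) (fd \<tau> (\<phi> q) v) = v"
      using fd_cong[OF ev\<sigma>] fd_compose[OF t\<tau>, of \<sigma> v] t\<sigma> \<tau>[OF c(2)] by simp
    then show "fd \<tau> (\<phi> q) v \<noteq> 0" using v linear_0[OF smooth_near_linear_fd[OF t\<sigma>]] by metis
  qed
qed

theorem corollary2: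
  fixes N :: "'a topology"
    and A :: "('a, 'n::finite) chart set"
    and f :: "'a \<Rightarrow> real^'m::finite"
    and U :: "(real^'m) set"
    and F :: "real^'m \<Rightarrow> real^'p::finite"
  assumes "smooth_manifold N A"
    and "CARD('n) \<ge> 2"
    and "CARD('p) = 2 * CARD('n) - 1"
    and "open U"
    and "immersion A f"
    and "f ` topspace N \<subseteq> U"
    and "smooth_on U F"
  shows "\<exists>\<Sigma> \<subseteq> {\<pi> :: real^'m \<Rightarrow> real^'p. linear \<pi>}.
    matrix ` \<Sigma> \<in> null_sets (lebesgue :: (real^'m^'p) measure) \<and>
    (\<forall>\<pi> \<in> {\<pi>. linear \<pi>} - \<Sigma>. \<forall>q.
      singular_point A ((\<lambda>x. F x + \<pi> x) \<circ> f) q \<longrightarrow>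
      whitney_umbrella_point N A ((\<lambda>x. F x + \<pi> x) \<circ> f) q)"
proof -
  note N = assms(1) and card = assms(3)
  have charts: "is_chart N c" if "c \<in> A" for c using N that by (auto simp: smooth_manifold_def)
  have cover: "(\<Union>c\<in>A. fst c) = topspace N" using N by (simp add: smooth_manifold_def)
  have chf: "openin N (fst c)" "open (snd c ` fst c)" "fst c \<subseteq> topspace N" "inj_on (snd c) (fst c)" if "c \<in> A" for c
    using is_chart_facts[of N "fst c" "snd c"] charts[OF that] by auto
  have imm: "smooth_map A f" "\<And>c q. c \<in> A \<Longrightarrow> q \<in> fst c \<Longrightarrow> rank_at c f q = CARD('n)"
    using assms(5) by (auto simp: immersion_def)
  have fsm: "smooth_on (snd c ` fst c) (in_chart f c)" if "c \<in> A" for c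
    using imm(1) that by (simp add: smooth_map_def)
  have inU: "in_chart f c ` (snd c ` fst c) \<subseteq> U" if "c \<in> A" for c
  proof clarify
    fix p assume "p \<in> fst c"
    then have "in_chart f c (snd c p) = f p" "p \<in> topspace N"
      using chf(3,4)[OF that] by (auto simp: in_chart_def split_def inv_into_f_f)
    then show "in_chart f c (snd c p) \<in> U" using assms(6) by auto
  qed
  have Fsm: "smooth_on (snd c ` fst c) (\<lambda>y. F (in_chart f c y))" if "c \<in> A" for c
    by (rule smooth_on_compose[OF assms(7) fsm[OF that] chf(2)[OF that] assms(4) inU[OF that]])
  \<comment> \<open>second countability: countably many charts cover \<open>N\<close>, so that a countable union of null sets results\<close>
  have "\<exists>\<V>. countable \<V> \<and> \<V> \<subseteq> fst ` A \<and> \<Union>\<V> = topspace N"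
    using second_countable_imp_Lindelof_space[of N] N cover chf(1)
    unfolding Lindelof_space_def smooth_manifold_def by (metis (no_types, lifting) imageE)
  then obtain C where C: "countable C" "C \<subseteq> A" "(\<Union>c\<in>C. fst c) = topspace N"
    using countable_subset_image[of _ fst A] by metis
  define Bad where "Bad c = {M :: real^'m^'p. \<exists>x\<in>snd c ` fst c. \<exists>v. v \<noteq> 0 \<and>
      fd (\<lambda>y. F (in_chart f c y) + M *v in_chart f c y) x v = 0 \<and>
      \<not> whitney_nondegenerate (\<lambda>y. F (in_chart f c y) + M *v in_chart f c y) x v}" for c :: "('a, 'n) chart"
  have "negligible (Bad c)" if c: "c \<in> C" for c
    unfolding Bad_def
  proof (rule negligible_degenerate_perturbations[OF card])
    have cA: "c \<in> A" using c C by auto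
    show "open (snd c ` fst c)" "smooth_on (snd c ` fst c) (in_chart f c)"
      "smooth_on (snd c ` fst c) (\<lambda>y. F (in_chart f c y))"
      using chf(2) fsm Fsm cA by auto
    show "inj (fd (in_chart f c) x)" if "x \<in> snd c ` fst c" for x
      using that rank_at_full_iff_inj(1)[OF imm(1) cA] imm(2)[OF cA] by auto
  qed
  then have neg: "negligible (\<Union>(Bad ` C))"
    using C(1) by (intro negligible_countable_Union) auto
  define \<Sigma> where "\<Sigma> = {\<pi> :: real^'m \<Rightarrow> real^'p. linear \<pi> \<and> matrix \<pi> \<in> \<Union>(Bad ` C)}"
  obtain i0 :: 'n and yi zi :: "'n \<Rightarrow> 'p" where W: "whitney_indices i0 yi zi"
    and umb: "\<And>x. whitney_indices.umbrella i0 yi zi x = umbrella_normal_form x"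
    using whitney_indices_enumeration[OF card] by metis
  have "negligible (matrix ` \<Sigma>)" by (rule negligible_subset[OF neg]) (auto simp: \<Sigma>_def)
  moreover have "whitney_umbrella_point N A ((\<lambda>x. F x + \<pi> x) \<circ> f) q"
    if \<pi>: "linear \<pi>" "\<pi> \<notin> \<Sigma>" and sing: "singular_point A ((\<lambda>x. F x + \<pi> x) \<circ> f) q" for \<pi> q
  proof -
    let ?g = "(\<lambda>x. F x + \<pi> x) \<circ> f"
    have ing: "in_chart ?g c = (\<lambda>y. F (in_chart f c y) + matrix \<pi> *v in_chart f c y)" for c :: "('a, 'n) chart"
      using \<pi>(1) by (auto simp: in_chart_def split_def fun_eq_iff)
    have gsm: "smooth_map A ?g"
      unfolding smooth_map_def ing
      by (intro ballI smooth_on_add Fsm chf(2) smooth_on_linear_compose[OF matrix_vector_mul_linear] fsm)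
    have "q \<in> topspace N" using sing chf(3) unfolding singular_point_def by blast
    then obtain c where "c \<in> C" "q \<in> fst c" using C(3) by blast
    then obtain V \<phi> where c: "(V, \<phi>) \<in> C" "q \<in> V" by (cases c) auto
    have cA: "(V, \<phi>) \<in> A" using c C by auto
    obtain v where v: "v \<noteq> 0" "fd (in_chart ?g (V, \<phi>)) (\<phi> q) v = 0"
      by (rule singular_in_other_chart[OF N gsm sing cA c(2)])
    have "matrix \<pi> \<notin> Bad (V, \<phi>)" using \<pi> c(1) by (auto simp: \<Sigma>_def)
    then have "whitney_nondegenerate (in_chart ?g (V, \<phi>)) (\<phi> q) v"
      using v c(2) unfolding Bad_def ing by auto
    moreover have "smooth_near (in_chart ?g (V, \<phi>)) (\<phi> q)"
      using gsm cA chf(2)[OF cA] c(2) by (intro smooth_nearI[of "\<phi> ` V"]) (auto simp: smooth_map_def)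
    ultimately have "whitney_indices.umbrella_germ i0 yi zi (in_chart ?g (V, \<phi>)) (\<phi> q)"
      using whitney_indices.umbrella_germ_of_whitney_nondegenerate[OF W _ v] by blast
    then show ?thesis by (rule whitney_umbrella_point_of_germ[OF N cA c(2) sing W umb])
  qed
  ultimately show ?thesis
    by (intro exI[of _ \<Sigma>]) (auto simp: \<Sigma>_def negligible_iff_null_sets)
qed

end
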